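(* Let $n\ge 1$ and let $f\in\mathcal S_n^0$. Suppose that $G(z,t)$ is a Herglotz vector field in the class $\mathcal M_n$ such that $f=f^G$, and let $\varphi^G_t$ be the solution of the Loewner ODE for $G$. Then for almost every $t\ge 0$ and for any $h\in\mathcal M_n$ there exists a family of functions $f^{\varepsilon}\in\mathcal S_n^0$ (indexed by all sufficiently small $\varepsilon>0$) such that $$f^{\varepsilon}(z)=f(z)+\varepsilon\, d(f)_z\cdot\left[d(\varphi^G_t)_z\right]^{-1}\left[h\left(\varphi^G_t(z)\right)-G\left(\varphi^G_t(z),t\right)\right]+r^{\varepsilon}(z),\qquad z\in\mathbb B^n,$$ where the error term $r^{\varepsilon}\in\mathrm{Hol}(\mathbb B^n,\mathbb C^n)$ has the property that $r^{\varepsilon}/\varepsilon\to 0$ locally uniformly in $\mathbb B^n$ as $\varepsilon\to 0+$.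
   Context: $\mathbb B^n=\{z\in\mathbb C^n:\|z\|<1\}$ is the Euclidean unit ball, $\mathrm{Hol}(\mathbb B^n,\mathbb C^n)$ is the space of holomorphic maps $\mathbb B^n\to\mathbb C^n$ with the compact-open topology, $\langle\cdot,\cdot\rangle$ is the standard Euclidean (Hermitian) inner product of $\mathbb C^n$, $\mathbb R^+=(0,\infty)$, and $d(f)_z$ (also $df_z$) is the complex derivative (Jacobian) of $f$ at $z$. $\mathcal M_n=\{h\in\mathrm{Hol}(\mathbb B^n,\mathbb C^n): h(0)=0,\ dh_0=-\mathrm{id},\ \mathrm{Re}\,\langle h(z),z\rangle\le 0 \text{ for all } z\in\mathbb B^n\}$. A Herglotz vector field in the class $\mathcal M_n$ is a mapping $G:\mathbb B^n\times\mathbb R^+\to\mathbb C^n$ such that $G(z,\cdot)$ is measurable on $\mathbb R^+$ for every $z\in\mathbb B^n$ and $G(\cdot,t)\in\mathcal M_n$ for a.e. $t\in\mathbb R^+$. For such $G$, $\varphi^G_t$ denotes the unique (locally absolutely continuous in $t$) solution of $\dot\varphi_t(z)=G(\varphi_t(z),t)$ for a.e. $t\ge 0$, $\varphi_0(z)=z\in\mathbb B^n$; each $\varphi_t^G$ is a univalent holomorphic self-map of $\mathbb B^n$. The limit $f^G:=\lim_{t\to\infty}e^t\varphi^G_t$ exists locally uniformly in $\mathbb B^n$. Finally, $\mathcal S_n^0:=\{f^G : G \text{ a Herglotz vector field in the class } \mathcal M_n\}$. *)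

theory Defs
  imports "HOL-Analysis.Analysis"
begin

text \<open>
  The space \<open>\<complex>\<^sup>n\<close> is \<open>complex ^ 'n\<close> with \<open>n = CARD('n)\<close>; its norm is the Euclidean one, so that
  \<open>ball 0 1\<close> is the unit ball.  Maps on the ball are represented by total functions, and no
  definition below depends on their values outside the ball.
\<close>

abbreviation unit_ball :: "(complex ^ 'n::finite) set"
  where "unit_ball \<equiv> ball 0 1"

definition hermitian_inner :: "complex ^ 'n::finite \<Rightarrow> complex ^ 'n \<Rightarrow> complex"
  where "hermitian_inner z w = (\<Sum>i\<in>UNIV. z $ i * cnj (w $ i))"

text \<open>
  Holomorphy is complex Frechet differentiability: the real derivative is multiplication by a
  complex matrix.
\<close>

definition Hol_ball :: "(complex ^ 'n::finite \<Rightarrow> complex ^ 'n) set"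
  where "Hol_ball =
    {f. \<forall>z\<in>unit_ball. \<exists>A :: complex ^ 'n ^ 'n. (f has_derivative (\<lambda>v. A *v v)) (at z)}"

text \<open>
  Since \<^const>\<open>matrix\<close> is taken over \<^typ>\<open>complex\<close>, this is the matrix \<open>A\<close> of the previous
  definition wherever \<open>f\<close> is complex differentiable.
\<close>

definition complex_jacobian :: "(complex ^ 'n::finite \<Rightarrow> complex ^ 'n) \<Rightarrow> complex ^ 'n \<Rightarrow> complex ^ 'n ^ 'n"
  where "complex_jacobian f z = matrix (frechet_derivative f (at z))"

definition class_M :: "(complex ^ 'n::finite \<Rightarrow> complex ^ 'n) set"
  where "class_M =
    {h \<in> Hol_ball. h 0 = 0 \<and> complex_jacobian h 0 = - mat 1 \<and>
       (\<forall>z\<in>unit_ball. Re (hermitian_inner (h z) z) \<le> 0)}"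

definition Herglotz_vector_field :: "(complex ^ 'n::finite \<Rightarrow> real \<Rightarrow> complex ^ 'n) \<Rightarrow> bool"
  where "Herglotz_vector_field G \<longleftrightarrow>
    (\<forall>z\<in>unit_ball. G z \<in> borel_measurable (lebesgue_on {0<..})) \<and>
    (AE t in lebesgue_on {0<..}. (\<lambda>z. G z t) \<in> class_M)"

definition absolutely_continuous_on :: "real set \<Rightarrow> (real \<Rightarrow> 'a::real_normed_vector) \<Rightarrow> bool"
  where "absolutely_continuous_on S u \<longleftrightarrow>
    (\<forall>e>0. \<exists>d>0. \<forall>I :: (real \<times> real) set.
       finite I \<and>
       (\<forall>(a, b)\<in>I. a \<le> b \<and> {a..b} \<subseteq> S) \<and>
       pairwise (\<lambda>(a, b) (a', b'). {a<..<b} \<inter> {a'<..<b'} = {}) I \<and>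
       (\<Sum>(a, b)\<in>I. b - a) < d
       \<longrightarrow> (\<Sum>(a, b)\<in>I. norm (u b - u a)) < e)"

text \<open>
  \<open>Loewner_flow G \<phi>\<close> says that \<open>\<phi>\<close> solves the Loewner equation driven by \<open>G\<close>.  For a
  Herglotz vector field the solution exists and is unique on the ball for times \<open>t \<ge> 0\<close>, so
  there is no choice in \<open>\<phi>\<close>.
\<close>

definition Loewner_flow ::
  "(complex ^ 'n::finite \<Rightarrow> real \<Rightarrow> complex ^ 'n) \<Rightarrow> (real \<Rightarrow> complex ^ 'n \<Rightarrow> complex ^ 'n) \<Rightarrow> bool"
  where "Loewner_flow G \<phi> \<longleftrightarrow>
    (\<forall>z\<in>unit_ball.
       \<phi> 0 z = z \<and>
       (\<forall>t\<ge>0. \<phi> t z \<in> unit_ball) \<and>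
       (\<forall>T>0. absolutely_continuous_on {0..T} (\<lambda>t. \<phi> t z)) \<and>
       (AE t in lebesgue_on {0<..}. ((\<lambda>s. \<phi> s z) has_vector_derivative G (\<phi> t z) t) (at t)))"

text \<open>
  Locally uniform convergence on the ball is uniform convergence on compact subsets.
\<close>

definition locally_uniform_limit_ball ::
  "('i \<Rightarrow> complex ^ 'n::finite \<Rightarrow> complex ^ 'n) \<Rightarrow> (complex ^ 'n \<Rightarrow> complex ^ 'n) \<Rightarrow> 'i filter \<Rightarrow> bool"
  where "locally_uniform_limit_ball u f F \<longleftrightarrow>
    (\<forall>K. compact K \<and> K \<subseteq> unit_ball \<longrightarrow> uniform_limit K u f F)"

text \<open>
  \<open>Loewner_limit \<phi> f\<close> says that \<open>f\<close> is the map \<open>f\<^sup>G\<close> if \<open>\<phi>\<close> is the flow of \<open>G\<close>.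
\<close>

definition Loewner_limit ::
  "(real \<Rightarrow> complex ^ 'n::finite \<Rightarrow> complex ^ 'n) \<Rightarrow> (complex ^ 'n \<Rightarrow> complex ^ 'n) \<Rightarrow> bool"
  where "Loewner_limit \<phi> f \<longleftrightarrow>
    locally_uniform_limit_ball (\<lambda>t z. exp t *\<^sub>R \<phi> t z) f at_top"

definition class_S0 :: "(complex ^ 'n::finite \<Rightarrow> complex ^ 'n) set"
  where "class_S0 =
    {f. \<exists>G \<phi>. Herglotz_vector_field G \<and> Loewner_flow G \<phi> \<and> Loewner_limit \<phi> f}"

end

theory Submission
  imports Defs "HOL-Complex_Analysis.Complex_Analysis"
begin

text \<open>
  The variation is a needle variation: \<open>G\<close> is replaced by \<open>h\<close> on a window of length \<open>\<epsilon>\<close> that ends at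
  time \<open>t\<close>.  Let \<open>g\<close> be the limit map of the shifted field \<open>G (\<cdot>, t + \<cdot>)\<close>.  Then
  \<open>f = e\<^sup>t g \<circ> \<phi>\<^sub>t\<close> and the perturbed limit map is \<open>e\<^sup>t g \<circ> \<psi>\<^sub>t\<close>, where \<open>\<psi>\<close> is the perturbed flow.  If
  \<open>t\<close> is a point of differentiability of \<open>s \<mapsto> \<phi>\<^sub>s(z)\<close> for all \<open>z\<close> in a countable dense set, then
  \<open>\<psi>\<^sub>t = \<phi>\<^sub>t + \<epsilon> (h (\<phi>\<^sub>t) - G (\<phi>\<^sub>t, t)) + o(\<epsilon>)\<close> locally uniformly, and the chain rule
  \<open>df = e\<^sup>t dg d\<phi>\<^sub>t\<close> turns this into the stated expansion.  The estimates rest on uniform bounds for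
  the class, which come from the Schwarz lemma on complex lines through the origin and the maximum
  principle on the others.
\<close>

section \<open>Lebesgue differentiation and absolute continuity\<close>

text \<open>The driving field is only measurable in time, so no estimate may use its regularity in
  \<open>s\<close>. The bounds on the fields therefore depend on a radius \<open>r < 1\<close> alone
  and hold for all of \<open>class_M\<close>; they apply along whole trajectories because
  \<open>inner (h z) z \<le> 0\<close> makes the closed balls about 0 invariant. The exceptional
  null set of times must be chosen before \<open>h\<close>. Only the average of \<open>G\<close>
  over the window, along the unperturbed flow, needs Lebesgue differentiation; \<open>h\<close> does
  not depend on time, and its continuity suffices. Exceptional times are removed once and for all:
  the field is redefined there and the equation is used in integrated form. The passage between the
  two forms is the fundamental theorem for absolutely continuous functions one way and Lebesgue
  differentiation the other way. Holomorphy of the error term is not visible in the formula, which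
  contains an inverse Jacobian. It follows because the first-order term is a locally uniform limit
  of holomorphic difference quotients.\<close>

lemma negligible_henstock_quotient:
  fixes f :: "real \<Rightarrow> 'a::euclidean_space"
  assumes int: "f integrable_on {a..b}" and "\<mu> > 0"
  shows "negligible {x\<in>{a..b}. \<forall>d>0. \<exists>y\<in>{a..b}. y \<noteq> x \<and> \<bar>y - x\<bar> < d \<and>
    \<mu> * \<bar>y - x\<bar> < norm (integral {a..y} f - integral {a..x} f - (y - x) *\<^sub>R f x)}"
    (is "negligible ?E")
  unfolding negligible_outer_le
proof (intro allI impI)
  fix e :: real assume "e > 0"
  define F where "F = (\<lambda>t. integral {a..t} f)"
  define E where "E = ?E"
  \<comment> \<open>Each bad point is an end point of an interval on which the Henstock error
    exceeds \<mu> times the length. Disjoint such intervals form a tagged partial division, so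
    Henstock's lemma bounds their total length by \<open>e / 5\<close>; the 5 pays for the 5-fold
    enlargement in Vitali's covering lemma.\<close>
  have pos: "e * \<mu> / 5 > 0" using \<open>e > 0\<close> \<open>\<mu> > 0\<close> by simp
  have int': "f integrable_on cbox a b" using int by simp
  obtain \<gamma> where g: "gauge \<gamma>" and hen: "\<And>p. \<lbrakk>p tagged_partial_division_of (cbox a b); \<gamma> fine p\<rbrakk> \<Longrightarrow>
    sum (\<lambda>(x,k). norm(measure lborel k *\<^sub>R f x - integral k f)) p < e * \<mu> / 5"
    by (rule Henstock_lemma[OF int' pos]) (rule that)
  define Q where "Q = (\<lambda>x y. y\<in>{a..b} \<and> y \<noteq> x \<and> cball ((x+y)/2) (\<bar>y-x\<bar>/2) \<subseteq> \<gamma> x \<and>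
       \<mu> * \<bar>y - x\<bar> < norm (F y - F x - (y - x) *\<^sub>R f x))"
  have "\<exists>y. Q x y" if "x \<in> E" for x
  proof -
    have "open (\<gamma> x)" "x \<in> \<gamma> x" using g by (auto simp: gauge_def)
    then obtain d where "d > 0" "ball x d \<subseteq> \<gamma> x" by (meson open_contains_ball)
    then obtain y where y: "y\<in>{a..b}" "y \<noteq> x" "\<bar>y - x\<bar> < d"
      "\<mu> * \<bar>y - x\<bar> < norm (F y - F x - (y - x) *\<^sub>R f x)"
      using \<open>x \<in> E\<close> \<open>d > 0\<close> unfolding E_def F_def mem_Collect_eq by blast
    have "cball ((x+y)/2) (\<bar>y-x\<bar>/2) \<subseteq> ball x d"
      using y(3) by (auto simp: dist_real_def abs_if field_simps split: if_splits)
    with y \<open>ball x d \<subseteq> \<gamma> x\<close> show ?thesis unfolding Q_def by (intro exI[of _ y]) auto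
  qed
  then have "\<forall>x\<in>E. \<exists>y. Q x y" by (rule ballI)
  from bchoice[OF this] obtain Y where Y0: "\<forall>x\<in>E. Q x (Y x)" ..
  have Y: "Y x\<in>{a..b} \<and> Y x \<noteq> x \<and> cball ((x+Y x)/2) (\<bar>Y x-x\<bar>/2) \<subseteq> \<gamma> x \<and>
       \<mu> * \<bar>Y x - x\<bar> < norm (F (Y x) - F x - (Y x - x) *\<^sub>R f x)" if "x \<in> E" for x
    using bspec[OF Y0 that] unfolding Q_def .
  \<comment> \<open>The ball with this centre and radius is the interval between \<open>x\<close>
    and \<open>Y x\<close>. The tag \<open>x\<close> is one of its end points, so a one-sided
    failure at \<open>x\<close> is enough.\<close>
  define c where "c = (\<lambda>x. (x + Y x)/2)"
  define r where "r = (\<lambda>x. \<bar>Y x - x\<bar>/2)"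
  have ab: "\<And>x. x \<in> E \<Longrightarrow> x \<in> {a..b}" unfolding E_def by blast
  have rpos: "0 < r x \<and> r x \<le> \<bar>b - a\<bar>" if "x \<in> E" for x
    using Y[OF that] ab[OF that] by (auto simp: r_def)
  have xin: "x \<in> cball (c x) (r x)" for x by (auto simp: c_def r_def dist_real_def)
  then have cov: "E \<subseteq> (\<Union>x\<in>E. cball (c x) (r x))" by blast
  obtain C where C: "countable C" "C \<subseteq> E"
     "pairwise (\<lambda>i j. disjnt (cball (c i) (r i)) (cball (c j) (r j))) C"
     "E \<subseteq> (\<Union>i\<in>C. cball (c i) (5 * r i))"
    by (rule Vitali_covering_lemma_cballs[OF cov rpos]) (assumption, rule that)
  have cb: "cball (c x) (r x) = {min x (Y x)..max x (Y x)}" for x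
    by (auto simp: c_def r_def dist_real_def abs_if field_simps split: if_splits)
  have bound: "(\<Sum>i\<in>D. measure lebesgue (cball (c i) (5 * r i))) \<le> e" if D: "D \<subseteq> C" "finite D" for D
  proof -
    define p where "p = (\<lambda>x. (x, cball (c x) (r x))) ` D"
    have DE: "\<And>x. x \<in> D \<Longrightarrow> x \<in> E" using D C by blast
    have "p tagged_partial_division_of cbox a b"
      unfolding tagged_partial_division_of_def
    proof (intro conjI allI impI)
      show "finite p" using D by (simp add: p_def)
      fix x K assume "(x,K) \<in> p"
      then have x: "x \<in> D" and K: "K = cball (c x) (r x)" by (auto simp: p_def)
      show "x \<in> K" using K xin by simp
      show "K \<subseteq> cbox a b" using Y[OF DE[OF x]] ab[OF DE[OF x]] unfolding K cb by auto
      show "\<exists>a b. K = cbox a b" unfolding K cb using box_real by metis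
    next
      fix x1 K1 x2 K2 assume A: "(x1, K1) \<in> p \<and> (x2, K2) \<in> p \<and> (x1, K1) \<noteq> (x2, K2)"
      then have "x1 \<in> D" "x2 \<in> D" "x1 \<noteq> x2" and K: "K1 = cball (c x1) (r x1)" "K2 = cball (c x2) (r x2)"
        by (auto simp: p_def)
      then have "disjnt K1 K2" using C(3) D unfolding pairwise_def by blast
      then show "interior K1 \<inter> interior K2 = {}"
        using interior_subset by (fastforce simp: disjnt_def)
    qed
    moreover have "\<gamma> fine p"
      using Y DE by (auto simp: fine_def p_def c_def r_def)
    ultimately have s: "sum (\<lambda>(x,k). norm(measure lborel k *\<^sub>R f x - integral k f)) p < e * \<mu> / 5" by (rule hen)
    have inj: "inj_on (\<lambda>x. (x, cball (c x) (r x))) D" by (auto simp: inj_on_def)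
    have le_term: "\<mu> * (2 * r x) \<le> norm(measure lborel (cball (c x) (r x)) *\<^sub>R f x - integral (cball (c x) (r x)) f)"
      if "x \<in> D" for x
    proof -
      have i: "integral {u..v} f = F v - F u" if "a \<le> u" "u \<le> v" "v \<le> b" for u v
        using Henstock_Kurzweil_Integration.integral_combine[OF that(1,2)] integrable_on_subinterval[OF int, of a v] that
        unfolding F_def by (metis add_diff_cancel_left' atLeastatMost_subset_iff order_refl)
      note y = Y[OF DE[OF that]] and x = ab[OF DE[OF that]]
      have "norm(measure lborel (cball (c x) (r x)) *\<^sub>R f x - integral (cball (c x) (r x)) f)
          = norm (F (Y x) - F x - (Y x - x) *\<^sub>R f x)"
      proof (cases "x \<le> Y x")
        case True
        then show ?thesis using y x unfolding cb by (simp add: min_def max_def i norm_minus_commute)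
      next
        case False
        then show ?thesis using y x unfolding cb
          by (simp add: min_def max_def i) (metis (no_types, lifting) add.commute add_diff_eq diff_diff_eq2 minus_diff_eq scaleR_minus_left diff_minus_eq_add)
      qed
      moreover have "\<mu> * (2 * r x) = \<mu> * \<bar>Y x - x\<bar>" by (simp add: r_def)
      ultimately show ?thesis using y by linarith
    qed
    have "\<mu> * (\<Sum>x\<in>D. 2 * r x) \<le> sum (\<lambda>x. norm(measure lborel (cball (c x) (r x)) *\<^sub>R f x - integral (cball (c x) (r x)) f)) D"
      unfolding sum_distrib_left by (rule sum_mono) (rule le_term)
    also have "\<dots> = sum (\<lambda>(x,k). norm(measure lborel k *\<^sub>R f x - integral k f)) p"
      unfolding p_def by (subst sum.reindex[OF inj]) simp
    also note s
    finally have "(\<Sum>x\<in>D. 2 * r x) < e / 5" using \<open>\<mu> > 0\<close> by (simp add: field_simps)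
    moreover have "(\<Sum>i\<in>D. measure lebesgue (cball (c i) (5 * r i))) = (\<Sum>x\<in>D. 5 * (2 * r x))"
    proof (rule sum.cong[OF refl])
      fix x assume "x \<in> D"
      then have "r x > 0" using rpos DE by blast
      then show "measure lebesgue (cball (c x) (5 * r x)) = 5 * (2 * r x)"
        by (simp add: cball_eq_atLeastAtMost)
    qed
    ultimately show ?thesis by (simp add: sum_distrib_left[symmetric])
  qed
  have "\<exists>T. E \<subseteq> T \<and> T \<in> lmeasurable \<and> measure lebesgue T \<le> e"
  proof (intro exI conjI)
    have bound': "measure lebesgue (\<Union>i\<in>D. cball (c i) (5 * r i)) \<le> e" if D: "D \<subseteq> C" "finite D" for D
      using measure_UNION_le[OF D(2), of "\<lambda>i. cball (c i) (5 * r i)" lebesgue] bound[OF D] by simp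
    show "(\<Union>i\<in>C. cball (c i) (5 * r i)) \<in> lmeasurable"
      by (rule fmeasurable_UN_bound[OF \<open>countable C\<close> _ bound']) auto
    show "measure lebesgue (\<Union>i\<in>C. cball (c i) (5 * r i)) \<le> e"
      by (rule measure_UN_bound[OF \<open>countable C\<close> _ bound']) auto
  qed (rule C(4))
  then show "\<exists>T. ?E \<subseteq> T \<and> T \<in> lmeasurable \<and> measure lebesgue T \<le> e"
    unfolding E_def .
qed

theorem integral_has_vector_derivative_ae:
  fixes f :: "real \<Rightarrow> 'a::euclidean_space"
  assumes int: "f integrable_on {a..b}"
  shows "negligible {x\<in>{a<..<b}. \<not> ((\<lambda>t. integral {a..t} f) has_vector_derivative f x) (at x)}"
proof (rule negligible_subset)
  define F where "F = (\<lambda>t. integral {a..t} f)"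
  define E where "E = (\<lambda>m::nat. {x\<in>{a..b}. \<forall>d>0. \<exists>y\<in>{a..b}. y \<noteq> x \<and> \<bar>y - x\<bar> < d \<and>
    inverse (Suc m) * \<bar>y - x\<bar> < norm (F y - F x - (y - x) *\<^sub>R f x)})"
  show "negligible (\<Union>m. E m)"
    unfolding E_def F_def
    by (rule negligible_Union_nat, rule negligible_henstock_quotient[OF int]) simp
  show "{x\<in>{a<..<b}. \<not> ((\<lambda>t. integral {a..t} f) has_vector_derivative f x) (at x)} \<subseteq> (\<Union>m. E m)"
  proof (rule subsetI, rule ccontr)
    fix x assume x: "x \<in> {x\<in>{a<..<b}. \<not> ((\<lambda>t. integral {a..t} f) has_vector_derivative f x) (at x)}"
      and no: "x \<notin> (\<Union>m. E m)"
    have "(F has_vector_derivative f x) (at x)"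
      unfolding has_vector_derivative_def has_derivative_at_alt
    proof (intro conjI allI impI)
      show "bounded_linear (\<lambda>h. h *\<^sub>R f x)" by (rule bounded_linear_scaleR_left)
      fix e :: real assume "e > 0"
      then obtain m where m: "inverse (real (Suc m)) < e" using reals_Archimedean by blast
      from no x obtain d where d: "d > 0" "\<And>y. y\<in>{a..b} \<Longrightarrow> y \<noteq> x \<Longrightarrow> \<bar>y - x\<bar> < d \<Longrightarrow>
        norm (F y - F x - (y - x) *\<^sub>R f x) \<le> inverse (real (Suc m)) * \<bar>y - x\<bar>"
      proof -
        have "x \<notin> E m" "x \<in> {a..b}" using no x by auto
        then have "\<exists>d>0. \<forall>y\<in>{a..b}. y \<noteq> x \<longrightarrow> \<bar>y - x\<bar> < d \<longrightarrow>
            norm (F y - F x - (y - x) *\<^sub>R f x) \<le> inverse (real (Suc m)) * \<bar>y - x\<bar>"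
          unfolding E_def mem_Collect_eq by (meson not_less)
        then show thesis using that by blast
      qed
      show "\<exists>d>0. \<forall>y. norm (y - x) < d \<longrightarrow> norm (F y - F x - (y - x) *\<^sub>R f x) \<le> e * norm (y - x)"
      proof (intro exI[of _ "min d (min (x - a) (b - x))"] conjI allI impI)
        show "0 < min d (min (x - a) (b - x))" using d x by auto
        fix y assume y: "norm (y - x) < min d (min (x - a) (b - x))"
        show "norm (F y - F x - (y - x) *\<^sub>R f x) \<le> e * norm (y - x)"
        proof (cases "y = x")
          case False
          have "norm (F y - F x - (y - x) *\<^sub>R f x) \<le> inverse (real (Suc m)) * \<bar>y - x\<bar>"
            using y False by (intro d(2)) auto
          also have "\<dots> \<le> e * \<bar>y - x\<bar>" using m by (intro mult_right_mono) auto
          finally show ?thesis by simp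
        qed simp
      qed
    qed
    then show False using x by (simp add: F_def)
  qed
qed

text \<open>For the Henstock-Kurzweil integral it is enough to control Riemann sums. Tags outside
  \<open>N\<close> are handled by differentiability (the straddle estimate). The intervals with tags
  in \<open>N\<close> lie in an open set of small measure, where absolute continuity makes the
  increments of \<open>u\<close> small in sum.\<close>

lemma fundamental_theorem_absolutely_continuous:
  fixes u :: "real \<Rightarrow> 'a::euclidean_space"
  assumes ab: "a \<le> b" and ac: "absolutely_continuous_on {a..b} u" and N: "negligible N"
    and der: "\<And>x. x \<in> {a..b} - N \<Longrightarrow> (u has_vector_derivative g x) (at x within {a..b})"
  shows "(g has_integral u b - u a) {a..b}"
proof -
  \<comment> \<open>With the value 0 on \<open>N\<close>, a tag in \<open>N\<close> contributes
    nothing but the increment of \<open>u\<close> to the error.\<close>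
  define h where "h = (\<lambda>x. if x \<in> N then 0 else g x)"
  have "(h has_integral u b - u a) {a..b}"
    unfolding has_integral_real
  proof (intro allI impI)
    fix e :: real assume "e > 0"
    then have "e/2 > 0" by simp
    with ac obtain \<delta> where "\<delta> > 0" and \<delta>: "\<And>I :: (real \<times> real) set.
       finite I \<Longrightarrow>
       (\<forall>(a', b')\<in>I. a' \<le> b' \<and> {a'..b'} \<subseteq> {a..b}) \<Longrightarrow>
       pairwise (\<lambda>(a, b) (a', b'). {a<..<b} \<inter> {a'<..<b'} = {}) I \<Longrightarrow>
       (\<Sum>(a, b)\<in>I. b - a) < \<delta>
       \<Longrightarrow> (\<Sum>(a, b)\<in>I. norm (u b - u a)) < e/2"
      unfolding absolutely_continuous_on_def by meson
    obtain U where U: "open U" "N \<subseteq> U" "U - N \<in> lmeasurable" "emeasure lebesgue (U - N) < ennreal \<delta>"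
      using sets_lebesgue_outer_open[OF negligible_imp_sets[OF N] \<open>\<delta> > 0\<close>] .
    have Ulm: "U \<in> lmeasurable"
    proof -
      have "U = (U - N) \<union> N" using U by blast
      then show ?thesis using U(3) negligible_imp_measurable[OF N] by (metis fmeasurable.Un)
    qed
    have mU: "measure lebesgue U < \<delta>"
    proof -
      have "measure lebesgue U = measure lebesgue (U - N)"
        by (rule measure_negligible_symdiff[OF U(3)]) (rule negligible_subset[OF N], blast)
      also have "\<dots> < \<delta>" using U(3,4) \<open>\<delta> > 0\<close> by (simp add: emeasure_eq_measure2 ennreal_less_iff)
      finally show ?thesis .
    qed
    \<comment> \<open>Chosen so that \<open>\<eta> * (b - a) \<le> e / 2\<close>; the summand 1
      admits \<open>a = b\<close>.\<close>
    define \<eta> where "\<eta> = e / (2 * (b - a + 1))"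
    have \<eta>: "\<eta> > 0" using \<open>e > 0\<close> ab by (simp add: \<eta>_def)
    have "\<exists>d>0. (x \<in> N \<longrightarrow> ball x d \<subseteq> U) \<and> (x \<in> {a..b} - N \<longrightarrow>
        (\<forall>y\<in>{a..b}. \<bar>y - x\<bar> < d \<longrightarrow> norm (u y - u x - (y - x) *\<^sub>R h x) \<le> \<eta> * \<bar>y - x\<bar>))" for x
    proof (cases "x \<in> N")
      case True
      then show ?thesis using U by (metis DiffE in_mono open_contains_ball)
    next
      case False
      show ?thesis
      proof (cases "x \<in> {a..b}")
        case True
        then have "(u has_vector_derivative h x) (at x within {a..b})"
          using der False by (simp add: h_def)
        then show ?thesis using \<eta> False
          unfolding has_vector_derivative_def has_derivative_within_alt by (auto dest!: spec[of _ \<eta>])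
      qed (use False in \<open>auto intro: exI[of _ 1]\<close>)
    qed
    then obtain d where d: "\<And>x. d x > 0" "\<And>x. x \<in> N \<Longrightarrow> ball x (d x) \<subseteq> U"
      "\<And>x y. x \<in> {a..b} - N \<Longrightarrow> y \<in> {a..b} \<Longrightarrow> \<bar>y - x\<bar> < d x \<Longrightarrow> norm (u y - u x - (y - x) *\<^sub>R h x) \<le> \<eta> * \<bar>y - x\<bar>"
      by metis
    show "\<exists>\<gamma>. gauge \<gamma> \<and> (\<forall>\<D>. \<D> tagged_division_of {a..b} \<and> \<gamma> fine \<D> \<longrightarrow>
        norm (sum (\<lambda>(x,k). measure lborel k *\<^sub>R h x) \<D> - (u b - u a)) < e)"
    proof (intro exI[of _ "\<lambda>x. ball x (d x)"] conjI allI impI)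
      show "gauge (\<lambda>x. ball x (d x))" using d by (intro gauge_ball_dependent) auto
      fix p assume "p tagged_division_of {a..b} \<and> (\<lambda>x. ball x (d x)) fine p"
      then have p: "p tagged_division_of {a..b}" and fine: "(\<lambda>x. ball x (d x)) fine p" by auto
      have pfin: "finite p" using p by blast
      note pD = tagged_division_ofD[OF p]
      define T where "T = (\<lambda>K. u (Sup K) - u (Inf K))"
      have K: "K = {Inf K..Sup K}" "Inf K \<le> Sup K" "x \<in> K" "K \<subseteq> {a..b}" "K \<subseteq> ball x (d x)" if "(x, K) \<in> p" for x K
      proof -
        show "x \<in> K" "K \<subseteq> {a..b}" using pD that by auto
        from pD(4)[OF that] obtain v w where vw: "K = {v..w}" by auto
        with \<open>x \<in> K\<close> have "v \<le> w" by auto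
        with vw show "K = {Inf K..Sup K}" "Inf K \<le> Sup K" by auto
        show "K \<subseteq> ball x (d x)" using fine that by (auto simp: fine_def)
      qed
      have tel: "(\<Sum>(x,K)\<in>p. T K) = u b - u a"
        unfolding T_def by (rule additive_tagged_division_1[OF ab p])
      define pN where "pN = {(x,K)\<in>p. x \<in> N}"
      have pNp: "pN \<subseteq> p" by (auto simp: pN_def)
      have cont: "measure lborel K = Sup K - Inf K" if "(x,K) \<in> p" for x K
        using K(1,2)[OF that] by (metis measure_lborel_Icc)
      have good: "norm (measure lborel K *\<^sub>R h x - T K) \<le> \<eta> * measure lborel K" if "(x,K) \<in> p - pN" for x K
      proof -
        have xK: "(x,K) \<in> p" "x \<notin> N" using that by (auto simp: pN_def)
        note k = K[OF xK(1)]
        have x: "x \<in> {a..b} - N" using k xK by blast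
        have SI: "Sup K \<in> K" "Inf K \<in> K" using k(1,2) atLeastAtMost_iff by (metis order_refl)+
        have 1: "norm (u (Sup K) - u x - (Sup K - x) *\<^sub>R h x) \<le> \<eta> * \<bar>Sup K - x\<bar>"
          using SI k(4,5) by (intro d(3)[OF x]) (auto simp: dist_real_def subset_iff)
        have 2: "norm (u (Inf K) - u x - (Inf K - x) *\<^sub>R h x) \<le> \<eta> * \<bar>Inf K - x\<bar>"
          using SI k(4,5) by (intro d(3)[OF x]) (auto simp: dist_real_def subset_iff)
        have x2: "Inf K \<le> x" "x \<le> Sup K" using k(1,3) by (metis atLeastAtMost_iff)+
        have "norm (measure lborel K *\<^sub>R h x - T K) = norm ((u (Inf K) - u x - (Inf K - x) *\<^sub>R h x) - (u (Sup K) - u x - (Sup K - x) *\<^sub>R h x))"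
          unfolding cont[OF xK(1)] T_def by (simp add: algebra_simps)
        also have "\<dots> \<le> norm (u (Inf K) - u x - (Inf K - x) *\<^sub>R h x) + norm (u (Sup K) - u x - (Sup K - x) *\<^sub>R h x)"
          by (rule norm_triangle_ineq4)
        also have "\<dots> \<le> \<eta> * \<bar>Inf K - x\<bar> + \<eta> * \<bar>Sup K - x\<bar>" using 1 2 by linarith
        also have "\<dots> = \<eta> * measure lborel K" using x2 unfolding cont[OF xK(1)] by (simp add: algebra_simps)
        finally show ?thesis .
      qed
      have S1: "norm (\<Sum>(x,K)\<in>p - pN. measure lborel K *\<^sub>R h x - T K) \<le> e/2"
      proof -
        have "norm (\<Sum>(x,K)\<in>p - pN. measure lborel K *\<^sub>R h x - T K) \<le> (\<Sum>(x,K)\<in>p - pN. \<eta> * measure lborel K)"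
          using good by (intro sum_norm_le) auto
        also have "\<dots> \<le> (\<Sum>(x,K)\<in>p. \<eta> * measure lborel K)"
          using \<eta> by (intro sum_mono2) (auto simp: pfin)
        also have "\<dots> = \<eta> * (\<Sum>(x,K)\<in>p. measure lborel K)" by (simp add: sum_distrib_left case_prod_unfold)
        also have "\<dots> = \<eta> * (b - a)"
          using additive_content_tagged_division[of p a b] p ab by simp
        also have "\<dots> \<le> e / 2" using \<open>e > 0\<close> ab by (simp add: \<eta>_def field_simps)
        finally show ?thesis .
      qed
      have S2: "norm (\<Sum>(x,K)\<in>pN. measure lborel K *\<^sub>R h x - T K) < e/2"
      proof -
        define q where "q = (\<lambda>(x::real,K::real set). (Inf K, Sup K))"
        have same: "x1 = x2 \<and> K1 = K2 \<or> interior K1 \<inter> interior K2 = {} " if "(x1,K1) \<in> p" "(x2,K2) \<in> p" for x1 x2 K1 K2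
          using pD(5) that by blast
        have inj: "inj_on q pN"
        proof (rule inj_onI, clarify)
          fix x1 K1 x2 K2 assume A: "(x1,K1) \<in> pN" "(x2,K2) \<in> pN" "q (x1,K1) = q (x2,K2)"
          then have P: "(x1,K1) \<in> p" "(x2,K2) \<in> p" and e: "Inf K1 = Inf K2" "Sup K1 = Sup K2" by (auto simp: pN_def q_def)
          then have KK: "K1 = K2" using K(1)[OF P(1)] K(1)[OF P(2)] by simp
          \<comment> \<open>A degenerate interval has its tag as its only point, so equal end points
            force equal tags. Otherwise the common interior is nonempty and the division property
            decides.\<close>
          show "x1 = x2 \<and> K1 = K2"
          proof (cases "Inf K1 = Sup K1")
            case True
            then have "x1 \<in> {Inf K1..Inf K1}" "x2 \<in> {Inf K1..Inf K1}"
              using K(1,3)[OF P(1)] K(1,3)[OF P(2)] KK by metis+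
            then show ?thesis using KK by simp
          next
            case False
            then have "Inf K1 < Sup K1" using K(2)[OF P(1)] by linarith
            then have "interior K1 \<noteq> {}" using K(1)[OF P(1)]
              by (metis interior_atLeastAtMost_real greaterThanLessThan_empty_iff leD)
            then show ?thesis using same[OF P] KK by auto
          qed
        qed
        have cs: "(\<Sum>(x,K)\<in>pN. measure lborel K) < \<delta>"
        proof -
          have tp: "pN tagged_partial_division_of {a..b}"
            by (rule tagged_partial_division_subset[OF _ pNp]) (use p in \<open>simp add: tagged_division_of_def\<close>)
          then have dv: "(snd ` pN) division_of \<Union>(snd ` pN)" by (rule partial_division_of_tagged_division)
          have td: "pN tagged_division_of \<Union>(snd ` pN)"
            by (rule tagged_partial_division_of_Union_self[OF tp])
          have "(\<Sum>(x,K)\<in>pN. measure lborel K) = (\<Sum>K\<in>snd ` pN. measure lborel K)"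
            by (rule sum.over_tagged_division_lemma[OF td]) (auto simp: content_eq_0_interior)
          also have "\<dots> = (\<Sum>K\<in>snd ` pN. measure lebesgue K)"
          proof (rule sum.cong[OF refl])
            fix k assume "k \<in> snd ` pN"
            then obtain x where "(x,k) \<in> p" using pNp by auto
            then have "k = {Inf k..Sup k}" by (rule K(1))
            then show "measure lborel k = measure lebesgue k" by (metis lborelD borel_closed closed_atLeastAtMost measure_completion)
          qed
          also have "\<dots> = measure lebesgue (\<Union>(snd ` pN))" by (rule content_division[OF dv])
          also have "\<dots> \<le> measure lebesgue U"
          proof (rule measure_mono_fmeasurable[OF _ _ Ulm])
            show "\<Union> (snd ` pN) \<subseteq> U" using d(2) K(5) by (fastforce simp: pN_def)
            show "\<Union> (snd ` pN) \<in> sets lebesgue" using lmeasurable_division[OF dv] by blast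
          qed
          also note mU
          finally show ?thesis .
        qed
        have "norm (\<Sum>(x,K)\<in>pN. measure lborel K *\<^sub>R h x - T K) = norm (\<Sum>(x,K)\<in>pN. - T K)"
          by (rule arg_cong[of _ _ norm], rule sum.cong) (auto simp: pN_def h_def)
        also have "\<dots> \<le> (\<Sum>(x,K)\<in>pN. norm (T K))"
          by (rule sum_norm_le) auto
        also have "\<dots> = (\<Sum>(a, b)\<in>q ` pN. norm (u b - u a))"
          by (subst sum.reindex[OF inj]) (auto simp: q_def T_def case_prod_unfold intro!: sum.cong)
        also have "\<dots> < e/2"
        proof (rule \<delta>)
          show "finite (q ` pN)" using pfin pNp finite_subset by blast
          show "\<forall>(a', b')\<in>q ` pN. a' \<le> b' \<and> {a'..b'} \<subseteq> {a..b}"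
            using K pNp by (fastforce simp: q_def)
          show "pairwise (\<lambda>(a, b) (a', b'). {a<..<b} \<inter> {a'<..<b'} = {}) (q ` pN)"
          proof (rule pairwiseI)
            fix i j assume "i \<in> q ` pN" "j \<in> q ` pN" "i \<noteq> j"
            then obtain x1 K1 x2 K2 where P: "(x1,K1) \<in> pN" "(x2,K2) \<in> pN" "i = (Inf K1, Sup K1)" "j = (Inf K2, Sup K2)"
              by (auto simp: q_def)
            then have "interior K1 \<inter> interior K2 = {}" using same[of x1 K1 x2 K2] \<open>i \<noteq> j\<close> pNp by blast
            moreover have "interior K1 = {Inf K1<..<Sup K1}" "interior K2 = {Inf K2<..<Sup K2}"
              using K(1) P pNp by (metis interior_atLeastAtMost_real subsetD)+
            ultimately show "(case i of (a, b) \<Rightarrow> \<lambda>(a', b'). {a<..<b} \<inter> {a'<..<b'} = {}) j" using P by simp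
          qed
          have "(\<Sum>(a, b)\<in>q ` pN. b - a) = (\<Sum>(x,K)\<in>pN. measure lborel K)"
            using cont pNp by (subst sum.reindex[OF inj]) (fastforce simp: q_def case_prod_unfold intro!: sum.cong)
          with cs show "(\<Sum>(a, b)\<in>q ` pN. b - a) < \<delta>" by simp
        qed
        finally show ?thesis .
      qed
      have "(\<Sum>(x,k)\<in>p. measure lborel k *\<^sub>R h x) - (u b - u a) = (\<Sum>(x,K)\<in>p. measure lborel K *\<^sub>R h x - T K)"
        unfolding tel[symmetric] by (simp add: sum_subtractf case_prod_unfold)
      also have "\<dots> = (\<Sum>(x,K)\<in>p - pN. measure lborel K *\<^sub>R h x - T K) + (\<Sum>(x,K)\<in>pN. measure lborel K *\<^sub>R h x - T K)"
        by (rule sum.subset_diff[OF pNp pfin])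
      finally have eq: "(\<Sum>(x,k)\<in>p. measure lborel k *\<^sub>R h x) - (u b - u a) =
        (\<Sum>(x,K)\<in>p - pN. measure lborel K *\<^sub>R h x - T K) + (\<Sum>(x,K)\<in>pN. measure lborel K *\<^sub>R h x - T K)" .
      show "norm ((\<Sum>(x,k)\<in>p. measure lborel k *\<^sub>R h x) - (u b - u a)) < e"
        unfolding eq by (rule order.strict_trans1[OF norm_triangle_ineq]) (use S1 S2 in linarith)
    qed
  qed
  then show ?thesis
    using has_integral_spike[OF N, of "{a..b}" g h] by (simp add: h_def)
qed

section \<open>Complex differentiable maps and bounds for the class\<close>

lemma norm_vector_scalar_mult: "norm (c *s (x :: complex ^ 'n::finite)) = norm c * norm x"
  by (simp add: norm_vec_def vector_scalar_mult_def norm_mult L2_set_right_distrib)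

lemma scaleR_eq_vector_scalar_mult: "r *\<^sub>R (x :: complex ^ 'n) = of_real r *s x"
  by (simp add: vec_eq_iff) (simp add: scaleR_conv_of_real)

lemma hermitian_inner_add_left: "hermitian_inner (x + y) w = hermitian_inner x w + hermitian_inner y w"
  by (simp add: hermitian_inner_def sum.distrib algebra_simps)

lemma hermitian_inner_diff_left: "hermitian_inner (x - y) w = hermitian_inner x w - hermitian_inner y w"
  by (simp add: hermitian_inner_def sum_subtractf algebra_simps)

lemma hermitian_inner_add_right: "hermitian_inner w (x + y) = hermitian_inner w x + hermitian_inner w y"
  by (simp add: hermitian_inner_def sum.distrib algebra_simps)

lemma hermitian_inner_scale_left: "hermitian_inner (c *s x) w = c * hermitian_inner x w"
  by (simp add: hermitian_inner_def sum_distrib_left algebra_simps)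

lemma hermitian_inner_scale_right: "hermitian_inner w (c *s x) = cnj c * hermitian_inner w x"
  by (simp add: hermitian_inner_def sum_distrib_left algebra_simps)

lemma Re_hermitian_inner: "Re (hermitian_inner x y) = inner x y"
  by (simp add: hermitian_inner_def inner_vec_def inner_complex_def)

lemma hermitian_inner_self: "hermitian_inner x x = of_real ((norm x)\<^sup>2)"
proof -
  have "Im (hermitian_inner x x) = 0" by (simp add: hermitian_inner_def)
  then show ?thesis by (simp add: complex_eq_iff Re_hermitian_inner power2_norm_eq_inner)
qed

lemma norm_hermitian_inner_le: "norm (hermitian_inner x y) \<le> norm x * norm y"
proof -
  have "norm (hermitian_inner x y) \<le> (\<Sum>i\<in>UNIV. norm (x $ i * cnj (y $ i)))"
    unfolding hermitian_inner_def by (rule norm_sum)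
  also have "\<dots> = (\<Sum>i\<in>UNIV. \<bar>norm (x $ i)\<bar> * \<bar>norm (y $ i)\<bar>)" by (simp add: norm_mult)
  also have "\<dots> \<le> norm x * norm y" unfolding norm_vec_def by (rule L2_set_mult_ineq)
  finally show ?thesis .
qed

text \<open>Duality, by testing with \<open>y = x\<close>. One-variable theorems are applied to the
  scalar functions \<open>hermitian_inner (F _) y\<close>, and this lemma returns to the
  vector-valued map without a dimensional factor.\<close>

lemma norm_le_hermitian_inner:
  assumes "\<And>y. norm (hermitian_inner x y) \<le> c * norm y" and "0 \<le> c"
  shows "norm x \<le> c"
proof (cases "x = 0")
  case False
  have "norm x * norm x \<le> c * norm x"
    using assms(1)[of x] by (simp add: hermitian_inner_self norm_power power2_eq_square norm_mult)
  with False show ?thesis by simp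
qed (simp add: assms)

lemma bounded_linear_hermitian_inner_left: "bounded_linear (\<lambda>x :: complex ^ 'n::finite. hermitian_inner x y)"
  by (rule linear_conv_bounded_linear[THEN iffD1], rule linearI)
    (simp_all add: hermitian_inner_add_left scaleR_eq_vector_scalar_mult hermitian_inner_scale_left scaleR_conv_of_real)

lemma bounded_linear_vector_scalar_mult_left: "bounded_linear (\<lambda>c. c *s (v :: complex ^ 'n::finite))"
  by (rule linear_conv_bounded_linear[THEN iffD1], rule linearI)
    (simp_all add: scaleR_eq_vector_scalar_mult vector_sadd_rdistrib scaleR_conv_of_real vector_smult_assoc)

lemma matrix_vector_mult_scale: "A *v (c *s v) = c *s (A *v (v :: complex ^ 'n::finite))"
  by (simp add: vec_eq_iff matrix_vector_mult_def sum_distrib_left algebra_simps)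

lemma bounded_linear_matrix_vector_mult_complex:
  "bounded_linear (\<lambda>v :: complex ^ 'n::finite. (A :: complex ^ 'n ^ 'm::finite) *v v)"
  by (rule linear_conv_bounded_linear[THEN iffD1], rule linearI)
    (simp_all add: matrix_vector_right_distrib scaleR_eq_vector_scalar_mult matrix_vector_mult_scale)

section \<open>Complex differentiability, Cauchy estimates and locally uniform limits\<close>

definition holo_at :: "(complex ^ 'n::finite \<Rightarrow> complex ^ 'n) \<Rightarrow> complex ^ 'n \<Rightarrow> bool"
  where "holo_at f z \<longleftrightarrow> (\<exists>A :: complex ^ 'n ^ 'n. (f has_derivative (\<lambda>v. A *v v)) (at z))"

lemma Hol_ball_iff: "f \<in> Hol_ball \<longleftrightarrow> (\<forall>z\<in>unit_ball. holo_at f z)"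
  by (simp add: Hol_ball_def holo_at_def)

lemma complex_jacobian_eqI:
  fixes A :: "complex ^ 'n::finite ^ 'n"
  assumes "(f has_derivative (\<lambda>v. A *v v)) (at z)"
  shows "complex_jacobian f z = A"
proof -
  have "frechet_derivative f (at z) = (\<lambda>v. A *v v)" using frechet_derivative_at[OF assms] by simp
  then show ?thesis by (simp add: complex_jacobian_def)
qed

lemma holo_at_has_derivative:
  "holo_at f z \<Longrightarrow> (f has_derivative (\<lambda>v. complex_jacobian f z *v v)) (at z)"
  by (auto simp: holo_at_def dest: complex_jacobian_eqI)

lemma holo_at_isCont: "holo_at f z \<Longrightarrow> isCont f z"
  by (auto simp: holo_at_def intro: has_derivative_continuous)

lemma holo_at_diff: "holo_at f z \<Longrightarrow> holo_at g z \<Longrightarrow> holo_at (\<lambda>z. f z - g z) z"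
  unfolding holo_at_def
proof (elim exE)
  fix A B assume "(f has_derivative (\<lambda>v. A *v v)) (at z)" "(g has_derivative (\<lambda>v. B *v v)) (at z)"
  then have "((\<lambda>z. f z - g z) has_derivative (\<lambda>v. (A - B) *v v)) (at z)"
    by (auto intro!: derivative_eq_intros simp: matrix_vector_mult_diff_rdistrib)
  then show "\<exists>A. ((\<lambda>z. f z - g z) has_derivative (\<lambda>v. A *v v)) (at z)" by blast
qed

lemma scaleR_matrix_vector_mult: "c *\<^sub>R ((A :: complex ^ 'n::finite ^ 'm::finite) *v v) = (c *\<^sub>R A) *v v"
  by (simp add: vec_eq_iff matrix_vector_mult_def scaleR_sum_right)

lemma holo_at_scaleR: "holo_at f z \<Longrightarrow> holo_at (\<lambda>z. c *\<^sub>R f z) z"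
  unfolding holo_at_def
proof (elim exE)
  fix A assume "(f has_derivative (\<lambda>v. A *v v)) (at z)"
  then have "((\<lambda>z. c *\<^sub>R f z) has_derivative (\<lambda>v. c *\<^sub>R (A *v v))) (at z)"
    by (rule has_derivative_scaleR_right)
  then show "\<exists>A. ((\<lambda>z. c *\<^sub>R f z) has_derivative (\<lambda>v. A *v v)) (at z)"
    unfolding scaleR_matrix_vector_mult by blast
qed

lemma slice_has_field_derivative:
  assumes "(F has_derivative (\<lambda>v. A *v v)) (at (z + \<zeta> *s v))"
  shows "((\<lambda>\<zeta>. hermitian_inner (F (z + \<zeta> *s v)) y) has_field_derivative hermitian_inner (A *v v) y) (at \<zeta>)"
proof -
  have 1: "((\<lambda>\<zeta>. z + \<zeta> *s v) has_derivative (\<lambda>\<zeta>. \<zeta> *s v)) (at \<zeta>)"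
    by (auto intro!: derivative_eq_intros bounded_linear_imp_has_derivative bounded_linear_vector_scalar_mult_left)
  have 2: "((\<lambda>\<zeta>. F (z + \<zeta> *s v)) has_derivative (\<lambda>\<zeta>. A *v (\<zeta> *s v))) (at \<zeta>)"
    using diff_chain_at[OF 1 assms] by (simp add: o_def)
  have "((\<lambda>\<zeta>. hermitian_inner (F (z + \<zeta> *s v)) y) has_derivative (\<lambda>\<zeta>. hermitian_inner (A *v (\<zeta> *s v)) y)) (at \<zeta>)"
    by (rule bounded_linear.has_derivative[OF bounded_linear_hermitian_inner_left 2])
  then show ?thesis
    by (simp add: has_field_derivative_def matrix_vector_mult_scale hermitian_inner_scale_left mult.commute[of _ "hermitian_inner _ _"])
qed

lemma slice_holomorphic_on:
  assumes "\<And>\<zeta>. \<zeta> \<in> S \<Longrightarrow> holo_at F (z + \<zeta> *s v)" "open S"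
  shows "(\<lambda>\<zeta>. hermitian_inner (F (z + \<zeta> *s v)) y) holomorphic_on S"
  unfolding holomorphic_on_open[OF assms(2)]
  using assms(1) slice_has_field_derivative unfolding holo_at_def by blast

text \<open>Cauchy's inequality on circles of radius \<open>R / 4\<close> about the points of
  \<open>cball 0 (R / 2)\<close> bounds the second derivative by
  \<open>2 * B * 16 / R\<^sup>2\<close>, whence the 32 in the Taylor estimate. The bound for the
  first derivative uses the circle of radius \<open>R / 2\<close> about 0.\<close>

lemma holomorphic_quadratic_remainder:
  assumes hol: "q holomorphic_on ball 0 R" and B: "\<And>w. w \<in> ball 0 R \<Longrightarrow> norm (q w) \<le> B"
    and R: "R > 0" and w: "norm w \<le> R / 2"
  shows "norm (q w - q 0 - deriv q 0 * w) \<le> 32 * B / R\<^sup>2 * (norm w)\<^sup>2"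
    and "norm (deriv q 0) \<le> 2 * B / R"
proof -
  have est: "norm ((deriv ^^ n) q x) \<le> fact n * B / (R/4)^n" if "x \<in> cball 0 (R/2)" for x n
  proof (rule Cauchy_inequality)
    have sub: "cball x (R/4) \<subseteq> ball 0 R"
    proof
      fix u assume "u \<in> cball x (R/4)"
      then have "norm (u - x) \<le> R/4" by (simp add: dist_norm norm_minus_commute)
      then show "u \<in> ball 0 R" using that R norm_triangle_sub[of u x] by simp
    qed
    show "q holomorphic_on ball x (R/4)"
      by (rule holomorphic_on_subset[OF hol]) (use sub ball_subset_cball in blast)
    show "continuous_on (cball x (R/4)) q"
      by (rule continuous_on_subset[OF holomorphic_on_imp_continuous_on[OF hol] sub])
    show "norm (q u) \<le> B" if "norm (x - u) = R/4" for u
      by (rule B) (use sub that in \<open>auto simp: dist_norm\<close>)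
  qed (use R in simp)
  have sub2: "cball 0 (R/2) \<subseteq> ball 0 R" using R by auto
  have der: "((deriv ^^ i) q has_field_derivative (deriv ^^ Suc i) q x) (at x within cball 0 (R/2))"
    if "x \<in> cball 0 (R/2)" for i x
  proof -
    have "(deriv ^^ i) q holomorphic_on ball 0 R" by (rule holomorphic_higher_deriv[OF hol]) auto
    then have "((deriv ^^ i) q has_field_derivative deriv ((deriv ^^ i) q) x) (at x)"
      by (rule holomorphic_derivI[OF _ _ subsetD[OF sub2 that]]) auto
    then show ?thesis by (simp add: has_field_derivative_at_within)
  qed
  have "norm ((deriv ^^ 0) q w - (\<Sum>i\<le>1. (deriv ^^ i) q 0 * (w - 0) ^ i / fact i)) \<le> (32 * B / R\<^sup>2) * norm (w - 0) ^ Suc 1 / fact 1"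
  proof (rule complex_Taylor[of "cball 0 (R/2)" 1 "\<lambda>i. (deriv ^^ i) q" "32 * B / R\<^sup>2" 0 w])
    show "norm ((deriv ^^ Suc 1) q x) \<le> 32 * B / R\<^sup>2" if "x \<in> cball 0 (R/2)" for x
      using est[OF that, of 2] by (simp add: numeral_2_eq_2 power2_eq_square field_simps)
  qed (use der w R in auto)
  then show "norm (q w - q 0 - deriv q 0 * w) \<le> 32 * B / R\<^sup>2 * (norm w)\<^sup>2"
    by (simp add: algebra_simps power2_eq_square)
  have "norm ((deriv ^^ 1) q 0) \<le> fact 1 * B / (R/2)^1"
  proof (rule Cauchy_inequality)
    show "q holomorphic_on ball 0 (R/2)"
      by (rule holomorphic_on_subset[OF hol]) (use R in auto)
    show "continuous_on (cball 0 (R/2)) q"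
      by (rule continuous_on_subset[OF holomorphic_on_imp_continuous_on[OF hol] sub2])
    show "norm (q u) \<le> B" if "norm (0 - u) = R/2" for u
      by (rule B) (use that R in auto)
  qed (use R in simp)
  then show "norm (deriv q 0) \<le> 2 * B / R" by (simp add: mult.commute)
qed

text \<open>The one-variable estimates are applied on the complex line through \<open>z\<close> in
  the direction of \<open>v\<close>. That the constants involve only \<open>B\<close> and
  \<open>R\<close> is what makes them stable under limits of maps and uniform in the time of a
  field.\<close>

lemma holo_at_remainder:
  assumes hol: "\<And>x. x \<in> ball z R \<Longrightarrow> holo_at F x" and B: "\<And>x. x \<in> ball z R \<Longrightarrow> norm (F x) \<le> B"
    and R: "R > 0" and A: "(F has_derivative (\<lambda>v. A *v v)) (at z)"
  shows "norm v \<le> R / 2 \<Longrightarrow> norm (F (z + v) - F z - A *v v) \<le> 32 * B / R\<^sup>2 * (norm v)\<^sup>2" (is "?P \<Longrightarrow> ?A")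
    and "norm (A *v v) \<le> 2 * B / R * norm v" (is ?B)
proof -
  have B0: "B \<ge> 0" using B[of z] R by (metis centre_in_ball norm_ge_zero order_trans)
  have "(?P \<longrightarrow> ?A) \<and> ?B"
  proof (cases "v = 0")
    case False
    define u where "u = of_real (1 / norm v) *s v"
    have u: "norm u = 1" "of_real (norm v) *s u = v"
      using False by (simp_all add: u_def norm_vector_scalar_mult norm_divide vector_smult_assoc)
    have Av: "A *v v = of_real (norm v) *s (A *v u)" by (metis u(2) matrix_vector_mult_scale)
    define q where "q = (\<lambda>y \<zeta>. hermitian_inner (F (z + \<zeta> *s u)) y)"
    have inb: "z + \<zeta> *s u \<in> ball z R" if "\<zeta> \<in> ball 0 R" for \<zeta>
      using that u by (simp add: dist_norm norm_vector_scalar_mult)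
    have q: "q y holomorphic_on ball 0 R" for y
      unfolding q_def by (rule slice_holomorphic_on) (use hol inb in auto)
    have qB: "norm (q y w) \<le> B * norm y" if "w \<in> ball 0 R" for w y
      unfolding q_def using norm_hermitian_inner_le B[OF inb[OF that]]
      by (metis (no_types, lifting) mult_right_mono norm_ge_zero order_trans)
    have dq: "deriv (q y) 0 = hermitian_inner (A *v u) y" for y
      unfolding q_def by (rule DERIV_imp_deriv, rule slice_has_field_derivative) (use A in simp)
    have 1: "norm (F (z + v) - F z - A *v v) \<le> 32 * B / R\<^sup>2 * (norm v)\<^sup>2" if "norm v \<le> R / 2"
    proof (rule norm_le_hermitian_inner)
      fix y
      have "hermitian_inner (F (z + v) - F z - A *v v) y = q y (of_real (norm v)) - q y 0 - deriv (q y) 0 * of_real (norm v)"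
        unfolding q_def using dq[of y, unfolded q_def] u(2) Av
        by (simp add: hermitian_inner_diff_left hermitian_inner_scale_left)
      also have "norm \<dots> \<le> 32 * (B * norm y) / R\<^sup>2 * (norm (of_real (norm v) :: complex))\<^sup>2"
        by (rule holomorphic_quadratic_remainder(1)[OF q qB R]) (use that in simp_all)
      finally show "norm (hermitian_inner (F (z + v) - F z - A *v v) y) \<le> 32 * B / R\<^sup>2 * (norm v)\<^sup>2 * norm y"
        by (simp add: algebra_simps)
    qed (use B0 in simp)
    have 2: "norm (A *v u) \<le> 2 * B / R"
    proof (rule norm_le_hermitian_inner)
      fix y
      show "norm (hermitian_inner (A *v u) y) \<le> 2 * B / R * norm y"
        using holomorphic_quadratic_remainder(2)[OF q[of y] qB[of _ y] R, where w = 0] R unfolding dq by simp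
    qed (use B0 R in simp)
    have 3: "norm (A *v v) \<le> 2 * B / R * norm v"
      unfolding Av norm_vector_scalar_mult using mult_right_mono[OF 2, of "norm v"] by (simp add: mult.commute)
    from 1 3 show ?thesis by blast
  qed (use B0 in simp)
  then show "?P \<Longrightarrow> ?A" ?B by blast+
qed

lemma holo_lipschitz:
  assumes S: "convex S" "\<And>x. x \<in> S \<Longrightarrow> ball x R \<subseteq> U" and R: "R > 0"
    and hol: "\<And>x. x \<in> U \<Longrightarrow> holo_at F x" and B: "\<And>x. x \<in> U \<Longrightarrow> norm (F x) \<le> B"
    and xy: "x \<in> S" "y \<in> S"
  shows "norm (F x - F y) \<le> 2 * B / R * norm (x - y)"
proof (rule differentiable_bound[OF S(1) _ _ xy(1,2)])
  fix w assume w: "w \<in> S"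
  then have wU: "w \<in> U" using S(2)[OF w] R by auto
  show d: "(F has_derivative (\<lambda>v. complex_jacobian F w *v v)) (at w within S)"
    by (rule has_derivative_at_withinI[OF holo_at_has_derivative[OF hol[OF wU]]])
  show "onorm (\<lambda>v. complex_jacobian F w *v v) \<le> 2 * B / R"
    by (rule onorm_le, rule holo_at_remainder(2)[OF _ _ R holo_at_has_derivative[OF hol[OF wU]]])
      (use S(2)[OF w] hol B in auto)
qed

lemma has_derivative_quadratic_remainder:
  assumes "bounded_linear L" "d > 0" and "\<And>v. norm v \<le> d \<Longrightarrow> norm (f (z + v) - f z - L v) \<le> K * (norm v)\<^sup>2"
  shows "(f has_derivative L) (at z)"
  unfolding has_derivative_at_alt
proof (intro conjI allI impI assms(1))
  fix e :: real assume "e > 0"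
  define K' where "K' = \<bar>K\<bar> + 1"
  have K': "K' > 0" "K \<le> K'" by (auto simp: K'_def)
  show "\<exists>d>0. \<forall>y. norm (y - z) < d \<longrightarrow> norm (f y - f z - L (y - z)) \<le> e * norm (y - z)"
  proof (intro exI[of _ "min d (e / K')"] conjI allI impI)
    show "0 < min d (e / K')" using assms(2) \<open>e > 0\<close> K' by simp
    fix y assume y: "norm (y - z) < min d (e / K')"
    have "norm (f (z + (y - z)) - f z - L (y - z)) \<le> K * (norm (y - z))\<^sup>2"
      by (rule assms(3)) (use y in simp)
    also have "\<dots> \<le> K' * (norm (y - z))\<^sup>2" using K' by (intro mult_right_mono) auto
    also have "\<dots> = (K' * norm (y - z)) * norm (y - z)" by (simp add: power2_eq_square)
    also have "\<dots> \<le> e * norm (y - z)"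
      using y K' by (intro mult_right_mono) (auto simp: field_simps)
    finally show "norm (f y - f z - L (y - z)) \<le> e * norm (y - z)" by simp
  qed
qed

text \<open>A uniform bound on the operators becomes boundedness of a set of matrices, from which
  the limit theorem below extracts a convergent subsequence.\<close>

lemma norm_matrix_le:
  fixes A :: "complex ^ 'n::finite ^ 'n"
  assumes "\<And>v. norm (A *v v) \<le> c * norm v"
  shows "norm A \<le> real CARD('n) * (real CARD('n) * c)"
proof -
  have entry: "norm (A $ j $ i) \<le> c" for i j
  proof -
    have "A $ j $ i = (A *v axis i 1) $ j"
      by (simp add: matrix_vector_mult_def axis_def if_distrib[of "(*) _"] cong: if_cong)
    then have "norm (A $ j $ i) \<le> norm (A *v axis i 1)" by (metis Finite_Cartesian_Product.norm_nth_le)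
    also have "\<dots> \<le> c * norm (axis i (1::complex))" by (rule assms)
    finally show ?thesis by simp
  qed
  have "norm A \<le> (\<Sum>j\<in>UNIV. norm (A $ j))" unfolding norm_vec_def by (rule L2_set_le_sum) simp
  also have "\<dots> \<le> (\<Sum>j\<in>(UNIV::'n set). real CARD('n) * c)"
  proof (rule sum_mono)
    fix j
    have "norm (A $ j) \<le> (\<Sum>i\<in>UNIV. norm (A $ j $ i))"
      unfolding norm_vec_def[of "A $ j"] by (rule L2_set_le_sum) simp
    also have "\<dots> \<le> (\<Sum>i\<in>(UNIV::'n set). c)" by (rule sum_mono) (rule entry)
    finally show "norm (A $ j) \<le> real CARD('n) * c" by simp
  qed
  finally show ?thesis by simp
qed

text \<open>Weierstrass's theorem in several variables. Cauchy's estimate bounds the Jacobians at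
  \<open>z\<close>, so some subsequence of them converges, and the quadratic remainder estimate with
  its uniform constant passes to the limit.\<close>

lemma holo_at_uniform_limit:
  fixes F :: "nat \<Rightarrow> complex ^ 'n::finite \<Rightarrow> complex ^ 'n"
  assumes R: "R > 0" and hol: "\<And>k x. x \<in> ball z R \<Longrightarrow> holo_at (F k) x"
    and lim: "uniform_limit (ball z R) F f sequentially"
  shows "holo_at f z"
proof -
  obtain N where N: "\<And>k x. k \<ge> N \<Longrightarrow> x \<in> ball z R \<Longrightarrow> dist (F k x) (f x) < 1"
    using lim[unfolded uniform_limit_iff, rule_format, of 1] unfolding eventually_sequentially by (metis zero_less_one)
  have sub: "cball z (R/2) \<subseteq> ball z R" using R by auto
  have "continuous_on (cball z (R/2)) (F N)"
    using hol sub holo_at_isCont by (blast intro: continuous_at_imp_continuous_on)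
  then have "compact (F N ` cball z (R/2))" by (intro compact_continuous_image) auto
  then obtain B0 where B0: "\<And>x. x \<in> cball z (R/2) \<Longrightarrow> norm (F N x) \<le> B0"
    by (meson bounded_iff compact_imp_bounded image_eqI)
  \<comment> \<open>\<open>B0\<close> bounds \<open>F N\<close> on the smaller ball; passing from
    \<open>F N\<close> to \<open>f\<close> and from \<open>f\<close> to \<open>F k\<close> costs
    less than 1 each.\<close>
  define B where "B = B0 + 2"
  have B: "norm (F k x) \<le> B" if "k \<ge> N" "x \<in> ball z (R/2)" for k x
  proof -
    have x: "x \<in> ball z R" "x \<in> cball z (R/2)" using that(2) subset_ball[of "R/2" R z] R by auto
    have "norm (F k x) \<le> norm (F N x) + dist (F N x) (f x) + dist (F k x) (f x)"
      unfolding dist_norm by norm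
    then show ?thesis using N[OF that(1) x(1)] N[OF order_refl x(1)] B0[OF x(2)] by (simp add: B_def)
  qed
  \<comment> \<open>Only from index \<open>N\<close> on do the maps share the bound
    \<open>B\<close>.\<close>
  define A where "A = (\<lambda>k. complex_jacobian (F (N + k)) z)"
  have A: "(F (N + k) has_derivative (\<lambda>v. A k *v v)) (at z)" for k
    unfolding A_def by (rule holo_at_has_derivative) (use hol R in auto)
  have hol2: "holo_at (F k) x" if "x \<in> ball z (R/2)" for k x using hol that subset_ball[of "R/2" R z] R by auto
  have rem: "norm v \<le> R / 4 \<Longrightarrow> norm (F (N + k) (z + v) - F (N + k) z - A k *v v) \<le> 32 * B / (R/2)\<^sup>2 * (norm v)\<^sup>2"
    and cau: "norm (A k *v v) \<le> 2 * B / (R/2) * norm v" for k v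
    using holo_at_remainder[of z "R/2" "F (N+k)" B "A k" v] hol2 B R A by auto
  have "bounded (range A)"
    unfolding bounded_iff using norm_matrix_le[OF cau] by blast
  then obtain l r where lr: "strict_mono r" "(A \<circ> r) \<longlonglongrightarrow> l"
    using bounded_imp_convergent_subsequence by blast
  have Al: "(\<lambda>k. A (r k) *v v) \<longlonglongrightarrow> l *v v" for v
  proof (rule vec_tendstoI)
    fix i
    have "(\<lambda>k. \<Sum>j\<in>UNIV. A (r k) $ i $ j * v $ j) \<longlonglongrightarrow> (\<Sum>j\<in>UNIV. l $ i $ j * v $ j)"
      using lr(2) by (auto intro!: tendsto_intros simp: o_def)
    then show "(\<lambda>k. (A (r k) *v v) $ i) \<longlonglongrightarrow> (l *v v) $ i" by (simp add: matrix_vector_mult_def)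
  qed
  have Fl: "(\<lambda>k. F (N + r k) x) \<longlonglongrightarrow> f x" if "x \<in> ball z R" for x
  proof -
    have "(\<lambda>k. F k x) \<longlonglongrightarrow> f x" using lim that by (rule tendsto_uniform_limitI)
    moreover have "strict_mono (\<lambda>k. N + r k)" using lr(1) by (simp add: strict_mono_def)
    ultimately show ?thesis using LIMSEQ_subseq_LIMSEQ[of "\<lambda>k. F k x" "f x" "\<lambda>k. N + r k"] by (simp add: o_def)
  qed
  have "(f has_derivative (\<lambda>v. l *v v)) (at z)"
  proof (rule has_derivative_quadratic_remainder[where d = "R/4" and K = "32 * B / (R/2)\<^sup>2"])
    fix v :: "complex ^ 'n" assume v: "norm v \<le> R / 4"
    have "z + v \<in> ball z R" using v R by (simp add: dist_norm)
    moreover have "z \<in> ball z R" using R by simp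
    ultimately have "(\<lambda>k. norm (F (N + r k) (z + v) - F (N + r k) z - A (r k) *v v)) \<longlonglongrightarrow> norm (f (z + v) - f z - l *v v)"
      by (intro tendsto_norm tendsto_diff Fl Al)
    then show "norm (f (z + v) - f z - l *v v) \<le> 32 * B / (R/2)\<^sup>2 * (norm v)\<^sup>2"
      by (rule LIMSEQ_le_const2) (use rem[OF v] in blast)
  qed (use R bounded_linear_matrix_vector_mult_complex in auto)
  then show ?thesis by (auto simp: holo_at_def)
qed

lemma Hol_ball_uniform_limit:
  fixes f :: "complex ^ 'n::finite \<Rightarrow> complex ^ 'n"
  assumes hol: "\<And>k x. x \<in> unit_ball \<Longrightarrow> holo_at (F k) x"
    and lim: "\<And>r. r < 1 \<Longrightarrow> uniform_limit (cball 0 r) F f sequentially"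
  shows "f \<in> Hol_ball"
  unfolding Hol_ball_iff
proof
  fix z :: "complex ^ 'n" assume z: "z \<in> unit_ball"
  define R where "R = (1 - norm z) / 2"
  have sub: "ball z R \<subseteq> cball 0 ((1 + norm z) / 2)"
  proof
    fix w assume "w \<in> ball z R"
    then show "w \<in> cball 0 ((1 + norm z) / 2)"
      using norm_triangle_sub[of w z] by (simp add: R_def dist_norm norm_minus_commute field_simps)
  qed
  have r1: "(1 + norm z) / 2 < 1" using z by simp
  show "holo_at f z"
  proof (rule holo_at_uniform_limit)
    show "R > 0" using z by (simp add: R_def)
    show "uniform_limit (ball z R) F f sequentially" by (rule uniform_limit_on_subset[OF lim[OF r1] sub])
    show "holo_at (F k) x" if "x \<in> ball z R" for k x by (rule hol) (use that sub r1 in \<open>auto simp: subset_iff\<close>)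
  qed
qed

section \<open>Slices through the origin and uniform bounds for \<open>class_M\<close>\<close>

lemma caratheodory_disc:
  assumes hol: "q holomorphic_on ball 0 1" and Re: "\<And>w. w \<in> ball 0 1 \<Longrightarrow> Re (q w) \<ge> 0"
    and q0: "q 0 = 1" and w: "norm w < 1"
  shows "norm (q w - 1) \<le> norm w * norm (q w + 1)"
proof (rule field_le_epsilon)
  fix e :: real assume "e > 0"
  \<comment> \<open>A Cayley transform of the half plane, to which the Schwarz lemma is applied.
    Without the shift by \<open>e\<close> its modulus could equal 1 where
    \<open>Re (q w) = 0\<close>; with it the bound is strict, and \<open>e\<close> is
    arbitrary.\<close>
  define m where "m = (\<lambda>w. (q w - 1) / (q w + 1 + of_real e))"
  have nz: "q w + 1 + of_real e \<noteq> 0" if "w \<in> ball 0 1" for w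
    using Re[OF that] \<open>e > 0\<close> by (auto simp: complex_eq_iff)
  have "m holomorphic_on ball 0 1"
    unfolding m_def by (intro holomorphic_intros hol) (use nz in auto)
  moreover have "m 0 = 0" by (simp add: m_def q0)
  moreover have "norm (m w) < 1" if "norm w < 1" for w
  proof -
    have r: "Re (q w) \<ge> 0" using Re that by simp
    have "(Re (q w) - 1)\<^sup>2 < (Re (q w) + 1 + e)\<^sup>2"
    proof -
      have "(2 + e) * (2 * Re (q w) + e) > 0" using r \<open>e > 0\<close> by (intro mult_pos_pos) auto
      then show ?thesis by (simp add: power2_eq_square algebra_simps)
    qed
    then have "norm (q w - 1) < norm (q w + 1 + of_real e)"
      by (simp add: cmod_def)
    then show ?thesis using nz[of w] that by (simp add: m_def norm_divide divide_simps)
  qed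
  ultimately have "norm (m w) \<le> norm w" using Schwarz_Lemma(1)[of m w] w by blast
  then have "norm (q w - 1) \<le> norm w * norm (q w + 1 + of_real e)"
    using nz[of w] w by (simp add: m_def norm_divide divide_simps)
  also have "\<dots> \<le> norm w * (norm (q w + 1) + e)"
    using \<open>e > 0\<close> by (intro mult_left_mono order_trans[OF norm_triangle_ineq]) auto
  also have "\<dots> \<le> norm w * norm (q w + 1) + e"
    using w \<open>e > 0\<close> by (simp add: algebra_simps)
  finally show "norm (q w - 1) \<le> norm w * norm (q w + 1) + e" .
qed

lemma minus_mat_1_mult: "(- mat 1 :: complex ^ 'n::finite ^ 'n) *v v = - v"
  using matrix_vector_mult_diff_rdistrib[of 0 "mat 1" v] by simp

lemma class_M_D:
  assumes "h \<in> class_M"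
  shows "x \<in> unit_ball \<Longrightarrow> holo_at h x" "h 0 = 0" "(h has_derivative (\<lambda>v. - v)) (at 0)"
    "x \<in> unit_ball \<Longrightarrow> inner (h x) x \<le> 0"
proof -
  have "(h has_derivative (\<lambda>v. complex_jacobian h 0 *v v)) (at 0)"
    by (rule holo_at_has_derivative) (use assms in \<open>auto simp: class_M_def Hol_ball_iff\<close>)
  moreover have "(- mat 1 :: complex ^ 'a ^ 'a) *v v = - v" for v
    by (rule minus_mat_1_mult)
  ultimately show "(h has_derivative (\<lambda>v. - v)) (at 0)" using assms by (simp add: class_M_def)
qed (use assms in \<open>auto simp: class_M_def Hol_ball_iff Re_hermitian_inner\<close>)

text \<open>Let \<open>v\<close> be the unit vector in the direction of \<open>x\<close>. The
  function \<open>- hermitian_inner (h (\<zeta> *s v)) v\<close> vanishes at 0 with derivative 1,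
  and its quotient \<open>q\<close> by \<zeta> has real part
  \<open>- inner (h w) w / (norm \<zeta>)\<^sup>2\<close> at \<open>w = \<zeta> *s v\<close>. So
  \<open>q\<close> maps the disc to the closed right half plane with \<open>q 0 = 1\<close>, and
  both claims are bounds for \<open>q (norm x)\<close>. The first drives the decay of the flow; the
  second shows that the radial part of \<open>h x + x\<close> is of third order.\<close>

lemma class_M_slice:
  assumes h: "h \<in> class_M" and x: "norm x < 1"
  shows "inner (h x) x \<le> - (norm x)\<^sup>2 * ((1 - norm x) / (1 + norm x))" (is ?A)
    and "norm (hermitian_inner (h x + x) x) \<le> 2 * (norm x)^3 / (1 - norm x)" (is ?B)
proof -
  have "?A \<and> ?B"
  proof (cases "x = 0")
    case True
    then show ?thesis using class_M_D(2)[OF h] by (simp add: hermitian_inner_def)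
  next
    case False
    define v where "v = of_real (1 / norm x) *s x"
    have v: "norm v = 1" "of_real (norm x) *s v = x"
      using False by (simp_all add: v_def norm_vector_scalar_mult norm_divide vector_smult_assoc)
    define f where "f = (\<lambda>\<zeta>. - hermitian_inner (h (0 + \<zeta> *s v)) v)"
    have inb: "0 + \<zeta> *s v \<in> unit_ball" if "\<zeta> \<in> ball 0 1" for \<zeta>
      using that v by (simp add: norm_vector_scalar_mult)
    have fhol: "f holomorphic_on ball 0 1"
      unfolding f_def by (intro holomorphic_intros slice_holomorphic_on class_M_D(1)[OF h] inb) auto
    have "(f has_field_derivative - hermitian_inner (- mat 1 *v v) v) (at 0)"
      unfolding f_def
      by (intro derivative_intros slice_has_field_derivative)
        (use class_M_D(3)[OF h] in \<open>simp add: minus_mat_1_mult\<close>)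
    then have df: "deriv f 0 = 1"
      using v by (auto dest!: DERIV_imp_deriv simp: minus_mat_1_mult hermitian_inner_self
        hermitian_inner_diff_left[of 0 v v, simplified] hermitian_inner_def[of 0])
    have f0: "f 0 = 0" using class_M_D(2)[OF h] by (simp add: f_def hermitian_inner_def)
    define q where "q = (\<lambda>\<zeta>. if \<zeta> = 0 then deriv f 0 else (f \<zeta> - f 0) / (\<zeta> - 0))"
    have qhol: "q holomorphic_on ball 0 1"
      unfolding q_def by (rule pole_lemma_open[OF fhol]) simp
    have fh: "f \<zeta> * cnj \<zeta> = - hermitian_inner (h (\<zeta> *s v)) (\<zeta> *s v)" for \<zeta>
      by (simp add: f_def hermitian_inner_scale_right)
    have Req: "Re (q \<zeta>) \<ge> 0" if "\<zeta> \<in> ball 0 1" for \<zeta>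
    proof (cases "\<zeta> = 0")
      case False
      have "q \<zeta> = f \<zeta> * cnj \<zeta> / of_real ((norm \<zeta>)\<^sup>2)"
        using False unfolding q_def f0 by (simp add: field_simps flip: complex_norm_square)
      then have "Re (q \<zeta>) = - inner (h (\<zeta> *s v)) (\<zeta> *s v) / (norm \<zeta>)\<^sup>2"
        unfolding fh by (simp add: Re_divide_of_real Re_hermitian_inner del: of_real_power)
      moreover have "inner (h (\<zeta> *s v)) (\<zeta> *s v) \<le> 0"
        using class_M_D(4)[OF h inb[OF that]] by simp
      ultimately show ?thesis by (simp add: divide_nonpos_nonneg)
    qed (simp add: q_def df)
    define p where "p = q (of_real (norm x))"
    have q0: "q 0 = 1" by (simp add: q_def df)
    have car: "norm (p - 1) \<le> norm x * norm (p + 1)"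
      unfolding p_def using caratheodory_disc[OF qhol Req q0, of "of_real (norm x)"] x by simp
    have Rep: "Re p \<ge> 0" unfolding p_def by (rule Req) (use x in simp)
    have hp: "hermitian_inner (h x) x = - p * of_real ((norm x)\<^sup>2)"
      using fh[of "of_real (norm x)"] False unfolding p_def q_def f0 v(2)
      by (simp add: power2_eq_square field_simps)
    let ?r = "norm x"
    have r: "?r > 0" using False by simp
    have "(norm (p - 1))\<^sup>2 \<le> (?r * norm (p + 1))\<^sup>2" using car by (rule power_mono) simp
    then have "(Re p - 1)\<^sup>2 + (Im p)\<^sup>2 \<le> ?r\<^sup>2 * ((Re p + 1)\<^sup>2 + (Im p)\<^sup>2)"
      by (simp add: power_mult_distrib cmod_power2)
    moreover have "?r\<^sup>2 * (Im p)\<^sup>2 \<le> 1 * (Im p)\<^sup>2"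
      using x r by (intro mult_right_mono) (auto simp: power_le_one)
    ultimately have "(Re p - 1)\<^sup>2 \<le> ?r\<^sup>2 * (Re p + 1)\<^sup>2"
      unfolding distrib_left[of "?r\<^sup>2"] by linarith
    then have "(Re p - 1)\<^sup>2 \<le> (?r * (Re p + 1))\<^sup>2" by (simp only: power_mult_distrib)
    then have "\<bar>Re p - 1\<bar> \<le> \<bar>?r * (Re p + 1)\<bar>" by (simp add: abs_le_square_iff)
    then have "1 - Re p \<le> ?r * (Re p + 1)" using Rep r by (simp add: abs_mult)
    moreover have "1 + ?r > 0" using r by linarith
    ultimately have "(1 - ?r) / (1 + ?r) \<le> Re p" by (simp only: pos_divide_le_eq) (simp add: algebra_simps)
    then have "?r\<^sup>2 * ((1 - ?r) / (1 + ?r)) \<le> ?r\<^sup>2 * Re p" by (intro mult_left_mono) auto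
    moreover have "inner (h x) x = - (Re p * ?r\<^sup>2)"
      using hp by (simp flip: Re_hermitian_inner of_real_power)
    ultimately have 1: "inner (h x) x \<le> - ?r\<^sup>2 * ((1 - ?r) / (1 + ?r))" by (simp add: mult.commute)
    have "norm (p + 1) \<le> norm (p - 1) + 2"
      using norm_triangle_ineq[of "p - 1" 2] by (simp add: algebra_simps)
    then have "norm (p - 1) \<le> ?r * (norm (p - 1) + 2)"
      using car r by (meson mult_left_mono norm_ge_zero order_trans)
    then have p1: "norm (p - 1) \<le> 2 * ?r / (1 - ?r)" using x by (simp add: field_simps)
    have "hermitian_inner (h x + x) x = - (p - 1) * of_real (?r\<^sup>2)"
      unfolding hermitian_inner_add_left hp hermitian_inner_self by (simp add: algebra_simps)
    then have "norm (hermitian_inner (h x + x) x) = norm (p - 1) * ?r\<^sup>2"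
      by (simp add: norm_mult norm_minus_commute norm_power)
    also have "\<dots> \<le> 2 * ?r / (1 - ?r) * ?r\<^sup>2" using p1 by (rule mult_right_mono) simp
    also have "\<dots> = 2 * ?r^3 / (1 - ?r)" by (simp add: power3_eq_cube power2_eq_square)
    finally show ?thesis using 1 by blast
  qed
  then show ?A ?B by blast+
qed

text \<open>Polarisation: the holomorphic function \<open>Q\<close> below has \<open>Q 0 = \<langle>\<Gamma> x, y\<rangle>\<close>, and on the unit circle
  \<open>\<bar>Q \<zeta>\<bar> = \<bar>\<langle>\<Gamma> w, w\<rangle>\<bar>\<close> with \<open>w = x + \<zeta> y\<close>.\<close>

lemma class_M_add_id_le:
  assumes h: "h \<in> class_M" and x: "norm x \<le> r" and r: "r < 1"
  shows "norm (h x + x) \<le> 64 / (1 - r)\<^sup>2 * (norm x)\<^sup>2"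
proof (cases "x = 0 \<or> h x + x = 0")
  case True
  then show ?thesis using class_M_D(2)[OF h] by auto
next
  case False
  define \<Gamma> where "\<Gamma> = (\<lambda>x. h x + x)"
  \<comment> \<open>Small enough that \<open>x + \<zeta> *s y\<close> with
    \<open>norm \<zeta> \<le> 1\<close> has norm at most \<open>(1 + r) / 2\<close> and at most
    \<open>2 * norm x\<close>. It is proportional to \<open>norm x\<close>, so that division of a
    cubic bound by \<open>s\<close> leaves a quadratic one.\<close>
  define s where "s = norm x * (1 - r) / 2"
  \<comment> \<open>The vector of length \<open>s\<close> in the direction of
    \<open>\<Gamma> x\<close>, which makes \<open>Q 0\<close> equal to
    \<open>s * norm (\<Gamma> x)\<close>.\<close>
  define y where "y = of_real (s / norm (\<Gamma> x)) *s \<Gamma> x"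
  have s: "s > 0" using False r by (simp add: s_def)
  have \<Gamma>0: "norm (\<Gamma> x) > 0" using False by (simp add: \<Gamma>_def)
  have ny: "norm y = s" using s \<Gamma>0 by (simp add: y_def norm_vector_scalar_mult norm_divide)
  have r0: "0 \<le> r" "0 < norm x" using x False by (auto intro: order_trans[OF norm_ge_zero])
  have "s \<le> norm x" "s \<le> (1 - r) / 2"
  proof -
    show "s \<le> norm x" using r0 by (simp add: s_def algebra_simps)
    have "norm x * ((1 - r) / 2) \<le> 1 * ((1 - r) / 2)" using x r by (intro mult_right_mono) auto
    then show "s \<le> (1 - r) / 2" by (simp add: s_def)
  qed
  note sb = this
  define \<rho> where "\<rho> = norm x + s"
  have \<rho>: "\<rho> \<le> (1 + r) / 2" "\<rho> \<le> 2 * norm x" "\<rho> < 1" "1 - \<rho> \<ge> (1 - r) / 2"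
    using sb x r by (auto simp: \<rho>_def field_simps)
  have hol\<Gamma>: "holo_at \<Gamma> w" if "norm w < 1" for w
  proof -
    from class_M_D(1)[OF h, of w] that obtain A where "(h has_derivative (\<lambda>v. A *v v)) (at w)" by (auto simp: holo_at_def)
    then have "(\<Gamma> has_derivative (\<lambda>v. (A + mat 1) *v v)) (at w)"
      unfolding \<Gamma>_def by (auto intro!: derivative_eq_intros simp: matrix_vector_mult_add_rdistrib)
    then show ?thesis by (auto simp: holo_at_def)
  qed
  have w: "norm (x + \<zeta> *s y) \<le> \<rho>" if "norm \<zeta> \<le> 1" for \<zeta>
  proof -
    have "norm (x + \<zeta> *s y) \<le> norm x + norm \<zeta> * s"
      using norm_triangle_ineq[of x "\<zeta> *s y"] by (simp add: norm_vector_scalar_mult ny)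
    also have "\<dots> \<le> norm x + 1 * s" using that s by (intro add_left_mono mult_right_mono) auto
    finally show ?thesis by (simp add: \<rho>_def)
  qed
  \<comment> \<open>The value of \<open>norm \<zeta>\<close> at which
    \<open>norm x + norm \<zeta> * s\<close> reaches 1. Since \<open>R > 1\<close>, the closed unit
    disc lies inside the domain of \<open>Q\<close>.\<close>
  define R where "R = 1 + (1 - \<rho>) / s"
  have R: "R > 1" using \<rho> s by (simp add: R_def)
  have wR: "norm (x + \<zeta> *s y) < 1" if "\<zeta> \<in> ball 0 R" for \<zeta>
  proof -
    have "norm (x + \<zeta> *s y) \<le> norm x + norm \<zeta> * s"
      using norm_triangle_ineq[of x "\<zeta> *s y"] by (simp add: norm_vector_scalar_mult ny)
    also have "\<dots> < norm x + R * s" using that s by simp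
    also have "\<dots> = 1" using s by (simp add: R_def \<rho>_def field_simps)
    finally show ?thesis .
  qed
  define Q where "Q = (\<lambda>\<zeta>. \<zeta> * hermitian_inner (\<Gamma> (x + \<zeta> *s y)) x + hermitian_inner (\<Gamma> (x + \<zeta> *s y)) y)"
  have Qhol: "Q holomorphic_on ball 0 R"
    unfolding Q_def by (intro holomorphic_intros slice_holomorphic_on hol\<Gamma> wR) auto
  have "norm (Q 0) \<le> 32 * (norm x)^3 / (1 - r)"
  proof (rule maximum_modulus_frontier[of Q "cball 0 1"])
    have sub: "cball 0 1 \<subseteq> ball (0::complex) R" using R by auto
    show "Q holomorphic_on interior (cball 0 1)"
      by (rule holomorphic_on_subset[OF Qhol]) (use sub interior_subset in blast)
    show "continuous_on (closure (cball 0 1)) Q"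
      by (rule continuous_on_subset[OF holomorphic_on_imp_continuous_on[OF Qhol]]) (use sub in simp)
    fix \<zeta> :: complex assume "\<zeta> \<in> frontier (cball 0 1)"
    then have n1: "norm \<zeta> = 1" by simp
    let ?w = "x + \<zeta> *s y"
    have wl: "norm ?w \<le> \<rho>" using w n1 by simp
    have "\<zeta> * cnj \<zeta> = 1" using n1 by (simp add: complex_norm_square[symmetric])
    then have "Q \<zeta> = \<zeta> * hermitian_inner (\<Gamma> ?w) ?w"
      unfolding Q_def hermitian_inner_add_right hermitian_inner_scale_right
      by (simp add: algebra_simps mult.assoc[symmetric])
    then have "norm (Q \<zeta>) = norm (hermitian_inner (\<Gamma> ?w) ?w)" by (simp add: norm_mult n1)
    also have "\<dots> \<le> 2 * (norm ?w)^3 / (1 - norm ?w)"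
      unfolding \<Gamma>_def by (rule class_M_slice(2)[OF h]) (use wl \<rho> in simp)
    also have "\<dots> \<le> 2 * (2 * norm x)^3 / ((1 - r) / 2)"
      using wl \<rho> r by (intro frac_le mult_left_mono power_mono) auto
    also have "\<dots> = 32 * (norm x)^3 / (1 - r)" by (simp add: power3_eq_cube)
    finally show "norm (Q \<zeta>) \<le> 32 * (norm x)^3 / (1 - r)" .
  qed auto
  moreover have "Q 0 = of_real (s * norm (\<Gamma> x))"
    using \<Gamma>0 by (simp add: Q_def y_def hermitian_inner_scale_right hermitian_inner_self power2_eq_square)
  ultimately have "s * norm (\<Gamma> x) \<le> 32 * (norm x)^3 / (1 - r)"
    using s by (simp add: norm_mult)
  then have "norm x * ((1 - r) * norm (\<Gamma> x)) \<le> norm x * (64 * (norm x)\<^sup>2 / (1 - r))"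
    by (simp add: s_def power3_eq_cube power2_eq_square algebra_simps)
  then have "(1 - r) * norm (\<Gamma> x) \<le> 64 * (norm x)\<^sup>2 / (1 - r)" using r0(2) by (simp only: mult_le_cancel_left_pos)
  then have "norm (\<Gamma> x) \<le> 64 * (norm x)\<^sup>2 / (1 - r) / (1 - r)" using r by (simp add: pos_le_divide_eq mult.commute mult.left_commute)
  then show ?thesis by (simp add: \<Gamma>_def power2_eq_square)
qed

text \<open>In \<open>bnd_M\<close>, 65 is the 64 of the bound for \<open>h x + x\<close> plus 1 for
  \<open>x\<close> itself. On balls of radius \<open>(1 - r) / 2\<close> about points of norm at
  most \<open>r\<close> this becomes \<open>260 / (1 - r)\<^sup>2\<close>, and Cauchy's estimates at
  that radius give \<open>1040 = 2 * 260 * 2\<close> in \<open>lip_M\<close> and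
  \<open>33280 = 32 * 260 * 4\<close> in \<open>rem_M\<close>.\<close>

definition lip_M :: "real \<Rightarrow> real" where "lip_M r = 1040 / (1 - r)^3"
definition bnd_M :: "real \<Rightarrow> real" where "bnd_M r = 65 / (1 - r)\<^sup>2"
definition rem_M :: "real \<Rightarrow> real" where "rem_M r = 33280 / (1 - r)^4"

lemma class_M_bounded:
  assumes h: "h \<in> class_M" and x: "norm x \<le> r" and r: "r < 1"
  shows "norm (h x) \<le> bnd_M r"
proof -
  have r0: "0 \<le> r" using x norm_ge_zero order_trans by blast
  have x1: "norm x \<le> 1" using x r by simp
  have one: "1 \<le> 1 / (1 - r)\<^sup>2" using r r0 by (simp add: power_le_one)
  have "norm (h x) \<le> norm (h x + x) + norm x" using norm_triangle_ineq4[of "h x + x" x] by simp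
  also have "norm (h x + x) \<le> 64 / (1 - r)\<^sup>2 * (norm x)\<^sup>2" by (rule class_M_add_id_le[OF assms])
  also have "\<dots> \<le> 64 / (1 - r)\<^sup>2 * 1"
    using x1 by (intro mult_left_mono) (auto simp: power_le_one)
  finally show ?thesis using one x1 by (simp add: bnd_M_def)
qed

lemma class_M_ball_bound:
  assumes h: "h \<in> class_M" and r: "r < 1" and x: "norm x \<le> r" and w: "w \<in> ball x ((1 - r)/2)"
  shows "holo_at h w" "norm (h w) \<le> 260 / (1 - r)\<^sup>2"
proof -
  have "norm w \<le> norm x + dist x w" by (metis dist_norm norm_minus_commute norm_triangle_sub)
  then have nw: "norm w \<le> (1 + r) / 2" using w x by (simp add: field_simps)
  then show "holo_at h w" using class_M_D(1)[OF h, of w] r by simp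
  have "norm (h w) \<le> bnd_M ((1 + r) / 2)" by (rule class_M_bounded[OF h nw]) (use r in simp)
  moreover have "1 - (1 + r) / 2 = (1 - r) / 2" by (simp add: field_simps)
  ultimately show "norm (h w) \<le> 260 / (1 - r)\<^sup>2" by (simp add: bnd_M_def power_divide)
qed

lemma class_M_const_pos: "r < 1 \<Longrightarrow> lip_M r > 0" "r < 1 \<Longrightarrow> bnd_M r > 0" "r < 1 \<Longrightarrow> rem_M r > 0"
  by (simp_all add: lip_M_def bnd_M_def rem_M_def)

lemma class_M_lipschitz:
  assumes h: "h \<in> class_M" and xy: "norm x \<le> r" "norm y \<le> r" and r: "r < 1"
  shows "norm (h x - h y) \<le> lip_M r * norm (x - y)"
proof -
  have "norm (h x - h y) \<le> 2 * (260 / (1 - r)\<^sup>2) / ((1 - r)/2) * norm (x - y)"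
  proof (rule holo_lipschitz[of "cball 0 r" _ "\<Union>x\<in>cball 0 r. ball x ((1 - r)/2)"])
    show "holo_at h w" "norm (h w) \<le> 260 / (1 - r)\<^sup>2"
      if "w \<in> (\<Union>x\<in>cball 0 r. ball x ((1 - r)/2))" for w
      using that class_M_ball_bound[OF h r] by auto
  qed (use r xy in auto)
  then show ?thesis by (simp add: lip_M_def power2_eq_square power3_eq_cube)
qed

lemma class_M_remainder:
  assumes h: "h \<in> class_M" and x: "norm x \<le> r" and r: "r < 1"
  shows "norm v \<le> (1 - r) / 4 \<Longrightarrow> norm (h (x + v) - h x - complex_jacobian h x *v v) \<le> rem_M r * (norm v)\<^sup>2"
    and "norm (complex_jacobian h x *v v) \<le> lip_M r * norm v"
proof -
  have "holo_at h x" using class_M_ball_bound(1)[OF h r x, of x] r by simp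
  then have d: "(h has_derivative (\<lambda>v. complex_jacobian h x *v v)) (at x)" by (rule holo_at_has_derivative)
  have "(1 - r) / 2 > 0" using r by simp
  note * = holo_at_remainder[OF class_M_ball_bound[OF h r x] this d, simplified]
  show "norm (h (x + v) - h x - complex_jacobian h x *v v) \<le> rem_M r * (norm v)\<^sup>2" if "norm v \<le> (1 - r) / 4"
    using *(1)[where v = v] that r by (simp add: rem_M_def power2_eq_square power4_eq_xxxx mult.assoc)
  show "norm (complex_jacobian h x *v v) \<le> lip_M r * norm v"
    using *(2)[where v = v] r by (simp add: lip_M_def power2_eq_square power3_eq_cube)
qed

section \<open>Caratheodory differential equations\<close>

lemma AE_lebesgue_on_iff_negligible:
  assumes "S \<in> sets lebesgue"
  shows "(AE t in lebesgue_on S. P t) \<longleftrightarrow> negligible {t\<in>S. \<not> P t}"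
proof -
  have "(AE t in lebesgue_on S. P t) \<longleftrightarrow> (AE t in lebesgue. t \<in> S \<longrightarrow> P t)"
    by (rule AE_restrict_space_iff) (use assms in simp)
  also have "\<dots> \<longleftrightarrow> negligible {t\<in>S. \<not> P t}"
    unfolding eventually_ae_filter_negligible by (auto intro: negligible_subset)
  finally show ?thesis .
qed

text \<open>Rounding the time inside \<open>u\<close> down to a grid leaves countably many values of
  \<open>u\<close>, each of which gives a measurable function; continuity of \<open>g\<close> in its
  first variable gives the pointwise limit. The values of \<open>u\<close> at grid times stay in
  \<open>range u\<close>, so a field that is well behaved only on the ball can be treated.\<close>

lemma caratheodory_measurable:
  fixes g :: "'a::metric_space \<Rightarrow> real \<Rightarrow> 'b::euclidean_space"
  assumes g: "\<And>x. x \<in> range u \<Longrightarrow> g x \<in> borel_measurable lebesgue"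
    and cont: "\<And>s. continuous_on (range u) (\<lambda>x. g x s)"
    and u: "continuous_on UNIV u"
  shows "(\<lambda>s. g (u s) s) \<in> borel_measurable lebesgue"
proof (rule borel_measurable_LIMSEQ_metric)
  fix n :: nat
  let ?f = "\<lambda>s. \<lfloor>s * real (Suc n)\<rfloor>"
  have "?f \<in> lborel \<rightarrow>\<^sub>M count_space UNIV" by measurable
  then have "?f \<in> lebesgue \<rightarrow>\<^sub>M count_space UNIV" by (rule measurable_completion)
  then show "(\<lambda>s. g (u (of_int (?f s) / real (Suc n))) s) \<in> borel_measurable lebesgue"
    by (rule measurable_compose_countable[rotated]) (intro g rangeI)
next
  fix s :: real assume "s \<in> space lebesgue"
  have "(\<lambda>n. of_int \<lfloor>s * real (Suc n)\<rfloor> / real (Suc n)) \<longlonglongrightarrow> s"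
  proof (rule tendsto_sandwich)
    show "(\<lambda>n. s - 1 / real (Suc n)) \<longlonglongrightarrow> s" by real_asymp
    show "\<forall>\<^sub>F n in sequentially. s - 1 / real (Suc n) \<le> of_int \<lfloor>s * real (Suc n)\<rfloor> / real (Suc n)"
    proof (intro always_eventually allI)
      fix n
      have "s * real (Suc n) - 1 \<le> of_int \<lfloor>s * real (Suc n)\<rfloor>" by linarith
      then have "(s * real (Suc n) - 1) / real (Suc n) \<le> of_int \<lfloor>s * real (Suc n)\<rfloor> / real (Suc n)"
        by (rule divide_right_mono) simp
      then show "s - 1 / real (Suc n) \<le> of_int \<lfloor>s * real (Suc n)\<rfloor> / real (Suc n)"
        by (simp add: diff_divide_distrib)
    qed
    show "\<forall>\<^sub>F n in sequentially. of_int \<lfloor>s * real (Suc n)\<rfloor> / real (Suc n) \<le> s"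
      by (intro always_eventually allI) (simp only: pos_divide_le_eq of_nat_0_less_iff zero_less_Suc of_int_floor_le)
  qed simp
  moreover have "isCont u s" using u by (simp add: continuous_on_eq_continuous_at)
  ultimately have "(\<lambda>n. u (of_int \<lfloor>s * real (Suc n)\<rfloor> / real (Suc n))) \<longlonglongrightarrow> u s"
    by (rule isCont_tendsto_compose[rotated])
  then show "(\<lambda>n. g (u (of_int \<lfloor>s * real (Suc n)\<rfloor> / real (Suc n))) s) \<longlonglongrightarrow> g (u s) s"
    by (rule continuous_on_tendsto_compose[OF cont]) auto
qed

lemma integrable_on_measurable_bounded:
  fixes f :: "real \<Rightarrow> 'a::euclidean_space"
  assumes "f \<in> borel_measurable lebesgue" "\<And>s. s \<in> {a..b} \<Longrightarrow> norm (f s) \<le> B"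
  shows "f integrable_on {a..b}"
proof (rule measurable_bounded_by_integrable_imp_integrable)
  show "f \<in> borel_measurable (lebesgue_on {a..b})"
    using assms(1) by (rule measurable_restrict_space1)
  show "(\<lambda>s. B) integrable_on {a..b}" by (simp add: integrable_const_ivl)
qed (use assms in auto)

text \<open>Extends a curve to negative times by its initial value, because the measurability lemma
  takes curves on the whole line.\<close>

lemma continuous_on_UNIV_max:
  fixes u :: "real \<Rightarrow> 'a::topological_space"
  assumes "\<And>T. continuous_on {0..T} u"
  shows "continuous_on UNIV (\<lambda>t. u (max 0 t))"
  unfolding continuous_on_eq_continuous_at[OF open_UNIV]
proof
  fix t :: real
  have "continuous_on {..<max 0 t + 1} (\<lambda>t. u (max 0 t))"
    by (rule continuous_on_compose2[OF assms[of "max 0 t + 1"]]) (auto intro!: continuous_intros)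
  then show "isCont (\<lambda>t. u (max 0 t)) t"
    by (simp add: continuous_on_eq_continuous_at)
qed

text \<open>Picard iteration, measured against the weight \<open>exp (2 * L * t)\<close>:
  integrating this weight divides by \<open>2 * L\<close> while the Lipschitz condition multiplies
  by \<open>L\<close>, so every step gains a factor 1/2. This gives uniform convergence on every
  bounded time interval at once.\<close>

lemma caratheodory_existence:
  fixes g :: "'a::euclidean_space \<Rightarrow> real \<Rightarrow> 'a"
  assumes meas: "\<And>x. g x \<in> borel_measurable lebesgue"
    and lip: "\<And>x y s. norm (g x s - g y s) \<le> L * norm (x - y)" and L: "L > 0"
    and bnd: "\<And>s. norm (g 0 s) \<le> B"
  obtains u where "continuous_on UNIV u" "\<And>t. t \<ge> 0 \<Longrightarrow> ((\<lambda>s. g (u s) s) has_integral (u t - x0)) {0..t}"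
proof -
  have contg: "continuous_on X (\<lambda>x. g x s)" for s X
    by (rule continuous_on_subset[OF lipschitz_on_continuous_on[of L UNIV]])
      (use lip L in \<open>auto intro!: lipschitz_onI simp: dist_norm\<close>)
  have mg: "(\<lambda>s. g (u s) s) \<in> borel_measurable lebesgue" if "continuous_on UNIV u" for u
    by (rule caratheodory_measurable[OF meas contg that])
  have ig: "(\<lambda>s. g (u s) s) integrable_on {a..b}" if u: "continuous_on UNIV u" for u a b
  proof -
    have "compact (u ` {a..b})" by (intro compact_continuous_image continuous_on_subset[OF u]) auto
    then obtain C where C: "\<And>s. s \<in> {a..b} \<Longrightarrow> norm (u s) \<le> C"
      by (meson bounded_iff compact_imp_bounded image_eqI)
    show ?thesis
    proof (rule integrable_on_measurable_bounded[OF mg[OF u]])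
      fix s assume "s \<in> {a..b}"
      have "norm (g (u s) s) \<le> norm (g (u s) s - g 0 s) + norm (g 0 s)" using norm_triangle_sub[of "g (u s) s" "g 0 s"] by simp
      also have "\<dots> \<le> L * norm (u s) + B" using lip[of "u s" s 0] bnd[of s] by simp
      also have "\<dots> \<le> L * C + B" using C[OF \<open>s \<in> {a..b}\<close>] L by simp
      finally show "norm (g (u s) s) \<le> L * C + B" .
    qed
  qed
  define U where "U = rec_nat (\<lambda>t::real. x0) (\<lambda>k u t. x0 + integral {0..max 0 t} (\<lambda>s. g (u s) s))"
  have U0: "U 0 = (\<lambda>t. x0)" and USuc: "\<And>k. U (Suc k) = (\<lambda>t. x0 + integral {0..max 0 t} (\<lambda>s. g (U k s) s))"
    by (simp_all add: U_def)
  have contU: "continuous_on UNIV (U k)" for k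
  proof (induction k)
    case (Suc k)
    show ?case unfolding USuc
      by (intro continuous_on_add continuous_on_const continuous_on_UNIV_max indefinite_integral_continuous_1 ig Suc)
  qed (simp add: U0)
  define M where "M = L * norm x0 + B"
  have M: "norm (g x0 s) \<le> M" for s
    using lip[of x0 s 0] bnd[of s] norm_triangle_sub[of "g x0 s" "g 0 s"] by (simp add: M_def)
  have M0: "M \<ge> 0" using M[of 0] norm_ge_zero order_trans by blast
  \<comment> \<open>Chosen for the first increment: it is at most \<open>M * t\<close>, which equals
    \<open>C * (2 * L * t)\<close> and is below \<open>C * exp (2 * L * t)\<close>.\<close>
  define C where "C = M / (2 * L)"
  have C0: "C \<ge> 0" using M0 L by (simp add: C_def)
  have exp_int: "((\<lambda>s. exp (2 * L * s)) has_integral (exp (2 * L * t) - 1) / (2 * L)) {0..t}" if "t \<ge> 0" for t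
  proof -
    have "((\<lambda>s. exp (2 * L * s)) has_integral (exp (2 * L * t) / (2 * L) - exp (2 * L * 0) / (2 * L))) {0..t}"
      using that L by (intro fundamental_theorem_of_calculus)
        (auto intro!: derivative_eq_intros simp flip: has_real_derivative_iff_has_vector_derivative)
    then show ?thesis by (simp add: diff_divide_distrib)
  qed
  have step: "norm (U (Suc k) t - U k t) \<le> C * (1/2)^k * exp (2 * L * max 0 t)" for k t
  proof (induction k arbitrary: t)
    case 0
    have "norm (integral {0..max 0 t} (\<lambda>s. g x0 s)) \<le> M * (max 0 t)"
      using ig[of "\<lambda>s. x0" 0 "max 0 t"] M M0
        has_integral_bound_real[of M "{}" "g x0" _ 0 "max 0 t"]
      by (auto dest!: integrable_integral)
    also have "\<dots> = C * (2 * L * max 0 t)" using L by (simp add: C_def)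
    also have "\<dots> \<le> C * exp (2 * L * max 0 t)"
      using C0 by (intro mult_left_mono) (use exp_ge_add_one_self[of "2 * L * max 0 t"] in linarith)
    finally show ?case by (simp add: U0 USuc)
  next
    case (Suc k)
    let ?t = "max 0 t"
    have "norm (U (Suc (Suc k)) t - U (Suc k) t) = norm (integral {0..?t} (\<lambda>s. g (U (Suc k) s) s - g (U k s) s))"
      unfolding integral_diff[OF ig[OF contU] ig[OF contU]] fun_cong[OF USuc[of "Suc k"]]
      by (subst (2) USuc) simp
    also have "\<dots> \<le> integral {0..?t} (\<lambda>s. L * (C * (1/2)^k) * exp (2 * L * s))"
    proof (rule integral_norm_bound_integral)
      show "(\<lambda>s. g (U (Suc k) s) s - g (U k s) s) integrable_on {0..?t}" by (intro integrable_diff ig contU)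
      show "(\<lambda>s. L * (C * (1/2)^k) * exp (2 * L * s)) integrable_on {0..?t}"
        using exp_int[of ?t] by (intro integrable_on_mult_right) (auto simp: integrable_on_def)
      fix s assume s: "s \<in> {0..?t}"
      have "norm (g (U (Suc k) s) s - g (U k s) s) \<le> L * norm (U (Suc k) s - U k s)" by (rule lip)
      also have "\<dots> \<le> L * (C * (1/2)^k * exp (2 * L * max 0 s))" using Suc L by (intro mult_left_mono) auto
      finally show "norm (g (U (Suc k) s) s - g (U k s) s) \<le> L * (C * (1/2)^k) * exp (2 * L * s)"
        using s by (simp add: mult.assoc)
    qed
    also have "\<dots> = L * (C * (1/2)^k) * ((exp (2 * L * ?t) - 1) / (2 * L))"
      by (intro integral_unique has_integral_mult_right exp_int) simp
    also have "\<dots> \<le> C * (1/2)^Suc k * exp (2 * L * ?t)"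
      using L C0 by (simp add: field_simps)
    finally show ?case .
  qed
  define u where "u = (\<lambda>t. x0 + (\<Sum>k. U (Suc k) t - U k t))"
  have ul: "uniform_limit {..T} U u sequentially" for T
  proof -
    have "uniform_limit {..T} (\<lambda>n t. \<Sum>i<n. U (Suc i) t - U i t) (\<lambda>t. \<Sum>k. U (Suc k) t - U k t) sequentially"
    proof (rule Weierstrass_m_test)
      show "norm (U (Suc n) t - U n t) \<le> C * exp (2 * L * max 0 T) * (1/2)^n" if "t \<in> {..T}" for n t
      proof -
        have "C * (1/2)^n * exp (2 * L * max 0 t) \<le> C * (1/2)^n * exp (2 * L * max 0 T)"
          using that C0 L by (intro mult_left_mono) (auto simp: max_def mult_le_cancel_left)
        then show ?thesis using step[of n t] by (simp add: mult_ac)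
      qed
      show "summable (\<lambda>n. C * exp (2 * L * max 0 T) * (1/2)^n)" by (intro summable_mult summable_geometric) simp
    qed
    then have "uniform_limit {..T} (\<lambda>n t. x0 + (\<Sum>i<n. U (Suc i) t - U i t)) u sequentially"
      unfolding u_def by (intro uniform_limit_intros)
    moreover have "x0 + (\<Sum>i<n. U (Suc i) t - U i t) = U n t" for n t
      using sum_lessThan_telescope[of "\<lambda>i. U i t" n] by (simp add: U0)
    ultimately show ?thesis by simp
  qed
  have contu: "continuous_on UNIV u"
    unfolding continuous_on_eq_continuous_at[OF open_UNIV]
  proof
    fix t :: real
    have "continuous_on {..t+1} u"
      by (rule uniform_limit_theorem[OF _ ul])
        (auto intro!: always_eventually continuous_on_subset[OF contU])
    then have "continuous_on {..<t+1} u" by (rule continuous_on_subset) auto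
    then show "isCont u t" by (simp add: continuous_on_eq_continuous_at)
  qed
  have "((\<lambda>s. g (u s) s) has_integral (u t - x0)) {0..t}" if t: "t \<ge> 0" for t
  proof -
    have ptU: "(\<lambda>k. U k t) \<longlonglongrightarrow> u t" by (rule tendsto_uniform_limitI[OF ul[of t]]) simp
    have "(\<lambda>k. integral {0..t} (\<lambda>s. g (U k s) s)) \<longlonglongrightarrow> integral {0..t} (\<lambda>s. g (u s) s)"
    proof (rule LIMSEQ_I)
      fix e :: real assume "e > 0"
      then have "e / (L * (t + 1)) > 0" using L t by simp
      then obtain N where N: "\<And>k s. k \<ge> N \<Longrightarrow> s \<in> {..t} \<Longrightarrow> dist (U k s) (u s) < e / (L * (t + 1))"
        using ul[of t] unfolding uniform_limit_iff eventually_sequentially by meson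
      have "norm (integral {0..t} (\<lambda>s. g (U k s) s) - integral {0..t} (\<lambda>s. g (u s) s)) < e" if "k \<ge> N" for k
      proof -
        have "integral {0..t} (\<lambda>s. g (U k s) s) - integral {0..t} (\<lambda>s. g (u s) s)
            = integral {0..t} (\<lambda>s. g (U k s) s - g (u s) s)"
          by (rule integral_diff[symmetric]) (intro ig contU contu)+
        also have "norm \<dots> \<le> integral {0..t} (\<lambda>s. e / (t + 1))"
        proof (rule integral_norm_bound_integral)
          fix s assume "s \<in> {0..t}"
          have "norm (g (U k s) s - g (u s) s) \<le> L * norm (U k s - u s)" by (rule lip)
          also have "\<dots> \<le> L * (e / (L * (t + 1)))"
            using N[OF that, of s] \<open>s \<in> {0..t}\<close> L by (intro mult_left_mono) (auto simp: dist_norm)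
          also have "\<dots> = e / (t + 1)" using L by simp
          finally show "norm (g (U k s) s - g (u s) s) \<le> e / (t + 1)" .
        qed (auto intro!: integrable_diff ig contU contu)
        also have "\<dots> < e" using t \<open>e > 0\<close> by (simp add: field_simps)
        finally show ?thesis .
      qed
      then show "\<exists>N. \<forall>k\<ge>N. norm (integral {0..t} (\<lambda>s. g (U k s) s) - integral {0..t} (\<lambda>s. g (u s) s)) < e" by blast
    qed
    then have "(\<lambda>k. U (Suc k) t) \<longlonglongrightarrow> x0 + integral {0..t} (\<lambda>s. g (u s) s)"
      unfolding USuc using t by (auto intro!: tendsto_intros)
    moreover have "(\<lambda>k. U (Suc k) t) \<longlonglongrightarrow> u t" using ptU by (rule LIMSEQ_Suc)
    ultimately have "u t = x0 + integral {0..t} (\<lambda>s. g (u s) s)" by (rule LIMSEQ_unique[rotated])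
    then show ?thesis using integrable_integral[OF ig[OF contu, of 0 t]] by simp
  qed
  with contu show thesis by (rule that)
qed

section \<open>Gronwall inequalities, forwards and backwards in time\<close>

lemma gronwall:
  fixes w :: "real \<Rightarrow> real"
  assumes cont: "continuous_on {0..T} w" and L: "L \<ge> 0"
    and w: "\<And>t. t \<in> {0..T} \<Longrightarrow> w t \<le> c + L * integral {0..t} w" and t: "t \<in> {0..T}"
  shows "w t \<le> c * exp (L * t)"
proof -
  define W where "W = (\<lambda>t. c + L * integral {0..t} w)"
  define E where "E = (\<lambda>t. W t * exp (- (L * t)))"
  have dW: "(W has_real_derivative L * w x) (at x within {0..T})" if "x \<in> {0..T}" for x
    unfolding W_def by (auto intro!: derivative_eq_intros integral_has_real_derivative cont that)
  have "E t \<le> E 0"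
  proof (rule DERIV_nonpos_imp_decreasing_open[of 0 t])
    show "0 \<le> t" using t by simp
    have "continuous_on {0..T} W" by (rule DERIV_continuous_on[OF dW])
    then show "continuous_on {0..t} E"
      unfolding E_def using t by (intro continuous_intros) (auto intro: continuous_on_subset)
    fix x assume x: "0 < x" "x < t"
    then have "(W has_real_derivative L * w x) (at x)"
      using dW[of x] t at_within_interior[of x "{0..T}"] by auto
    then have "(E has_real_derivative exp (- (L * x)) * (L * (w x - W x))) (at x)"
      unfolding E_def by (auto intro!: derivative_eq_intros simp: algebra_simps)
    moreover have "w x \<le> W x" unfolding W_def by (rule w) (use x t in auto)
    ultimately show "\<exists>y. (E has_real_derivative y) (at x) \<and> y \<le> 0"
      using L by (intro exI conjI) (auto intro!: mult_nonneg_nonpos)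
  qed
  then have "W t * exp (- (L * t)) \<le> c" by (simp add: E_def W_def)
  then have "W t \<le> c * exp (L * t)" by (simp add: exp_minus field_simps)
  with w[OF t] show ?thesis by (simp add: W_def)
qed

text \<open>\<open>w0\<close> carries a difference of initial values and \<open>e\<close> a defect
  in the equation. With \<open>e = 0\<close> it gives Lipschitz dependence on the initial point;
  with \<open>w0 = 0\<close> it compares the flow with its linearisation.\<close>

lemma gronwall_has_integral:
  fixes w :: "real \<Rightarrow> 'a::euclidean_space"
  assumes cont: "continuous_on {0..T} w" and L: "L \<ge> 0" and e: "e \<ge> 0"
    and w: "\<And>t. t \<in> {0..T} \<Longrightarrow> (f has_integral (w t - w0)) {0..t}"
    and f: "\<And>s. s \<in> {0..T} \<Longrightarrow> norm (f s) \<le> L * norm (w s) + e"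
    and t: "t \<in> {0..T}"
  shows "norm (w t) \<le> (norm w0 + e * T) * exp (L * t)"
proof (rule gronwall[of T "\<lambda>t. norm (w t)"])
  show c: "continuous_on {0..T} (\<lambda>t. norm (w t))" by (intro continuous_intros cont)
  fix t assume t: "t \<in> {0..T}"
  have i: "(\<lambda>s. norm (w s)) integrable_on {0..t}"
    by (rule integrable_continuous_interval) (rule continuous_on_subset[OF c], use t in auto)
  have "norm (w t - w0) = norm (integral {0..t} f)" using w[OF t] by (simp add: integral_unique)
  also have "\<dots> \<le> integral {0..t} (\<lambda>s. L * norm (w s) + e)"
    by (rule integral_norm_bound_integral)
      (use w[OF t] f t i in \<open>auto intro!: integrable_add integrable_on_mult_right simp: integrable_on_def[of f]\<close>)
  also have "\<dots> = L * integral {0..t} (\<lambda>s. norm (w s)) + e * t"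
    using i t by (subst integral_add) (auto intro!: integrable_on_mult_right)
  finally have "norm (w t) \<le> norm w0 + e * t + L * integral {0..t} (\<lambda>s. norm (w s))"
    using norm_triangle_sub[of "w t" w0] by simp
  also have "e * t \<le> e * T" using t e by (intro mult_left_mono) auto
  finally show "norm (w t) \<le> norm w0 + e * T + L * integral {0..t} (\<lambda>s. norm (w s))" by simp
qed (use L t in auto)

text \<open>Let \<open>W t\<close> be the integral of \<open>norm (w s)\<close> from
  \<open>t\<close> to \<open>T\<close>. The terminal condition gives
  \<open>norm (w t) \<le> L * W t\<close>, hence \<open>W t * exp (L * t)\<close> is nondecreasing;
  as it vanishes at \<open>T\<close>, \<open>W 0\<close> is not positive.\<close>

lemma gronwall_backward:
  fixes w :: "real \<Rightarrow> 'a::euclidean_space"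
  assumes cont: "continuous_on {0..T} w" and L: "L \<ge> 0" and T: "T \<ge> 0"
    and w: "\<And>t. t \<in> {0..T} \<Longrightarrow> (f has_integral (w t - w0)) {0..t}"
    and f: "\<And>s. s \<in> {0..T} \<Longrightarrow> norm (f s) \<le> L * norm (w s)"
    and wT: "w T = 0"
  shows "w 0 = 0"
proof -
  let ?n = "\<lambda>t. norm (w t)"
  have c: "continuous_on {0..T} ?n" by (intro continuous_intros cont)
  have i: "?n integrable_on {0..T}" by (rule integrable_continuous_interval[OF c])
  define W where "W = (\<lambda>t. integral {0..T} ?n - integral {0..t} ?n)"
  have le: "?n t \<le> L * W t" if t: "t \<in> {0..T}" for t
  proof -
    have fT: "f integrable_on {0..T}" using w[of T] T by auto
    have ft: "f integrable_on {t..T}" using integrable_on_subinterval[OF fT, of t T] t by auto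
    have it: "?n integrable_on {t..T}" using integrable_on_subinterval[OF i, of t T] t by auto
    have "integral {0..t} f + integral {t..T} f = integral {0..T} f"
      using t by (intro Henstock_Kurzweil_Integration.integral_combine fT) auto
    then have "w t + integral {t..T} f = 0"
      using w[of t] w[of T] t T wT by (simp add: integral_unique)
    then have "- w t = integral {t..T} f" by (rule minus_unique)
    then have "norm (w t) = norm (integral {t..T} f)" by (metis norm_minus_cancel)
    also have "\<dots> \<le> integral {t..T} (\<lambda>s. L * ?n s)"
      by (rule integral_norm_bound_integral) (use ft it f t in \<open>auto intro!: integrable_on_mult_right\<close>)
    also have "\<dots> = L * integral {t..T} ?n" by simp
    also have "integral {t..T} ?n = W t"
      using Henstock_Kurzweil_Integration.integral_combine[of 0 t T ?n] t i by (simp add: W_def)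
    finally show ?thesis .
  qed
  define E where "E = (\<lambda>t. - (W t * exp (L * t)))"
  have dW: "(W has_real_derivative - ?n x) (at x within {0..T})" if "x \<in> {0..T}" for x
    unfolding W_def by (auto intro!: derivative_eq_intros integral_has_real_derivative c that)
  have "E T \<le> E 0"
  proof (rule DERIV_nonpos_imp_decreasing_open[OF T])
    have "continuous_on {0..T} W" by (rule DERIV_continuous_on[OF dW])
    then show "continuous_on {0..T} E" unfolding E_def by (intro continuous_intros)
    fix x assume x: "0 < x" "x < T"
    then have "(W has_real_derivative - ?n x) (at x)"
      using dW[of x] at_within_interior[of x "{0..T}"] by auto
    then have "(E has_real_derivative - (exp (L * x) * (L * W x - ?n x))) (at x)"
      unfolding E_def by (auto intro!: derivative_eq_intros simp: algebra_simps)
    moreover have "?n x \<le> L * W x" by (rule le) (use x in auto)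
    ultimately show "\<exists>y. (E has_real_derivative y) (at x) \<and> y \<le> 0"
      by (intro exI conjI) auto
  qed
  then have "W 0 \<le> 0" by (simp add: E_def W_def)
  then have "L * W 0 \<le> 0" using L by (simp add: mult_nonneg_nonpos)
  moreover have "?n 0 \<le> L * W 0" by (rule le) (use T in simp)
  ultimately have "?n 0 \<le> 0" by linarith
  then show ?thesis by simp
qed

section \<open>Indefinite integrals: Lipschitz bounds, derivatives and monotonicity\<close>

lemma lipschitz_on_absolutely_continuous_on:
  assumes lip: "C-lipschitz_on S u"
  shows "absolutely_continuous_on S u"
  unfolding absolutely_continuous_on_def
proof (intro allI impI)
  have "C \<ge> 0" by (rule lipschitz_on_nonneg[OF lip])
  fix e :: real assume "e > 0"
  show "\<exists>d>0. \<forall>I. finite I \<and> (\<forall>(a, b)\<in>I. a \<le> b \<and> {a..b} \<subseteq> S) \<and>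
       pairwise (\<lambda>(a, b) (a', b'). {a<..<b} \<inter> {a'<..<b'} = {}) I \<and>
       (\<Sum>(a, b)\<in>I. b - a) < d \<longrightarrow> (\<Sum>(a, b)\<in>I. norm (u b - u a)) < e"
  proof (intro exI[of _ "e / (C + 1)"] conjI allI impI; (elim conjE)?)
    show "0 < e / (C + 1)" using \<open>e > 0\<close> \<open>C \<ge> 0\<close> by simp
    fix I :: "(real \<times> real) set"
    assume I: "\<forall>(a, b)\<in>I. a \<le> b \<and> {a..b} \<subseteq> S" and s: "(\<Sum>(a, b)\<in>I. b - a) < e / (C + 1)"
    have "(\<Sum>(a, b)\<in>I. norm (u b - u a)) \<le> (\<Sum>(a, b)\<in>I. C * (b - a))"
    proof (rule sum_mono, clarify)
      fix a b assume "(a, b) \<in> I"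
      then have "a \<le> b" "{a..b} \<subseteq> S" using I by auto
      then have "b \<in> S" "a \<in> S" by auto
      from lipschitz_onD[OF lip this] show "norm (u b - u a) \<le> C * (b - a)" using \<open>a \<le> b\<close> by (simp add: dist_norm)
    qed
    also have "\<dots> = C * (\<Sum>(a, b)\<in>I. b - a)" by (simp add: sum_distrib_left case_prod_unfold)
    also have "\<dots> \<le> (C + 1) * (\<Sum>(a, b)\<in>I. b - a)"
      using I by (intro mult_right_mono sum_nonneg) auto
    also have "\<dots> < e" using s \<open>C \<ge> 0\<close> by (simp add: field_simps)
    finally show "(\<Sum>(a, b)\<in>I. norm (u b - u a)) < e" .
  qed
qed

lemma has_integral_increment:
  fixes u :: "real \<Rightarrow> 'a::euclidean_space"
  assumes "\<And>t. t \<ge> 0 \<Longrightarrow> (f has_integral (u t - u0)) {0..t}" "0 \<le> a" "a \<le> b"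
  shows "(f has_integral (u b - u a)) {a..b}"
proof -
  have "f integrable_on {0..b}" using assms(1)[of b] assms(2,3) by auto
  then have "f integrable_on {a..b}" "integral {0..a} f + integral {a..b} f = integral {0..b} f"
    using assms(2,3) by (auto intro: integrable_on_subinterval Henstock_Kurzweil_Integration.integral_combine)
  moreover have "integral {0..a} f = u a - u0" "integral {0..b} f = u b - u0"
    using assms(1)[of a] assms(1)[of b] assms(2,3) by (auto intro: integral_unique)
  ultimately show ?thesis by (metis add_diff_cancel_left' diff_diff_eq2 diff_add_cancel integrable_integral)
qed

lemma has_integral_lipschitz:
  fixes u :: "real \<Rightarrow> 'a::euclidean_space"
  assumes int: "\<And>t. t \<ge> 0 \<Longrightarrow> (f has_integral (u t - u0)) {0..t}"
    and f: "\<And>s. 0 \<le> s \<Longrightarrow> s \<le> b \<Longrightarrow> norm (f s) \<le> B" and B: "0 \<le> B" and ab: "0 \<le> a" "a \<le> b"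
  shows "norm (u b - u a) \<le> B * (b - a)"
  using has_integral_bound_real[OF B _ has_integral_increment[OF int ab], of "{}"] f ab by auto

lemma has_integral_derivative_negligible:
  fixes u :: "real \<Rightarrow> 'a::euclidean_space"
  assumes int: "\<And>t. t \<ge> 0 \<Longrightarrow> (f has_integral (u t - u0)) {0..t}"
  shows "negligible {t. t > 0 \<and> \<not> (u has_vector_derivative f t) (at t)}"
proof (rule negligible_subset)
  show "negligible (\<Union>n. {x\<in>{0<..<real n}. \<not> ((\<lambda>t. integral {0..t} f) has_vector_derivative f x) (at x)})"
    by (rule negligible_Union_nat, rule integral_has_vector_derivative_ae) (use int of_nat_0_le_iff in blast)
  show "{t. t > 0 \<and> \<not> (u has_vector_derivative f t) (at t)} \<subseteq>
    (\<Union>n. {x\<in>{0<..<real n}. \<not> ((\<lambda>t. integral {0..t} f) has_vector_derivative f x) (at x)})"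
  proof safe
    fix x :: real assume x: "x > 0" and no: "\<not> (u has_vector_derivative f x) (at x)"
    obtain n where n: "x < real n" using reals_Archimedean2 by blast
    have "\<not> ((\<lambda>t. integral {0..t} f) has_vector_derivative f x) (at x)"
    proof
      assume "((\<lambda>t. integral {0..t} f) has_vector_derivative f x) (at x)"
      then have "((\<lambda>t. u0 + integral {0..t} f) has_vector_derivative f x) (at x)"
        by (auto intro!: derivative_eq_intros)
      then have "(u has_vector_derivative f x) (at x)"
      proof (rule has_vector_derivative_transform_within_open[of _ _ _ "{0<..}"])
        show "u0 + integral {0..y} f = u y" if "y \<in> {0<..}" for y
          using int[of y] that by (simp add: integral_unique)
      qed (use x in auto)
      with no show False ..
    qed
    with x n show "x \<in> (\<Union>n. {x\<in>{0<..<real n}. \<not> ((\<lambda>t. integral {0..t} f) has_vector_derivative f x) (at x)})"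
      by auto
  qed
qed

lemma absolutely_continuous_nonincreasing:
  fixes q :: "real \<Rightarrow> real"
  assumes "a \<le> b" "absolutely_continuous_on {a..b} q" "negligible N"
    and "\<And>x. x \<in> {a..b} - N \<Longrightarrow> (q has_vector_derivative d x) (at x within {a..b}) \<and> d x \<le> 0"
  shows "q b \<le> q a"
proof -
  define d' where "d' = (\<lambda>x. if x \<in> N then 0 else d x)"
  have "(d' has_integral q b - q a) {a..b}"
    by (rule fundamental_theorem_absolutely_continuous[OF assms(1-3)]) (use assms(4) in \<open>auto simp: d'_def\<close>)
  then have "q b - q a \<le> 0"
    by (rule has_integral_le[OF _ has_integral_0]) (use assms(4) in \<open>auto simp: d'_def\<close>)
  then show ?thesis by simp
qed

section \<open>Flows of Herglotz vector fields\<close>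

lemma continuous_on_compact_norm_le:
  assumes "compact S" "continuous_on S f"
  obtains B where "\<And>x. x \<in> S \<Longrightarrow> norm (f x) \<le> B"
  using compact_imp_bounded[OF compact_continuous_image[OF assms(2,1)]] by (auto simp: bounded_iff)

text \<open>Weighted quantities such as \<open>exp (b t) * (norm (u t))\<^sup>2\<close> and
  \<open>exp t *\<^sub>R u t\<close> are Lipschitz by this lemma. They are therefore absolutely
  continuous, and derivatives outside a null set control them.\<close>

lemma lipschitz_on_bilinear:
  fixes f :: "real \<Rightarrow> 'a::real_normed_vector" and g :: "real \<Rightarrow> 'b::real_normed_vector"
    and prod :: "'a \<Rightarrow> 'b \<Rightarrow> 'c::real_normed_vector"
  assumes "bounded_bilinear prod" "compact S"
    and f: "\<exists>C. C-lipschitz_on S f" and g: "\<exists>C. C-lipschitz_on S g"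
  shows "\<exists>C. C-lipschitz_on S (\<lambda>x. prod (f x) (g x))"
proof -
  interpret bounded_bilinear prod by fact
  obtain Cf Cg where C: "Cf-lipschitz_on S f" "Cg-lipschitz_on S g" using f g by blast
  obtain P where P: "\<And>x. x \<in> S \<Longrightarrow> norm (f x) \<le> P"
    by (rule continuous_on_compact_norm_le[OF assms(2) lipschitz_on_continuous_on[OF C(1)]]) (rule that)
  obtain Q where Q: "\<And>x. x \<in> S \<Longrightarrow> norm (g x) \<le> Q"
    by (rule continuous_on_compact_norm_le[OF assms(2) lipschitz_on_continuous_on[OF C(2)]]) (rule that)
  obtain K where K: "\<And>a b. norm (prod a b) \<le> norm a * norm b * K" and K0: "K \<ge> 0"
    using nonneg_bounded by blast
  show ?thesis
  proof (intro exI lipschitz_onI)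
    show "0 \<le> \<bar>P\<bar> * Cg * K + Cf * \<bar>Q\<bar> * K"
      using C K0 by (auto intro!: add_nonneg_nonneg mult_nonneg_nonneg dest: lipschitz_on_nonneg)
    fix x y assume xy: "x \<in> S" "y \<in> S"
    have nonneg: "Cf \<ge> 0" "Cg \<ge> 0" using C lipschitz_on_nonneg by auto
    have "prod (f x) (g x) - prod (f y) (g y) = prod (f x) (g x - g y) + prod (f x - f y) (g y)"
      by (simp add: diff_right diff_left)
    then have "dist (prod (f x) (g x)) (prod (f y) (g y)) \<le> norm (prod (f x) (g x - g y)) + norm (prod (f x - f y) (g y))"
      by (simp add: dist_norm norm_triangle_ineq)
    also have "\<dots> \<le> norm (f x) * norm (g x - g y) * K + norm (f x - f y) * norm (g y) * K"
      by (intro add_mono K)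
    also have "\<dots> \<le> \<bar>P\<bar> * (Cg * dist x y) * K + (Cf * dist x y) * \<bar>Q\<bar> * K"
    proof (intro add_mono mult_right_mono mult_mono K0)
      show "norm (f x) \<le> \<bar>P\<bar>" "norm (g y) \<le> \<bar>Q\<bar>" using P[OF xy(1)] Q[OF xy(2)] by auto
      show "norm (g x - g y) \<le> Cg * dist x y" "norm (f x - f y) \<le> Cf * dist x y"
        using lipschitz_onD[OF C(2) xy] lipschitz_onD[OF C(1) xy] by (auto simp: dist_norm)
    qed (use nonneg in auto)
    finally show "dist (prod (f x) (g x)) (prod (f y) (g y)) \<le> (\<bar>P\<bar> * Cg * K + Cf * \<bar>Q\<bar> * K) * dist x y"
      by (simp add: algebra_simps)
  qed
qed

lemma C1_lipschitz_on:
  fixes b :: "real \<Rightarrow> real"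
  assumes "\<And>s. s \<in> {0..T} \<Longrightarrow> (b has_real_derivative b' s) (at s)" "continuous_on {0..T} b'"
  shows "\<exists>C. C-lipschitz_on {0..T} b"
proof -
  obtain C where C: "\<And>s. s \<in> {0..T} \<Longrightarrow> norm (b' s) \<le> C"
    by (rule continuous_on_compact_norm_le[OF compact_Icc assms(2)]) (rule that)
  have "\<bar>C\<bar>-lipschitz_on {0..T} b"
  proof (rule bounded_derivative_imp_lipschitz)
    fix s assume s: "s \<in> {0..T}"
    show "(b has_derivative (\<lambda>x. b' s * x)) (at s within {0..T})"
      using assms(1)[OF s] by (simp add: has_field_derivative_def has_derivative_at_withinI)
    show "onorm (\<lambda>x. b' s * x) \<le> \<bar>C\<bar>"
      by (rule onorm_le) (use C[OF s] in \<open>auto simp: abs_mult intro!: mult_right_mono\<close>)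
  qed auto
  then show ?thesis by blast
qed

lemma has_integral_lipschitz_on:
  fixes u :: "real \<Rightarrow> 'a::euclidean_space"
  assumes int: "\<And>t. t \<ge> 0 \<Longrightarrow> (f has_integral (u t - u0)) {0..t}"
    and f: "\<And>s. 0 \<le> s \<Longrightarrow> norm (f s) \<le> B" and B: "0 \<le> B"
  shows "B-lipschitz_on {0..T} u"
proof (rule lipschitz_onI)
  fix x y assume xy: "x \<in> {0..T}" "y \<in> {0..T}"
  show "dist (u x) (u y) \<le> B * dist x y"
  proof (cases "x \<le> y")
    case True
    then show ?thesis
      using has_integral_lipschitz[OF int _ B, of y x] f xy by (simp add: dist_norm norm_minus_commute)
  next
    case False
    then show ?thesis
      using has_integral_lipschitz[OF int _ B, of x y] f xy by (simp add: dist_norm)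
  qed
qed (rule B)

text \<open>Outside a null set the derivative of \<open>exp (b t) * (norm (u t))\<^sup>2\<close> is
  \<open>exp (b t)\<close> times the left side of the condition \<open>dec\<close>. A constant
  \<open>b\<close> will give invariance of balls, a linear one exponential decay, and a corrected
  linear one the optimal rate.\<close>

lemma energy_estimate:
  fixes u :: "real \<Rightarrow> 'a::euclidean_space"
  assumes int: "\<And>t. t \<ge> 0 \<Longrightarrow> (f has_integral (u t - u0)) {0..t}"
    and f: "\<And>s. 0 \<le> s \<Longrightarrow> norm (f s) \<le> B"
    and b: "\<And>s. (b has_real_derivative b' s) (at s)" and b': "continuous_on UNIV b'"
    and dec: "\<And>s. s > 0 \<Longrightarrow> b' s * (norm (u s))\<^sup>2 + 2 * inner (f s) (u s) \<le> 0"
    and T: "T \<ge> 0"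
  shows "exp (b T) * (norm (u T))\<^sup>2 \<le> exp (b 0) * (norm (u 0))\<^sup>2"
proof -
  have B: "B \<ge> 0" using f[of 0] norm_ge_zero order_trans by blast
  have lu: "\<exists>C. C-lipschitz_on {0..T} u" using has_integral_lipschitz_on[OF int f B] by blast
  have cb: "continuous_on X b" for X
    by (rule DERIV_continuous_on[of _ _ b']) (use b has_field_derivative_at_within in blast)
  have le: "\<exists>C. C-lipschitz_on {0..T} (\<lambda>t. exp (b t))"
    by (rule C1_lipschitz_on[where b' = "\<lambda>s. exp (b s) * b' s"])
      (auto intro!: derivative_eq_intros continuous_intros b cb continuous_on_subset[OF b'])
  define q where "q = (\<lambda>t. exp (b t) * inner (u t) (u t))"
  have "\<exists>C. C-lipschitz_on {0..T} (\<lambda>t. inner (u t) (u t))"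
    by (rule lipschitz_on_bilinear[OF bounded_bilinear_inner _ lu lu]) simp
  then have "\<exists>C. C-lipschitz_on {0..T} q"
    unfolding q_def by (intro lipschitz_on_bilinear[OF bounded_bilinear_mult _ le]) simp
  then have ac: "absolutely_continuous_on {0..T} q" using lipschitz_on_absolutely_continuous_on by blast
  define N where "N = {t. t > 0 \<and> \<not> (u has_vector_derivative f t) (at t)} \<union> {0}"
  have N: "negligible N"
    unfolding N_def by (intro negligible_Un has_integral_derivative_negligible[OF int]) auto
  have "q T \<le> q 0"
  proof (rule absolutely_continuous_nonincreasing[OF T ac N])
    fix x assume "x \<in> {0..T} - N"
    then have x: "x > 0" and du: "(u has_vector_derivative f x) (at x)" by (auto simp: N_def)
    have de: "((\<lambda>t. exp (b t)) has_real_derivative exp (b x) * b' x) (at x)"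
      by (auto intro!: derivative_eq_intros b)
    have di: "((\<lambda>t. inner (u t) (u t)) has_real_derivative inner (u x) (f x) + inner (f x) (u x)) (at x)"
      using bounded_bilinear.has_vector_derivative[OF bounded_bilinear_inner du du]
      by (simp add: has_real_derivative_iff_has_vector_derivative)
    have "(q has_real_derivative exp (b x) * (b' x * (norm (u x))\<^sup>2 + 2 * inner (f x) (u x))) (at x)"
      unfolding q_def by (rule DERIV_cong[OF DERIV_mult[OF de di]])
        (simp add: power2_norm_eq_inner inner_commute algebra_simps)
    then show "(q has_vector_derivative exp (b x) * (b' x * (norm (u x))\<^sup>2 + 2 * inner (f x) (u x))) (at x within {0..T}) \<and>
        exp (b x) * (b' x * (norm (u x))\<^sup>2 + 2 * inner (f x) (u x)) \<le> 0"
      using dec[OF x] by (auto simp: has_real_derivative_iff_has_vector_derivative mult_nonneg_nonpos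
          intro: has_vector_derivative_at_within)
  qed
  then show ?thesis by (simp add: q_def power2_norm_eq_inner)
qed

section \<open>Fields without exceptional times, their trajectories and flows\<close>

definition M_field :: "(complex ^ 'n::finite \<Rightarrow> real \<Rightarrow> complex ^ 'n) \<Rightarrow> bool"
  where "M_field G \<longleftrightarrow> (\<forall>s. (\<lambda>z. G z s) \<in> class_M) \<and> (\<forall>z\<in>unit_ball. G z \<in> borel_measurable lebesgue)"

lemma M_field_D: "M_field G \<Longrightarrow> (\<lambda>z. G z s) \<in> class_M"
  by (simp add: M_field_def)

text \<open>The integrated equation involves no exceptional times and does not notice a change of
  the integrand on a null set. In the same spirit \<open>M_field\<close> requires membership in the
  class at every real time, including negative ones, so that shifts and superpositions need no case
  distinction.\<close>

definition M_trajectory :: "(complex ^ 'n::finite \<Rightarrow> real \<Rightarrow> complex ^ 'n) \<Rightarrow> real \<Rightarrow> complex ^ 'n \<Rightarrow> (real \<Rightarrow> complex ^ 'n) \<Rightarrow> bool"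
  where "M_trajectory G T z u \<longleftrightarrow> continuous_on {0..T} u \<and> (\<forall>t\<in>{0..T}. u t \<in> unit_ball) \<and>
    (\<forall>t\<in>{0..T}. ((\<lambda>s. G (u s) s) has_integral (u t - z)) {0..t})"

definition M_flow :: "(complex ^ 'n::finite \<Rightarrow> real \<Rightarrow> complex ^ 'n) \<Rightarrow> (real \<Rightarrow> complex ^ 'n \<Rightarrow> complex ^ 'n) \<Rightarrow> bool"
  where "M_flow G \<phi> \<longleftrightarrow> (\<forall>z\<in>unit_ball. \<forall>T\<ge>0. M_trajectory G T z (\<lambda>t. \<phi> t z))"

lemma has_integral_singletonD: "(f has_integral y) {a::real} \<Longrightarrow> y = 0"
  by (rule has_integral_unique[OF _ has_integral_refl(2)])

lemma M_trajectory_start: "M_trajectory G T z u \<Longrightarrow> T \<ge> 0 \<Longrightarrow> u 0 = z"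
  unfolding M_trajectory_def
  by (auto dest!: bspec[of _ _ 0] has_integral_singletonD)

lemma M_trajectory_compact:
  assumes "M_trajectory G T z u"
  obtains r where "0 \<le> r" "r < 1" "\<And>t. t \<in> {0..T} \<Longrightarrow> norm (u t) \<le> r"
proof (cases "{0..T} = {}")
  case True
  then show thesis using that[of 0] by auto
next
  case False
  have "continuous_on {0..T} (\<lambda>t. norm (u t))"
    using assms by (auto simp: M_trajectory_def intro!: continuous_intros)
  from continuous_attains_sup[OF _ False this] obtain x
    where "x \<in> {0..T}" "\<And>t. t \<in> {0..T} \<Longrightarrow> norm (u t) \<le> norm (u x)" by auto
  then show thesis using that[of "norm (u x)"] assms by (auto simp: M_trajectory_def)
qed

lemma M_trajectory_lipschitz:
  assumes M: "\<And>s. s \<in> {0..T} \<Longrightarrow> (\<lambda>z. G z s) \<in> class_M"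
    and u: "M_trajectory G T z u" and v: "M_trajectory G T w v"
    and r: "r < 1" "\<And>t. t \<in> {0..T} \<Longrightarrow> norm (u t) \<le> r" "\<And>t. t \<in> {0..T} \<Longrightarrow> norm (v t) \<le> r"
    and t: "t \<in> {0..T}"
  shows "norm (u t - v t) \<le> norm (z - w) * exp (lip_M r * t)"
proof -
  have "norm (u t - v t) \<le> (norm (z - w) + 0 * T) * exp (lip_M r * t)"
  proof (rule gronwall_has_integral[of T "\<lambda>t. u t - v t" "lip_M r" 0 "\<lambda>s. G (u s) s - G (v s) s"])
    show "continuous_on {0..T} (\<lambda>t. u t - v t)" using u v by (auto simp: M_trajectory_def intro!: continuous_intros)
    show "0 \<le> lip_M r" using class_M_const_pos(1)[OF r(1)] by simp
    show "((\<lambda>s. G (u s) s - G (v s) s) has_integral u t - v t - (z - w)) {0..t}" if "t \<in> {0..T}" for t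
      using has_integral_diff[of "\<lambda>s. G (u s) s" "u t - z" "{0..t}" "\<lambda>s. G (v s) s" "v t - w"] u v that
      by (simp add: M_trajectory_def algebra_simps)
    show "norm (G (u s) s - G (v s) s) \<le> lip_M r * norm (u s - v s) + 0" if "s \<in> {0..T}" for s
      using class_M_lipschitz[OF M[OF that] r(2,3)[OF that] r(1)] by simp
  qed (use t in auto)
  then show ?thesis by simp
qed

lemma M_trajectory_unique:
  assumes M: "\<And>s. s \<in> {0..T} \<Longrightarrow> (\<lambda>z. G z s) \<in> class_M"
    and u: "M_trajectory G T z u" and v: "M_trajectory G T z v" and t: "t \<in> {0..T}"
  shows "u t = v t"
proof -
  obtain r where r: "0 \<le> r" "r < 1" "\<And>t. t \<in> {0..T} \<Longrightarrow> norm (u t) \<le> r"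
    by (rule M_trajectory_compact[OF u]) (rule that)
  obtain r' where r': "0 \<le> r'" "r' < 1" "\<And>t. t \<in> {0..T} \<Longrightarrow> norm (v t) \<le> r'"
    by (rule M_trajectory_compact[OF v]) (rule that)
  have "norm (u t - v t) \<le> norm (z - z) * exp (lip_M (max r r') * t)"
    by (rule M_trajectory_lipschitz[OF M u v _ _ _ t]) (use r r' in \<open>auto intro: max.coboundedI1 max.coboundedI2\<close>)
  then show ?thesis by simp
qed

text \<open>Composing the field with the nearest-point projection \<open>P\<close> onto the closed
  ball of radius \<open>r\<close> makes it globally Lipschitz. The new field still does not increase
  the norm: where it differs from \<open>G\<close>, \<open>x\<close> is a positive multiple of
  \<open>P x\<close>. So the solution stays within \<open>norm z < r\<close> and never meets the
  modification.\<close>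

lemma M_trajectory_exists:
  fixes G :: "complex ^ 'n::finite \<Rightarrow> real \<Rightarrow> complex ^ 'n"
  assumes G: "M_field G" and z: "z \<in> unit_ball"
  obtains u where "\<And>T. T \<ge> 0 \<Longrightarrow> M_trajectory G T z u" "\<And>t. t \<ge> 0 \<Longrightarrow> norm (u t) \<le> norm z"
proof -
  define r where "r = (1 + norm z) / 2"
  have r: "r > 0" "r < 1" "norm z \<le> r" using z by (auto simp: r_def add_pos_nonneg)
  define P where "P = closest_point (cball (0 :: complex ^ 'n) r)"
  have cb: "convex (cball (0 :: complex ^ 'n) r)" "closed (cball (0 :: complex ^ 'n) r)" "cball (0 :: complex ^ 'n) r \<noteq> {}"
    using r by auto
  have Pin: "norm (P x) \<le> r" for x using closest_point_in_set[OF cb(2,3), of x] by (simp add: P_def)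
  have Pid: "P x = x" if "norm x \<le> r" for x using closest_point_self[of x "cball 0 r"] that by (simp add: P_def)
  have Plip: "norm (P x - P y) \<le> norm (x - y)" for x y
    using closest_point_lipschitz[OF cb, of x y] by (simp add: P_def dist_norm)
  note M = M_field_D[OF G]
  define g where "g = (\<lambda>x s. G (P x) s)"
  have bnd: "norm (g x s) \<le> bnd_M r" for x s
    unfolding g_def using class_M_bounded[OF M Pin r(2)] .
  have lip: "norm (g x s - g y s) \<le> lip_M r * norm (x - y)" for x y s
    unfolding g_def using class_M_lipschitz[OF M Pin Pin r(2), of x s y] Plip[of x y] class_M_const_pos(1)[OF r(2)]
    by (meson mult_left_mono less_imp_le order_trans)
  have meas: "g x \<in> borel_measurable lebesgue" for x
    using G Pin[of x] r(2) by (simp add: g_def M_field_def)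
  have inward: "inner (g x s) x \<le> 0" for x s
  proof -
    define w where "w = x - P x"
    have gP: "inner (g x s) (P x) \<le> 0"
      unfolding g_def by (rule class_M_D(4)[OF M]) (use Pin[of x] r in simp)
    show ?thesis
    proof (cases "w = 0")
      case True
      then show ?thesis using gP by (simp add: w_def)
    next
      case False
      \<comment> \<open>The boundary point of the ball in the direction of \<open>w\<close>. The
        variational inequality of the projection, tested there, forces equality in the
        Cauchy-Schwarz inequality, so \<open>P x\<close> is a positive multiple of
        \<open>w\<close>.\<close>
      define y where "y = (r / norm w) *\<^sub>R w"
      have "y \<in> cball 0 r" using r False by (simp add: y_def)
      then have "inner w (y - P x) \<le> 0"
        unfolding w_def P_def by (rule closest_point_dot[OF cb(1,2)])
      moreover have "inner w y = r * norm w"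
        using False by (simp add: y_def dot_square_norm power2_eq_square)
      ultimately have 1: "r * norm w \<le> inner w (P x)" by (simp add: inner_diff_right)
      have 2: "inner w (P x) \<le> norm w * norm (P x)" by (rule norm_cauchy_schwarz)
      have 3: "norm w * norm (P x) \<le> norm w * r" using Pin by (intro mult_left_mono) auto
      have eq: "inner w (P x) = norm w * norm (P x)" and "norm w * norm (P x) = norm w * r"
        using 1 2 3 mult.commute[of r "norm w"] by linarith+
      then have nP: "norm (P x) = r" using False by simp
      have "norm w *\<^sub>R P x = r *\<^sub>R w" using eq norm_cauchy_schwarz_eq[of w "P x"] nP by simp
      then have "w = (norm w / r) *\<^sub>R P x" using r
        by (metis divide_inverse_commute scaleR_scaleR left_inverse less_irrefl scaleR_one)
      then have "inner (g x s) x = (1 + norm w / r) * inner (g x s) (P x)"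
        unfolding w_def by (metis (no_types, lifting) add.commute diff_add_cancel distrib_right inner_add_right inner_scaleR_right mult_1)
      then show ?thesis using gP r by (simp add: mult_nonneg_nonpos)
    qed
  qed
  obtain u where u: "continuous_on UNIV u" "\<And>t. t \<ge> 0 \<Longrightarrow> ((\<lambda>s. g (u s) s) has_integral (u t - z)) {0..t}"
    using caratheodory_existence[OF meas lip class_M_const_pos(1)[OF r(2)] bnd, of z] by blast
  have u0: "u 0 = z" using u(2)[of 0] by (auto dest: has_integral_singletonD)
  have nu: "norm (u t) \<le> norm z" if "t \<ge> 0" for t
  proof -
    have "exp 0 * (norm (u t))\<^sup>2 \<le> exp 0 * (norm (u 0))\<^sup>2"
      by (rule energy_estimate[OF u(2) bnd _ _ _ that, where b' = "\<lambda>_. 0"]) (use inward in auto)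
    then show ?thesis using u0 by simp
  qed
  have "((\<lambda>s. G (u s) s) has_integral (u t - z)) {0..t}" if "t \<ge> 0" for t
    by (rule has_integral_eq[OF _ u(2)[OF that]]) (use nu r in \<open>auto simp: g_def intro!: arg_cong[of _ _ "\<lambda>x. G x _"] Pid intro: order_trans\<close>)
  then have "M_trajectory G T z u" for T
    using z le_less_trans[OF nu] unfolding M_trajectory_def
    by (auto intro: continuous_on_subset[OF u(1)])
  then show thesis using nu by (rule that)
qed

lemma M_flow_exists:
  assumes G: "M_field G"
  obtains \<phi> where "M_flow G \<phi>"
proof -
  have "\<forall>z\<in>unit_ball. \<exists>u. \<forall>T\<ge>0. M_trajectory G T z u"
    using M_trajectory_exists[OF G] by metis
  from bchoice[OF this] obtain U where "\<forall>z\<in>unit_ball. \<forall>T\<ge>0. M_trajectory G T z (U z)" ..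
  then have "M_flow G (\<lambda>t z. U z t)" by (simp add: M_flow_def)
  then show thesis by (rule that)
qed

lemma M_flow_D:
  assumes "M_flow G \<phi>" "z \<in> unit_ball"
  shows "T \<ge> 0 \<Longrightarrow> M_trajectory G T z (\<lambda>t. \<phi> t z)"
    "t \<ge> 0 \<Longrightarrow> \<phi> t z \<in> unit_ball"
    "t \<ge> 0 \<Longrightarrow> ((\<lambda>s. G (\<phi> s z) s) has_integral (\<phi> t z - z)) {0..t}"
    "\<phi> 0 z = z"
    "continuous_on {0..T} (\<lambda>t. \<phi> t z)"
proof -
  show t: "T \<ge> 0 \<Longrightarrow> M_trajectory G T z (\<lambda>t. \<phi> t z)" for T using assms by (simp add: M_flow_def)
  show "t \<ge> 0 \<Longrightarrow> \<phi> t z \<in> unit_ball" "t \<ge> 0 \<Longrightarrow> ((\<lambda>s. G (\<phi> s z) s) has_integral (\<phi> t z - z)) {0..t}"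
    using t[of t] by (auto simp: M_trajectory_def)
  show "\<phi> 0 z = z" using M_trajectory_start[OF t[of 0]] by simp
  show "continuous_on {0..T} (\<lambda>t. \<phi> t z)" using t[of T] by (cases "T \<ge> 0") (auto simp: M_trajectory_def)
qed

lemma M_flow_norm_le:
  assumes G: "M_field G" and \<phi>: "M_flow G \<phi>" and z: "z \<in> unit_ball" and t: "t \<ge> 0"
  shows "norm (\<phi> t z) \<le> norm z"
proof -
  obtain u where u: "\<And>T. T \<ge> 0 \<Longrightarrow> M_trajectory G T z u" "\<And>t. t \<ge> 0 \<Longrightarrow> norm (u t) \<le> norm z"
    by (rule M_trajectory_exists[OF G z]) (rule that)
  have "\<phi> t z = u t"
    by (rule M_trajectory_unique[OF M_field_D[OF G] M_flow_D(1)[OF \<phi> z t] u(1)[OF t]]) (use t in auto)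
  then show ?thesis using u(2)[OF t] by simp
qed

lemma M_flow_lipschitz:
  assumes G: "M_field G" and \<phi>: "M_flow G \<phi>" and r: "r < 1" "norm z \<le> r" "norm w \<le> r" and t: "t \<ge> 0"
  shows "norm (\<phi> t z - \<phi> t w) \<le> norm (z - w) * exp (lip_M r * t)"
proof -
  have zw: "z \<in> unit_ball" "w \<in> unit_ball" using r by auto
  show ?thesis
    by (rule M_trajectory_lipschitz[OF M_field_D[OF G] M_flow_D(1)[OF \<phi> zw(1) t] M_flow_D(1)[OF \<phi> zw(2) t] r(1)])
      (use order_trans[OF M_flow_norm_le[OF G \<phi> zw(1)] r(2)] order_trans[OF M_flow_norm_le[OF G \<phi> zw(2)] r(3)] t in auto)
qed

section \<open>The linearised equation and the derivative of the flow\<close>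

lemma bounded_linear_vector_scalar_mult_right: "bounded_linear (\<lambda>v :: complex ^ 'n::finite. c *s v)"
  by (rule linear_conv_bounded_linear[THEN iffD1], rule linearI)
    (simp_all add: scaleR_eq_vector_scalar_mult vector_add_ldistrib vector_smult_assoc mult.commute)

text \<open>The Jacobian along a curve is a pointwise limit of difference quotients of the field,
  and those are measurable superpositions.\<close>

lemma M_flow_jacobian_measurable:
  assumes G: "M_field G" and u: "continuous_on UNIV u" and r: "r < 1" "\<And>s. norm (u s) \<le> r"
  shows "(\<lambda>s. complex_jacobian (\<lambda>z. G z s) (u s) *v v) \<in> borel_measurable lebesgue"
proof (rule borel_measurable_LIMSEQ_metric)
  \<comment> \<open>A null sequence scaled so that
    \<open>\<delta> n * norm v \<le> (1 - r) / 4\<close>, the range of the remainder estimate; the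
    summand 1 in the denominator covers \<open>v = 0\<close>.\<close>
  define \<delta> where "\<delta> = (\<lambda>n. (1 - r) / (4 * (norm v + 1)) * inverse (real (Suc n)))"
  have c0: "(1 - r) / (4 * (norm v + 1)) > 0" using r(1) by (intro divide_pos_pos) (auto simp: add_nonneg_pos)
  have \<delta>: "\<delta> n > 0" for n unfolding \<delta>_def by (intro mult_pos_pos c0) simp
  have \<delta>v: "\<delta> n * norm v \<le> (1 - r) / 4" for n
  proof -
    have "\<delta> n \<le> (1 - r) / (4 * (norm v + 1)) * 1"
      unfolding \<delta>_def using c0 by (intro mult_left_mono) (auto simp: inverse_le_1_iff)
    then have "\<delta> n * norm v \<le> (1 - r) / (4 * (norm v + 1)) * norm v" by (intro mult_right_mono) auto
    also have "\<dots> \<le> (1 - r) / (4 * (norm v + 1)) * (norm v + 1)" using c0 by (intro mult_left_mono) auto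
    also have "\<dots> = (1 - r) / 4"
    proof -
      have "(1 - r) / (4 * m) * m = (1 - r) / 4" if "m > 0" for m :: real using that by simp
      then show ?thesis by (simp only: add_nonneg_pos norm_ge_zero zero_less_one)
    qed
    finally show ?thesis .
  qed
  have inb: "norm (u s + \<delta> n *\<^sub>R v) < 1" for s n
    using norm_triangle_ineq[of "u s" "\<delta> n *\<^sub>R v"] \<delta>v[of n] \<delta>[of n] r(2)[of s] r(1) by simp
  note M = M_field_D[OF G]
  have cont: "continuous_on X (\<lambda>z. G z s)" if "X \<subseteq> unit_ball" for X s
    using holo_at_isCont[OF class_M_D(1)[OF M]] that
    by (intro continuous_at_imp_continuous_on) blast
  have meas: "(\<lambda>s. G (w s) s) \<in> borel_measurable lebesgue" if "continuous_on UNIV w" "\<And>s. norm (w s) < 1" for w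
    by (rule caratheodory_measurable[OF _ cont that(1)]) (use G that(2) in \<open>auto simp: M_field_def\<close>)
  show "(\<lambda>s. (1 / \<delta> n) *\<^sub>R (G (u s + \<delta> n *\<^sub>R v) s - G (u s) s)) \<in> borel_measurable lebesgue" for n
    by (intro borel_measurable_scaleR borel_measurable_diff borel_measurable_const meas continuous_intros u)
      (use inb r(2) r(1) in \<open>auto intro: le_less_trans\<close>)
  fix s :: real
  show "(\<lambda>n. (1 / \<delta> n) *\<^sub>R (G (u s + \<delta> n *\<^sub>R v) s - G (u s) s)) \<longlonglongrightarrow> complex_jacobian (\<lambda>z. G z s) (u s) *v v"
  proof (rule LIM_zero_cancel, rule Lim_null_comparison[OF always_eventually], rule allI)
    fix n
    let ?J = "complex_jacobian (\<lambda>z. G z s) (u s)"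
    have Js: "?J *v (\<delta> n *\<^sub>R v) = \<delta> n *\<^sub>R (?J *v v)"
      by (simp add: scaleR_eq_vector_scalar_mult matrix_vector_mult_scale)
    have "(1 / \<delta> n) *\<^sub>R (G (u s + \<delta> n *\<^sub>R v) s - G (u s) s) - ?J *v v
        = (1 / \<delta> n) *\<^sub>R (G (u s + \<delta> n *\<^sub>R v) s - G (u s) s - ?J *v (\<delta> n *\<^sub>R v))"
      unfolding Js using \<delta>[of n] by (simp add: scaleR_diff_right)
    then have "norm ((1 / \<delta> n) *\<^sub>R (G (u s + \<delta> n *\<^sub>R v) s - G (u s) s) - ?J *v v)
        = (1 / \<delta> n) * norm (G (u s + \<delta> n *\<^sub>R v) s - G (u s) s - ?J *v (\<delta> n *\<^sub>R v))"
      using \<delta>[of n] by simp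
    also have "\<dots> \<le> (1 / \<delta> n) * (rem_M r * (norm (\<delta> n *\<^sub>R v))\<^sup>2)"
      using \<delta>[of n] \<delta>v[of n] by (intro mult_left_mono class_M_remainder(1)[OF M r(2) r(1)]) auto
    also have "\<dots> = (rem_M r * (norm v)\<^sup>2) * \<delta> n"
      using \<delta>[of n] by (simp add: power2_eq_square)
    finally show "norm ((1 / \<delta> n) *\<^sub>R (G (u s + \<delta> n *\<^sub>R v) s - G (u s) s) - ?J *v v) \<le> (rem_M r * (norm v)\<^sup>2) * \<delta> n" .
  next
    have "\<delta> \<longlonglongrightarrow> (1 - r) / (4 * (norm v + 1)) * 0"
      unfolding \<delta>_def by (intro tendsto_mult_left LIMSEQ_inverse_real_of_nat)
    then have "(\<lambda>n. (rem_M r * (norm v)\<^sup>2) * \<delta> n) \<longlonglongrightarrow> (rem_M r * (norm v)\<^sup>2) * 0"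
      by (intro tendsto_mult_left) simp
    then show "(\<lambda>n. (rem_M r * (norm v)\<^sup>2) * \<delta> n) \<longlonglongrightarrow> 0" by simp
  qed
qed

text \<open>The derivative of the flow map is the fundamental solution of the linearised equation, whose
  kernel is trivial because solutions of that equation are unique backwards in time.\<close>

lemma M_flow_derivative:
  fixes G :: "complex ^ 'n::finite \<Rightarrow> real \<Rightarrow> complex ^ 'n"
  assumes G: "M_field G" and \<phi>: "M_flow G \<phi>" and z: "z \<in> unit_ball" and T: "T \<ge> 0"
  obtains A :: "complex ^ 'n ^ 'n"
    where "(\<phi> T has_derivative (\<lambda>v. A *v v)) (at z)" "\<And>v. A *v v = 0 \<Longrightarrow> v = 0"
proof -
  \<comment> \<open>Halfway between \<open>norm z\<close> and 1, which leaves room for the nearby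
    initial points \<open>z + v\<close>.\<close>
  define r where "r = (1 + norm z) / 2"
  have r: "r < 1" "norm z \<le> r" using z by (auto simp: r_def)
  define L where "L = lip_M r"
  have L: "L > 0" unfolding L_def using class_M_const_pos(1)[OF r(1)] .
  note M = M_field_D[OF G]
  define u where "u = (\<lambda>s. \<phi> (max 0 s) z)"
  have u: "continuous_on UNIV u"
    unfolding u_def by (rule continuous_on_UNIV_max[OF M_flow_D(5)[OF \<phi> z]])
  have nu: "norm (u s) \<le> r" for s
    unfolding u_def using order_trans[OF M_flow_norm_le[OF G \<phi> z] r(2)] by simp
  define J where "J = (\<lambda>s. complex_jacobian (\<lambda>z. G z s) (u s))"
  have Jm: "(\<lambda>s. J s *v v) \<in> borel_measurable lebesgue" for v
    unfolding J_def by (rule M_flow_jacobian_measurable[OF G u r(1) nu])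
  have Jn: "norm (J s *v v) \<le> L * norm v" for s v
    unfolding J_def L_def by (rule class_M_remainder(2)[OF M nu r(1)])
  have Jl: "norm (J s *v x - J s *v y) \<le> L * norm (x - y)" for s x y
    using Jn[of s "x - y"] by (simp add: matrix_vector_mult_diff_distrib)
  have "\<exists>V. continuous_on UNIV V \<and> (\<forall>t\<ge>0. ((\<lambda>s. J s *v V s) has_integral (V t - axis i 1)) {0..t})" for i
  proof (rule caratheodory_existence[of "\<lambda>v s. J s *v v" L 0 "axis i 1", OF Jm Jl L])
    show "norm (J s *v 0) \<le> 0" for s by simp
  qed blast
  then have "\<forall>i. \<exists>V. continuous_on UNIV V \<and> (\<forall>t\<ge>0. ((\<lambda>s. J s *v V s) has_integral (V t - axis i 1)) {0..t})"
    by (rule allI)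
  from choice[OF this] obtain V where "\<forall>i. continuous_on UNIV (V i) \<and>
    (\<forall>t\<ge>0. ((\<lambda>s. J s *v V i s) has_integral (V i t - axis i 1)) {0..t})" ..
  then have V: "continuous_on UNIV (V i)"
    "t \<ge> 0 \<Longrightarrow> ((\<lambda>s. J s *v V i s) has_integral (V i t - axis i 1)) {0..t}" for i t by auto
  \<comment> \<open>Column \<open>i\<close> of \<open>A t\<close> is the solution that starts at the
    \<open>i\<close>-th unit vector. Since the equation is complex linear, \<open>A t *v v\<close>
    is the solution that starts at \<open>v\<close>.\<close>
  define A where "A = (\<lambda>t. \<chi> j i. V i t $ j)"
  have Av: "A t *v v = (\<Sum>i\<in>UNIV. v $ i *s V i t)" for t v
    by (simp add: vec_eq_iff A_def matrix_vector_mult_def mult.commute)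
  have cA: "continuous_on X (\<lambda>t. A t *v v)" for v X
    unfolding Av by (intro continuous_on_sum bounded_linear.continuous_on[OF bounded_linear_vector_scalar_mult_right]
        continuous_on_subset[OF V(1)]) simp
  have iA: "((\<lambda>s. J s *v (A s *v v)) has_integral (A t *v v - v)) {0..t}" if "t \<ge> 0" for t v
  proof -
    have "((\<lambda>s. \<Sum>i\<in>UNIV. v $ i *s (J s *v V i s)) has_integral (\<Sum>i\<in>UNIV. v $ i *s (V i t - axis i 1))) {0..t}"
      using has_integral_linear[OF V(2)[OF that] bounded_linear_vector_scalar_mult_right]
      by (intro has_integral_sum) (auto simp: o_def)
    moreover have "(\<Sum>i\<in>UNIV. v $ i *s (J s *v V i s)) = J s *v (A s *v v)" for s
      unfolding Av by (simp add: linear_sum[OF bounded_linear.linear[OF bounded_linear_matrix_vector_mult_complex]] matrix_vector_mult_scale)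
    moreover have "(\<Sum>i\<in>UNIV. v $ i *s (V i t - axis i 1)) = A t *v v - v"
      unfolding Av by (simp add: vector_ssub_ldistrib sum_subtractf basis_expansion)
    ultimately show ?thesis by simp
  qed
  have A0: "A 0 *v v = v" for v
    using has_integral_unique[OF iA[of 0 v]] has_integral_refl(2)[of "\<lambda>s. J s *v (A s *v v)" 0] by fastforce
  \<comment> \<open>Two trajectories that start within \<open>d\<close> of each other stay within
    \<open>d * exp (L * T) = (1 - r) / 4\<close> up to time \<open>T\<close>, which is the range of
    the remainder estimate for the field.\<close>
  define d where "d = (1 - r) / 4 * exp (- (L * T))"
  have d: "d > 0" "d \<le> (1 - r) / 4"
  proof -
    show "d > 0" unfolding d_def using r by simp
    have "exp (- (L * T)) \<le> 1" using L T by simp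
    then have "(1 - r) / 4 * exp (- (L * T)) \<le> (1 - r) / 4 * 1" using r by (intro mult_left_mono) auto
    then show "d \<le> (1 - r) / 4" by (simp add: d_def)
  qed
  show thesis
  proof
    show "(\<phi> T has_derivative (\<lambda>v. A T *v v)) (at z)"
    proof (rule has_derivative_quadratic_remainder[OF bounded_linear_matrix_vector_mult_complex d(1)])
      fix v :: "complex ^ 'n" assume v: "norm v \<le> d"
      have zv: "norm (z + v) \<le> r"
      proof -
        have "norm z = 2 * r - 1" by (simp add: r_def field_simps)
        moreover have "norm (z + v) \<le> norm z + d" using norm_triangle_ineq[of z v] v by linarith
        moreover have "4 * d \<le> 1 - r" using d(2) by simp
        ultimately show ?thesis using r(1) by linarith
      qed
      then have zvb: "z + v \<in> unit_ball" using r by simp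
      let ?u = "\<lambda>s. \<phi> s z" and ?v = "\<lambda>s. \<phi> s (z + v)"
      \<comment> \<open>Bounds the Taylor remainder of the field between the two trajectories at all
        times up to \<open>T\<close>. It is quadratic in \<open>v\<close>, and the Gronwall
        inequality preserves this.\<close>
      define e where "e = rem_M r * (norm v * exp (L * T))\<^sup>2"
      have "norm (?v T - ?u T - A T *v v) \<le> (norm (0 :: complex ^ 'n) + e * T) * exp (L * T)"
      proof (rule gronwall_has_integral[of T "\<lambda>t. ?v t - ?u t - A t *v v" L e "\<lambda>s. G (?v s) s - G (?u s) s - J s *v (A s *v v)"])
        show "continuous_on {0..T} (\<lambda>t. ?v t - ?u t - A t *v v)"
          by (intro continuous_intros cA M_flow_D(5)[OF \<phi> z] M_flow_D(5)[OF \<phi> zvb])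
        show "0 \<le> L" using L by simp
        show "0 \<le> e" using class_M_const_pos(3)[OF r(1)] by (simp add: e_def)
        show "((\<lambda>s. G (?v s) s - G (?u s) s - J s *v (A s *v v)) has_integral ?v t - ?u t - A t *v v - 0) {0..t}"
          if "t \<in> {0..T}" for t
        proof -
          have "t \<ge> 0" using that by simp
          from has_integral_diff[OF has_integral_diff[OF M_flow_D(3)[OF \<phi> zvb this] M_flow_D(3)[OF \<phi> z this]] iA[OF this, of v]]
          show ?thesis by (simp add: algebra_simps)
        qed
        fix s assume s: "s \<in> {0..T}"
        let ?D = "?v s - ?u s"
        have us: "u s = ?u s" using s by (simp add: u_def)
        have "norm ?D \<le> norm (z + v - z) * exp (lip_M r * s)"
          by (rule M_flow_lipschitz[OF G \<phi> r(1) zv r(2)]) (use s in simp)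
        also have "\<dots> \<le> norm v * exp (L * T)"
          using s L by (auto simp: L_def[symmetric] intro!: mult_left_mono)
        finally have D: "norm ?D \<le> norm v * exp (L * T)" .
        also have "\<dots> \<le> d * exp (L * T)" using v by (intro mult_right_mono) auto
        also have "\<dots> = (1 - r) / 4" by (simp add: d_def mult.assoc flip: exp_add)
        finally have D2: "norm ?D \<le> (1 - r) / 4" .
        have "norm (G (?u s + ?D) s - G (?u s) s - J s *v ?D) \<le> rem_M r * (norm ?D)\<^sup>2"
          using class_M_remainder(1)[OF M nu[of s] r(1) D2] unfolding J_def us .
        also have "\<dots> \<le> e"
          unfolding e_def using class_M_const_pos(3)[OF r(1)] D by (intro mult_left_mono power_mono) auto
        finally have 1: "norm (G (?v s) s - G (?u s) s - J s *v ?D) \<le> e" by simp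
        have 2: "norm (J s *v (?D - A s *v v)) \<le> L * norm (?D - A s *v v)" by (rule Jn)
        have "G (?v s) s - G (?u s) s - J s *v (A s *v v)
          = J s *v (?D - A s *v v) + (G (?v s) s - G (?u s) s - J s *v ?D)"
          by (simp add: matrix_vector_mult_diff_distrib)
        then show "norm (G (?v s) s - G (?u s) s - J s *v (A s *v v)) \<le> L * norm (?v s - ?u s - A s *v v) + e"
          by (simp only: norm_triangle_le[OF add_mono[OF 2 1]])
      qed (use T in simp)
      also have "\<dots> = (rem_M r * (exp (L * T))\<^sup>2 * T * exp (L * T)) * (norm v)\<^sup>2"
        by (simp add: e_def power_mult_distrib)
      finally show "norm (\<phi> T (z + v) - \<phi> T z - A T *v v) \<le> (rem_M r * (exp (L * T))\<^sup>2 * T * exp (L * T)) * (norm v)\<^sup>2" .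
    qed
    fix v assume v: "A T *v v = 0"
    have "A 0 *v v = 0"
      by (rule gronwall_backward[OF cA less_imp_le[OF L] T iA Jn v]) simp
    then show "v = 0" by (simp add: A0)
  qed
qed

lemma M_flow_holo_at:
  "M_field G \<Longrightarrow> M_flow G \<phi> \<Longrightarrow> z \<in> unit_ball \<Longrightarrow> t \<ge> 0 \<Longrightarrow> holo_at (\<phi> t) z"
  unfolding holo_at_def by (rule M_flow_derivative) auto

lemma M_flow_matrix_inv_jacobian:
  assumes "M_field G" "M_flow G \<phi>" "z \<in> unit_ball" "t \<ge> 0"
  shows "complex_jacobian (\<phi> t) z ** matrix_inv (complex_jacobian (\<phi> t) z) = mat 1"
proof -
  obtain A where A: "(\<phi> t has_derivative (\<lambda>v. A *v v)) (at z)" "\<And>v. A *v v = 0 \<Longrightarrow> v = 0"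
    using M_flow_derivative[OF assms] by blast
  then have "\<exists>B. B ** A = mat 1" unfolding matrix_left_invertible_ker by blast
  then have "\<exists>B. A ** B = mat 1 \<and> B ** A = mat 1" by (metis matrix_left_right_inverse)
  then have "A ** matrix_inv A = mat 1" unfolding matrix_inv_def by (metis (mono_tags, lifting) someI_ex)
  then show ?thesis using complex_jacobian_eqI[OF A(1)] by simp
qed

section \<open>Exponential decay and the limit map\<close>

lemma exp_mult_le_iff: "exp x * a \<le> c \<longleftrightarrow> a \<le> c * exp (- x)" for x a c :: real
  by (simp add: exp_minus field_simps)

text \<open>The rate is obtained in two passes. The first bound of \<open>class_M_slice\<close>
  gives the crude rate \<open>(1 - r) / 2\<close>. Inserted into the second bound, it makes the
  deviation from the ideal rate 1 integrable in time, so this deviation costs only a constant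
  factor.\<close>

lemma M_flow_decay:
  assumes G: "M_field G" and \<phi>: "M_flow G \<phi>" and z: "norm z \<le> r" "r < 1" and t: "t \<ge> 0"
  shows "norm (\<phi> t z) \<le> exp (4 / (1 - r)\<^sup>2) * exp (- t)"
proof -
  have zb: "z \<in> unit_ball" using z by simp
  have z1: "(norm z)\<^sup>2 \<le> 1" using z by (simp add: power_le_one)
  note M = M_field_D[OF G]
  let ?u = "\<lambda>s. \<phi> s z"
  have nu: "norm (?u s) \<le> r" if "s \<ge> 0" for s using M_flow_norm_le[OF G \<phi> zb that] z by simp
  note int = M_flow_D(3)[OF \<phi> zb]
  have bnd: "norm (G (?u s) s) \<le> bnd_M r" if "0 \<le> s" for s
    by (rule class_M_bounded[OF M nu[OF that] z(2)])
  have u0: "?u 0 = z" by (rule M_flow_D(4)[OF \<phi> zb])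
  have e1: "norm (?u s) \<le> exp (- ((1 - r) * s / 2))" if s: "s \<ge> 0" for s
  proof -
    have "exp ((1 - r) * s) * (norm (?u s))\<^sup>2 \<le> exp ((1 - r) * 0) * (norm (?u 0))\<^sup>2"
    proof (rule energy_estimate[OF int bnd _ _ _ s])
      show "((\<lambda>s. (1 - r) * s) has_real_derivative (1 - r)) (at s)" for s
        by (auto intro!: derivative_eq_intros)
      fix s :: real assume "s > 0"
      then have n: "norm (?u s) \<le> r" using nu by simp
      have "inner (G (?u s) s) (?u s) \<le> - (norm (?u s))\<^sup>2 * ((1 - norm (?u s)) / (1 + norm (?u s)))"
        by (rule class_M_slice(1)[OF M]) (use n z in simp)
      moreover have "(1 - r) / 2 \<le> (1 - norm (?u s)) / (1 + norm (?u s))"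
        using n z by (intro frac_le) (auto simp: add_pos_nonneg)
      then have "(norm (?u s))\<^sup>2 * ((1 - r) / 2) \<le> (norm (?u s))\<^sup>2 * ((1 - norm (?u s)) / (1 + norm (?u s)))"
        by (intro mult_left_mono) auto
      ultimately have "inner (G (?u s) s) (?u s) \<le> - ((norm (?u s))\<^sup>2 * ((1 - r) / 2))" by linarith
      then show "(1 - r) * (norm (?u s))\<^sup>2 + 2 * inner (G (?u s) s) (?u s) \<le> 0" by (simp add: field_simps)
    qed auto
    then have "exp ((1 - r) * s) * (norm (?u s))\<^sup>2 \<le> 1" using z1 u0 by simp
    then have "(norm (?u s))\<^sup>2 \<le> exp (- ((1 - r) * s))" unfolding exp_mult_le_iff by simp
    also have "\<dots> = (exp (- ((1 - r) * s / 2)))\<^sup>2" by (simp flip: exp_double)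
    finally show ?thesis by (rule power2_le_imp_le) simp
  qed
  \<comment> \<open>The exponential term is the bounded antiderivative of the deviation
    \<open>- 4 / (1 - r) * exp (- ((1 - r) * s / 2))\<close>. It is nonnegative, so
    \<open>b t \<ge> 2 * t\<close>, and its value at 0 is the exponent
    \<open>8 / (1 - r)\<^sup>2\<close>, halved when the square root is taken.\<close>
  define b where "b = (\<lambda>s. 2 * s + 8 / (1 - r)\<^sup>2 * exp (- ((1 - r) * s / 2)))"
  have "exp (b t) * (norm (?u t))\<^sup>2 \<le> exp (b 0) * (norm (?u 0))\<^sup>2"
  proof (rule energy_estimate[OF int bnd _ _ _ t, where b' = "\<lambda>s. 2 - 4 / (1 - r) * exp (- ((1 - r) * s / 2))"])
    show "(b has_real_derivative 2 - 4 / (1 - r) * exp (- ((1 - r) * s / 2))) (at s)" for s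
    proof -
      let ?E = "exp (- ((1 - r) * s / 2))"
      have "((\<lambda>s. exp (- ((1 - r) * s / 2))) has_real_derivative ?E * - ((1 - r) / 2)) (at s)"
        by (auto intro!: derivative_eq_intros)
      then have "(b has_real_derivative 2 * 1 + 8 / (1 - r)\<^sup>2 * (?E * - ((1 - r) / 2))) (at s)"
        unfolding b_def by (intro DERIV_add DERIV_cmult DERIV_ident)
      moreover have "8 / m\<^sup>2 * (m / 2) = 4 / m" for m :: real by (simp add: power2_eq_square)
      moreover have "2 * 1 + c * (E * - k) = 2 - c * k * E" for c E k :: real by simp
      ultimately show ?thesis by (simp only:)
    qed
    show "continuous_on UNIV (\<lambda>s. 2 - 4 / (1 - r) * exp (- ((1 - r) * s / 2)))"
      by (intro continuous_intros) simp
    fix s :: real assume s: "s > 0"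
    let ?n = "norm (?u s)"
    have n: "?n \<le> r" "?n \<le> exp (- ((1 - r) * s / 2))" using nu e1 s by auto
    have "inner (G (?u s) s + ?u s) (?u s) \<le> norm (hermitian_inner (G (?u s) s + ?u s) (?u s))"
      unfolding Re_hermitian_inner[symmetric] by (rule complex_Re_le_cmod)
    also have "\<dots> \<le> 2 * ?n ^ 3 / (1 - ?n)" by (rule class_M_slice(2)[OF M]) (use n z in simp)
    also have "\<dots> \<le> 2 * ?n ^ 3 / (1 - r)" using n z by (intro divide_left_mono) auto
    also have "\<dots> = 2 / (1 - r) * ?n\<^sup>2 * ?n" by (simp add: power3_eq_cube power2_eq_square)
    also have "\<dots> \<le> 2 / (1 - r) * ?n\<^sup>2 * exp (- ((1 - r) * s / 2))"
      using n z by (intro mult_left_mono) auto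
    finally have "inner (G (?u s) s) (?u s) + ?n\<^sup>2 \<le> 2 / (1 - r) * ?n\<^sup>2 * exp (- ((1 - r) * s / 2))"
      by (simp add: inner_add_left power2_norm_eq_inner)
    then show "(2 - 4 / (1 - r) * exp (- ((1 - r) * s / 2))) * ?n\<^sup>2 + 2 * inner (G (?u s) s) (?u s) \<le> 0"
      by (simp add: algebra_simps)
  qed
  moreover have "exp (b 0) * (norm (?u 0))\<^sup>2 \<le> exp (b 0) * 1"
    unfolding u0 by (rule mult_left_mono[OF z1]) simp
  moreover have "exp (2 * t) * (norm (?u t))\<^sup>2 \<le> exp (b t) * (norm (?u t))\<^sup>2"
    by (intro mult_right_mono) (auto simp: b_def)
  moreover have "exp (b 0) * 1 = exp (8 / (1 - r)\<^sup>2)" by (simp add: b_def)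
  ultimately have "exp (2 * t) * (norm (?u t))\<^sup>2 \<le> exp (8 / (1 - r)\<^sup>2)" by linarith
  then have "(norm (?u t))\<^sup>2 \<le> exp (8 / (1 - r)\<^sup>2) * exp (- (2 * t))" unfolding exp_mult_le_iff .
  also have "\<dots> = (exp (4 / (1 - r)\<^sup>2) * exp (- t))\<^sup>2"
    by (simp add: power_mult_distrib flip: exp_double)
  finally show ?thesis by (rule power2_le_imp_le) simp
qed

definition limit_M :: "real \<Rightarrow> real" where "limit_M r = 64 / (1 - r)\<^sup>2 * (exp (4 / (1 - r)\<^sup>2))\<^sup>2"

text \<open>The derivative of \<open>exp s *\<^sub>R \<phi> s z\<close> is \<open>exp s\<close>
  times the field plus the identity, which is quadratic in \<open>\<phi> s z\<close> by
  \<open>class_M_add_id_le\<close>. The decay of order \<open>exp (- s)\<close> therefore leaves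
  \<open>exp (- s)\<close>, with the two constants multiplied in \<open>limit_M\<close>.\<close>

lemma M_flow_scaled_increment:
  assumes G: "M_field G" and \<phi>: "M_flow G \<phi>" and z: "norm z \<le> r" "r < 1" and ab: "0 \<le> a" "a \<le> b"
  shows "norm (exp b *\<^sub>R \<phi> b z - exp a *\<^sub>R \<phi> a z) \<le> limit_M r * exp (- a)"
proof -
  have zb: "z \<in> unit_ball" using z by simp
  note M = M_field_D[OF G]
  let ?u = "\<lambda>s. \<phi> s z"
  have nu: "norm (?u s) \<le> r" if "s \<ge> 0" for s using M_flow_norm_le[OF G \<phi> zb that] z by simp
  note int = M_flow_D(3)[OF \<phi> zb]
  have bnd: "norm (G (?u s) s) \<le> bnd_M r" if "0 \<le> s" for s
    by (rule class_M_bounded[OF M nu[OF that] z(2)])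
  have "\<exists>C. C-lipschitz_on {0..b} ?u"
    using has_integral_lipschitz_on[OF int bnd] class_M_const_pos(2)[OF z(2)] by (meson less_imp_le)
  moreover have "\<exists>C. C-lipschitz_on {0..b} (exp :: real \<Rightarrow> real)"
    by (rule C1_lipschitz_on[where b' = exp]) (auto intro!: derivative_eq_intros continuous_intros)
  ultimately have "\<exists>C. C-lipschitz_on {0..b} (\<lambda>s. exp s *\<^sub>R ?u s)"
    by (intro lipschitz_on_bilinear[OF bounded_bilinear_scaleR]) auto
  then have ac: "absolutely_continuous_on {a..b} (\<lambda>s. exp s *\<^sub>R ?u s)"
    using lipschitz_on_absolutely_continuous_on lipschitz_on_subset ab
    by (metis atLeastatMost_subset_iff order_refl)
  define g where "g = (\<lambda>s. exp s *\<^sub>R (G (?u s) s + ?u s))"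
  define N where "N = {t. t > 0 \<and> \<not> (?u has_vector_derivative G (?u t) t) (at t)} \<union> {0}"
  have N: "negligible N"
    unfolding N_def by (intro negligible_Un has_integral_derivative_negligible[OF int]) auto
  have hi: "(g has_integral exp b *\<^sub>R ?u b - exp a *\<^sub>R ?u a) {a..b}"
  proof (rule fundamental_theorem_absolutely_continuous[OF ab(2) ac N])
    fix x assume "x \<in> {a..b} - N"
    then have du: "(?u has_vector_derivative G (?u x) x) (at x)" using ab by (auto simp: N_def)
    have "((\<lambda>s. exp s *\<^sub>R ?u s) has_vector_derivative exp x *\<^sub>R G (?u x) x + exp x *\<^sub>R ?u x) (at x)"
      by (rule has_vector_derivative_scaleR[OF DERIV_exp du])
    then show "((\<lambda>s. exp s *\<^sub>R ?u s) has_vector_derivative g x) (at x within {a..b})"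
      by (simp add: g_def scaleR_add_right has_vector_derivative_at_within)
  qed
  have he: "((\<lambda>s. limit_M r * exp (- s)) has_integral limit_M r * (exp (- a) - exp (- b))) {a..b}"
  proof -
    have "((\<lambda>s. exp (- s)) has_integral (- exp (- b) - - exp (- a))) {a..b}"
      using ab by (intro fundamental_theorem_of_calculus)
        (auto intro!: derivative_eq_intros simp flip: has_real_derivative_iff_has_vector_derivative)
    from has_integral_mult_right[OF this, of "limit_M r"] show ?thesis by simp
  qed
  have "norm (exp b *\<^sub>R ?u b - exp a *\<^sub>R ?u a) = norm (integral {a..b} g)"
    using hi by (simp add: integral_unique)
  also have "\<dots> \<le> integral {a..b} (\<lambda>s. limit_M r * exp (- s))"
  proof (rule integral_norm_bound_integral)
    fix s assume "s \<in> {a..b}"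
    then have s: "s \<ge> 0" using ab by simp
    have "norm (g s) = exp s * norm (G (?u s) s + ?u s)" by (simp add: g_def)
    also have "\<dots> \<le> exp s * (64 / (1 - r)\<^sup>2 * (norm (?u s))\<^sup>2)"
      by (intro mult_left_mono class_M_add_id_le[OF M nu[OF s] z(2)]) simp
    also have "\<dots> \<le> exp s * (64 / (1 - r)\<^sup>2 * (exp (4 / (1 - r)\<^sup>2) * exp (- s))\<^sup>2)"
      by (intro mult_left_mono power_mono M_flow_decay[OF G \<phi> z s]) auto
    also have "\<dots> = limit_M r * exp (- s)"
      by (simp add: limit_M_def power2_eq_square exp_minus)
    finally show "norm (g s) \<le> limit_M r * exp (- s)" .
  qed (use hi he in auto)
  also have "\<dots> = limit_M r * (exp (- a) - exp (- b))" using he by (rule integral_unique)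
  also have "\<dots> \<le> limit_M r * exp (- a)" by (intro mult_left_mono) (auto simp: limit_M_def)
  finally show ?thesis .
qed

lemma locally_uniform_limit_ballI:
  fixes f :: "complex ^ 'n::finite \<Rightarrow> complex ^ 'n"
  assumes "\<And>r. r < 1 \<Longrightarrow> uniform_limit (cball 0 r) u f F"
  shows "locally_uniform_limit_ball u f F"
  unfolding locally_uniform_limit_ball_def
proof (intro allI impI, elim conjE)
  fix K :: "(complex ^ 'n) set" assume K: "compact K" "K \<subseteq> unit_ball"
  show "uniform_limit K u f F"
  proof (cases "K = {}")
    case False
    obtain x where x: "x \<in> K" "\<And>y. y \<in> K \<Longrightarrow> norm y \<le> norm x"
      using continuous_attains_sup[OF K(1) False continuous_on_norm_id] by blast
    show ?thesis
    proof (rule uniform_limit_on_subset)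
      show "uniform_limit (cball 0 (norm x)) u f F" by (rule assms) (use x(1) K(2) in auto)
      show "K \<subseteq> cball 0 (norm x)" using x(2) by auto
    qed
  qed simp
qed

text \<open>The limit is defined along integer times, where the scaled increments form a Cauchy
  sequence. The tail bound depends on \<open>norm z\<close> only through \<open>r\<close>, so
  convergence in real time is uniform on closed balls.\<close>

lemma M_flow_limit_exists:
  fixes G :: "complex ^ 'n::finite \<Rightarrow> real \<Rightarrow> complex ^ 'n"
  assumes G: "M_field G" and \<phi>: "M_flow G \<phi>"
  obtains f where "Loewner_limit \<phi> f" "f \<in> Hol_ball"
proof -
  define f where "f = (\<lambda>z. lim (\<lambda>n. exp (real n) *\<^sub>R \<phi> (real n) z))"
  have lim: "(\<lambda>n. exp (real n) *\<^sub>R \<phi> (real n) z) \<longlonglongrightarrow> f z" if z: "z \<in> unit_ball" for z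
  proof -
    let ?r = "norm z"
    have r: "?r < 1" using z by simp
    have "Cauchy (\<lambda>n. exp (real n) *\<^sub>R \<phi> (real n) z)"
    proof (rule CauchyI')
      fix e :: real assume "e > 0"
      have "(\<lambda>n. limit_M ?r * exp (- real n)) \<longlonglongrightarrow> 0" by real_asymp
      then have "\<forall>\<^sub>F n in sequentially. limit_M ?r * exp (- real n) < e" using \<open>e > 0\<close> by (rule order_tendstoD)
      then obtain N where N: "\<And>n. n \<ge> N \<Longrightarrow> limit_M ?r * exp (- real n) < e" by (auto simp: eventually_sequentially)
      show "\<exists>M. \<forall>m\<ge>M. \<forall>n>m. dist (exp (real m) *\<^sub>R \<phi> (real m) z) (exp (real n) *\<^sub>R \<phi> (real n) z) < e"
      proof (intro exI allI impI)
        fix m n assume mn: "m \<ge> N" "n > m"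
        show "dist (exp (real m) *\<^sub>R \<phi> (real m) z) (exp (real n) *\<^sub>R \<phi> (real n) z) < e"
          using M_flow_scaled_increment[OF G \<phi> order_refl r, of "real m" "real n"] N[OF mn(1)] mn(2)
          by (simp add: dist_norm norm_minus_commute)
      qed
    qed
    then show ?thesis unfolding f_def using Cauchy_convergent_iff convergent_LIMSEQ_iff by blast
  qed
  have est: "norm (f z - exp t *\<^sub>R \<phi> t z) \<le> limit_M r * exp (- t)" if z: "norm z \<le> r" "r < 1" and t: "t \<ge> 0" for z r t
  proof (rule LIMSEQ_le_const2)
    show "(\<lambda>n. norm (exp (real n) *\<^sub>R \<phi> (real n) z - exp t *\<^sub>R \<phi> t z)) \<longlonglongrightarrow> norm (f z - exp t *\<^sub>R \<phi> t z)"
      by (intro tendsto_intros lim) (use z in simp)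
    obtain N where N: "t \<le> real N" using real_arch_simple by blast
    show "\<exists>N. \<forall>n\<ge>N. norm (exp (real n) *\<^sub>R \<phi> (real n) z - exp t *\<^sub>R \<phi> t z) \<le> limit_M r * exp (- t)"
      using M_flow_scaled_increment[OF G \<phi> z t] N by (meson of_nat_mono order_trans)
  qed
  have unif: "uniform_limit (cball 0 r) (\<lambda>t z. exp t *\<^sub>R \<phi> t z) f at_top" if r: "r < 1" for r
  proof (rule uniform_limitI)
    fix e :: real assume "e > 0"
    have "((\<lambda>t. limit_M r * exp (- t)) \<longlongrightarrow> 0) at_top" by real_asymp
    then have "\<forall>\<^sub>F t in at_top. limit_M r * exp (- t) < e" using \<open>e > 0\<close> by (rule order_tendstoD)
    then show "\<forall>\<^sub>F t in at_top. \<forall>z\<in>cball 0 r. dist (exp t *\<^sub>R \<phi> t z) (f z) < e"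
      using eventually_ge_at_top[of 0]
    proof eventually_elim
      case (elim t)
      show ?case
      proof
        fix z :: "complex ^ 'n" assume "z \<in> cball 0 r"
        then show "dist (exp t *\<^sub>R \<phi> t z) (f z) < e"
          using est[of z r t] r elim by (simp add: dist_norm norm_minus_commute)
      qed
    qed
  qed
  have "Loewner_limit \<phi> f"
    unfolding Loewner_limit_def by (rule locally_uniform_limit_ballI) (rule unif)
  moreover have "f \<in> Hol_ball"
  proof (rule Hol_ball_uniform_limit)
    show "holo_at (\<lambda>z. exp (real k) *\<^sub>R \<phi> (real k) z) x" if "x \<in> unit_ball" for k x
      using that by (intro holo_at_scaleR M_flow_holo_at[OF G \<phi>]) simp_all
    show "uniform_limit (cball 0 r) (\<lambda>k z. exp (real k) *\<^sub>R \<phi> (real k) z) f sequentially" if "r < 1" for r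
      unfolding uniform_limit_iff
      using eventually_compose_filterlim[OF _ filterlim_real_sequentially] unif[OF that, unfolded uniform_limit_iff] by blast
  qed
  ultimately show thesis by (rule that)
qed

lemma Loewner_limit_tendsto:
  assumes "Loewner_limit \<phi> f" "z \<in> unit_ball"
  shows "((\<lambda>t. exp t *\<^sub>R \<phi> t z) \<longlongrightarrow> f z) at_top"
proof -
  have "uniform_limit {z} (\<lambda>t z. exp t *\<^sub>R \<phi> t z) f at_top"
    using assms compact_sing[of z] unfolding Loewner_limit_def locally_uniform_limit_ball_def by blast
  then show ?thesis by (rule tendsto_uniform_limitI) simp
qed

section \<open>Time shifts\<close>

lemma M_field_shift:
  assumes "M_field G"
  shows "M_field (\<lambda>z s. G z (\<tau> + s))"
  unfolding M_field_def
proof (intro conjI allI ballI)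
  show "(\<lambda>z. G z (\<tau> + s)) \<in> class_M" for s using assms by (simp add: M_field_def)
  fix z :: "complex ^ 'a" assume "z \<in> unit_ball"
  then have "G z \<in> borel_measurable lebesgue" using assms by (simp add: M_field_def)
  moreover have "(\<lambda>s. \<tau> + s) \<in> lebesgue \<rightarrow>\<^sub>M lebesgue"
    using lebesgue_affine_measurable[of "\<lambda>_::real. 1" \<tau>] by simp
  ultimately show "(\<lambda>s. G z (\<tau> + s)) \<in> borel_measurable lebesgue"
    by (rule measurable_compose[rotated])
qed

lemma M_flow_semigroup:
  assumes G: "M_field G" and \<phi>: "M_flow G \<phi>" and \<Phi>: "M_flow (\<lambda>z s. G z (\<tau> + s)) \<Phi>"
    and z: "z \<in> unit_ball" and "\<tau> \<ge> 0" "s \<ge> 0"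
  shows "\<phi> (\<tau> + s) z = \<Phi> s (\<phi> \<tau> z)"
proof -
  have w: "\<phi> \<tau> z \<in> unit_ball" by (rule M_flow_D(2)[OF \<phi> z \<open>\<tau> \<ge> 0\<close>])
  have M: "(\<lambda>z. G z (\<tau> + s)) \<in> class_M" for s using G by (simp add: M_field_def)
  have "M_trajectory (\<lambda>z s. G z (\<tau> + s)) s (\<phi> \<tau> z) (\<lambda>s. \<phi> (\<tau> + s) z)"
    unfolding M_trajectory_def
  proof (intro conjI ballI)
    show "continuous_on {0..s} (\<lambda>s. \<phi> (\<tau> + s) z)"
      by (rule continuous_on_compose2[OF M_flow_D(5)[OF \<phi> z, of "\<tau> + s"]])
        (use \<open>\<tau> \<ge> 0\<close> in \<open>auto intro!: continuous_intros\<close>)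
    fix t assume t: "t \<in> {0..s}"
    then show "\<phi> (\<tau> + t) z \<in> unit_ball" using M_flow_D(2)[OF \<phi> z] \<open>\<tau> \<ge> 0\<close> by simp
    have "((\<lambda>s. G (\<phi> s z) s) has_integral (\<phi> (\<tau> + t) z - \<phi> \<tau> z)) {\<tau>..\<tau> + t}"
      by (rule has_integral_increment[OF M_flow_D(3)[OF \<phi> z] \<open>\<tau> \<ge> 0\<close>]) (use t in simp_all)
    then show "((\<lambda>s. G (\<phi> (\<tau> + s) z) (\<tau> + s)) has_integral (\<phi> (\<tau> + t) z - \<phi> \<tau> z)) {0..t}"
      using has_integral_shift_Icc_real[of "\<lambda>s. G (\<phi> s z) s" \<tau> _ 0 t] by (simp add: o_def add.commute)
  qed
  then show ?thesis
    using M_trajectory_unique[OF M _ M_flow_D(1)[OF \<Phi> w \<open>s \<ge> 0\<close>], of "\<lambda>s. \<phi> (\<tau> + s) z" s] \<open>s \<ge> 0\<close> by simp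
qed

text \<open>This separates the two influences on the limit map: the outer map \<open>g\<close> sees
  only the field after time \<tau>, the inner map only the field before it. The scaling splits as
  \<open>exp t = exp \<tau> * exp (t - \<tau>)\<close>.\<close>

lemma M_flow_limit_shift:
  assumes G: "M_field G" and \<phi>: "M_flow G \<phi>" and \<Phi>: "M_flow (\<lambda>z s. G z (\<tau> + s)) \<Phi>"
    and f: "Loewner_limit \<phi> f" and g: "Loewner_limit \<Phi> g"
    and z: "z \<in> unit_ball" and \<tau>: "\<tau> \<ge> 0"
  shows "f z = exp \<tau> *\<^sub>R g (\<phi> \<tau> z)"
proof (rule tendsto_unique[OF _ Loewner_limit_tendsto[OF f z]])
  have "((\<lambda>t. exp (t - \<tau>) *\<^sub>R \<Phi> (t - \<tau>) (\<phi> \<tau> z)) \<longlongrightarrow> g (\<phi> \<tau> z)) at_top"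
    by (rule filterlim_compose[OF Loewner_limit_tendsto[OF g M_flow_D(2)[OF \<phi> z \<tau>]]]) real_asymp
  then have "((\<lambda>t. exp \<tau> *\<^sub>R exp (t - \<tau>) *\<^sub>R \<Phi> (t - \<tau>) (\<phi> \<tau> z)) \<longlongrightarrow> exp \<tau> *\<^sub>R g (\<phi> \<tau> z)) at_top"
    by (intro tendsto_intros)
  then show "((\<lambda>t. exp t *\<^sub>R \<phi> t z) \<longlongrightarrow> exp \<tau> *\<^sub>R g (\<phi> \<tau> z)) at_top"
  proof (rule Lim_transform_eventually)
    show "\<forall>\<^sub>F t in at_top. exp \<tau> *\<^sub>R exp (t - \<tau>) *\<^sub>R \<Phi> (t - \<tau>) (\<phi> \<tau> z) = exp t *\<^sub>R \<phi> t z"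
      using eventually_ge_at_top[of \<tau>]
    proof eventually_elim
      case (elim t)
      then show ?case using M_flow_semigroup[OF G \<phi> \<Phi> z \<tau>, of "t - \<tau>"] by (simp flip: exp_add)
    qed
  qed
qed simp

section \<open>Needle variations\<close>

lemma has_derivative_unit_ball_cong:
  fixes f g :: "complex ^ 'n::finite \<Rightarrow> complex ^ 'n"
  assumes "(f has_derivative D) (at z)" "z \<in> unit_ball" "\<And>w. w \<in> unit_ball \<Longrightarrow> g w = f w"
  shows "(g has_derivative D) (at z)"
  by (rule has_derivative_transform_within_open[OF assms(1) open_ball assms(2)]) (simp add: assms(3))

text \<open>A limit map is determined on the ball only, so holomorphy is carried over by agreement
  there with the limit map already constructed.\<close>

lemma Loewner_limit_Hol_ball:
  assumes G: "M_field G" and \<phi>: "M_flow G \<phi>" and f: "Loewner_limit \<phi> f"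
  shows "f \<in> Hol_ball"
proof -
  obtain f' where f': "Loewner_limit \<phi> f'" "f' \<in> Hol_ball" by (rule M_flow_limit_exists[OF G \<phi>])
  have eq: "f z = f' z" if "z \<in> unit_ball" for z
    by (rule tendsto_unique[OF _ Loewner_limit_tendsto[OF f that] Loewner_limit_tendsto[OF f'(1) that]]) simp
  show ?thesis
    using f'(2) eq has_derivative_unit_ball_cong unfolding Hol_ball_def mem_Collect_eq by metis
qed

text \<open>This map will serve as the field at exceptional and nonpositive times.\<close>

lemma uminus_class_M: "uminus \<in> class_M"
proof -
  have d: "(uminus has_derivative (\<lambda>v. (- mat 1) *v v)) (at z)" for z :: "complex ^ 'a"
    unfolding minus_mat_1_mult by (auto intro!: derivative_eq_intros)
  then show ?thesis
    unfolding class_M_def by (auto simp: Hol_ball_def complex_jacobian_eqI[OF d] Re_hermitian_inner)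
qed

lemma Herglotz_vector_field_M_field:
  fixes G :: "complex ^ 'n::finite \<Rightarrow> real \<Rightarrow> complex ^ 'n"
  assumes "Herglotz_vector_field G"
  obtains G' N where "M_field G'" "negligible N" "\<And>s z. s > 0 \<Longrightarrow> s \<notin> N \<Longrightarrow> G' z s = G z s"
proof
  define N where "N = {t\<in>{0<..}. (\<lambda>z. G z t) \<notin> class_M}"
  \<comment> \<open>The inner conditional extends \<open>G z\<close> by 0 to a function that is
    measurable on the whole line (\<open>F\<close> below); the outer one replaces it by
    \<open>- z\<close> at nonpositive times and on \<open>N\<close>, so the value 0 is never taken
    from it.\<close>
  define G' where "G' = (\<lambda>z s. if s \<in> {0<..} - N then (if s \<in> {0<..} then G z s else 0) else - z)"
  show N: "negligible N"
    using assms unfolding N_def Herglotz_vector_field_def by (simp add: AE_lebesgue_on_iff_negligible)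
  show "G' z s = G z s" if "s > 0" "s \<notin> N" for s z using that by (simp add: G'_def)
  show "M_field G'"
    unfolding M_field_def
  proof (intro conjI allI ballI)
    fix s
    show "(\<lambda>z. G' z s) \<in> class_M"
    proof (cases "s \<in> {0<..} - N")
      case True
      then have "(\<lambda>z. G' z s) = (\<lambda>z. G z s)" by (auto simp: G'_def)
      then show ?thesis using True by (simp add: N_def)
    next
      case False
      then have "(\<lambda>z. G' z s) = uminus" by (auto simp: G'_def)
      then show ?thesis using uminus_class_M by simp
    qed
  next
    fix z :: "complex ^ 'n" assume "z \<in> unit_ball"
    define F where "F = (\<lambda>s. if s \<in> {0<..} then G z s else 0)"
    have "F \<in> borel_measurable lebesgue"
      using assms \<open>z \<in> unit_ball\<close> borel_measurable_if[of "{0<..}" "G z"]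
      by (simp add: F_def Herglotz_vector_field_def)
    moreover have "({0<..} - N) \<inter> space lebesgue \<in> sets lebesgue"
      using negligible_imp_sets[OF N] by (simp add: sets.Diff)
    moreover have "G' z = (\<lambda>s. if s \<in> {0<..} - N then F s else - z)" by (simp add: G'_def F_def fun_eq_iff)
    ultimately show "G' z \<in> borel_measurable lebesgue"
      by (simp only: measurable_If_set measurable_const space_borel UNIV_I)
  qed
qed

text \<open>Absolute continuity turns the almost everywhere equation into the integrated one. The
  times in \<open>N\<close>, where the fields may differ, join the exceptional set of the
  fundamental theorem.\<close>

lemma Loewner_flow_M_flow:
  fixes G :: "complex ^ 'n::finite \<Rightarrow> real \<Rightarrow> complex ^ 'n"
  assumes \<phi>: "Loewner_flow G \<phi>" and N: "negligible N" and eq: "\<And>s z. s > 0 \<Longrightarrow> s \<notin> N \<Longrightarrow> G' z s = G z s"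
  shows "M_flow G' \<phi>"
  unfolding M_flow_def M_trajectory_def
proof (intro ballI allI impI conjI)
  fix z :: "complex ^ 'n" assume z: "z \<in> unit_ball"
  show inb: "\<phi> t z \<in> unit_ball" if "t \<in> {0..T}" for t T using \<phi> z that by (simp add: Loewner_flow_def)
  have start: "\<phi> 0 z = z" using \<phi> z by (simp add: Loewner_flow_def)
  define N' where "N' = {t\<in>{0<..}. \<not> ((\<lambda>s. \<phi> s z) has_vector_derivative G (\<phi> t z) t) (at t)} \<union> N \<union> {0}"
  have N': "negligible N'"
    using \<phi> z N unfolding N'_def Loewner_flow_def by (simp add: AE_lebesgue_on_iff_negligible negligible_Un)
  have int: "((\<lambda>s. G' (\<phi> s z) s) has_integral (\<phi> T z - z)) {0..T}" if T: "T \<ge> 0" for T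
  proof (cases "T = 0")
    case True
    then show ?thesis using start by (simp add: has_integral_refl)
  next
    case False
    have "absolutely_continuous_on {0..T} (\<lambda>t. \<phi> t z)" using \<phi> z T False by (simp add: Loewner_flow_def)
    then have "((\<lambda>s. G' (\<phi> s z) s) has_integral (\<phi> T z - \<phi> 0 z)) {0..T}"
    proof (rule fundamental_theorem_absolutely_continuous[OF T _ N'])
      fix x assume "x \<in> {0..T} - N'"
      then have "x > 0" "x \<notin> N" "((\<lambda>s. \<phi> s z) has_vector_derivative G (\<phi> x z) x) (at x)" by (auto simp: N'_def)
      then show "((\<lambda>s. \<phi> s z) has_vector_derivative G' (\<phi> x z) x) (at x within {0..T})"
        using eq by (simp add: has_vector_derivative_at_within)
    qed
    then show ?thesis using start by simp
  qed
  then show "((\<lambda>s. G' (\<phi> s z) s) has_integral (\<phi> t z - z)) {0..t}" if "t \<in> {0..T}" for t T using that by simp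
  show "continuous_on {0..T} (\<lambda>t. \<phi> t z)" if "T \<ge> 0" for T
  proof -
    have "continuous_on {0..T} (\<lambda>t. z + integral {0..t} (\<lambda>s. G' (\<phi> s z) s))"
      using int[OF that] by (intro continuous_intros indefinite_integral_continuous_1) blast
    moreover have "z + integral {0..t} (\<lambda>s. G' (\<phi> s z) s) = \<phi> t z" if "t \<in> {0..T}" for t
      using int[of t] that by (simp add: integral_unique)
    ultimately show ?thesis by (rule continuous_on_eq)
  qed
qed

text \<open>The way back: along a trajectory from \<open>z\<close> the field is bounded by
  \<open>bnd_M (norm z)\<close>, so the trajectory is Lipschitz in time and Lebesgue differentiation
  recovers the differential equation.\<close>

lemma M_field_class_S0:
  fixes G :: "complex ^ 'n::finite \<Rightarrow> real \<Rightarrow> complex ^ 'n"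
  assumes G: "M_field G" and \<phi>: "M_flow G \<phi>" and f: "Loewner_limit \<phi> f"
  shows "f \<in> class_S0"
proof -
  have "Herglotz_vector_field G"
    using G unfolding M_field_def Herglotz_vector_field_def by (auto intro: measurable_restrict_space1)
  moreover have "Loewner_flow G \<phi>"
    unfolding Loewner_flow_def
  proof (intro ballI conjI allI impI)
    fix z :: "complex ^ 'n" assume z: "z \<in> unit_ball"
    note int = M_flow_D(3)[OF \<phi> z]
    show "\<phi> 0 z = z" by (rule M_flow_D(4)[OF \<phi> z])
    show "\<phi> t z \<in> unit_ball" if "t \<ge> 0" for t by (rule M_flow_D(2)[OF \<phi> z that])
    have z1: "norm z < 1" using z by simp
    have bnd: "norm (G (\<phi> s z) s) \<le> bnd_M (norm z)" if "0 \<le> s" for s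
      by (rule class_M_bounded[OF M_field_D[OF G] M_flow_norm_le[OF G \<phi> z that] z1])
    show "absolutely_continuous_on {0..T} (\<lambda>t. \<phi> t z)" for T
      using lipschitz_on_absolutely_continuous_on[OF has_integral_lipschitz_on[OF int bnd]] class_M_const_pos(2)[OF z1]
      by (meson less_imp_le)
    show "AE t in lebesgue_on {0<..}. ((\<lambda>s. \<phi> s z) has_vector_derivative G (\<phi> t z) t) (at t)"
      using has_integral_derivative_negligible[OF int] by (simp add: AE_lebesgue_on_iff_negligible)
  qed
  ultimately show ?thesis using f by (auto simp: class_S0_def)
qed

section \<open>Left difference quotients in time\<close>

lemma has_vector_derivative_left_quotient:
  fixes u :: "real \<Rightarrow> 'a::real_normed_vector"
  assumes "(u has_vector_derivative D) (at t)"
  shows "((\<lambda>\<epsilon>. (1 / \<epsilon>) *\<^sub>R (u t - u (t - \<epsilon>))) \<longlongrightarrow> D) (at_right 0)"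
proof (rule tendstoI)
  fix e :: real assume "e > 0"
  then obtain d where d: "d > 0" "\<And>y. \<bar>y - t\<bar> < d \<Longrightarrow> norm (u y - u t - (y - t) *\<^sub>R D) \<le> e / 2 * \<bar>y - t\<bar>"
    using assms unfolding has_vector_derivative_def has_derivative_at_alt by (metis half_gt_zero real_norm_def)
  have "\<forall>\<^sub>F \<epsilon> in at_right 0. \<epsilon> \<in> {0<..<d}" using d(1) by (rule eventually_at_right_real)
  then show "\<forall>\<^sub>F \<epsilon> in at_right 0. dist ((1 / \<epsilon>) *\<^sub>R (u t - u (t - \<epsilon>))) D < e"
  proof eventually_elim
    case (elim \<epsilon>)
    have "(1 / \<epsilon>) *\<^sub>R (u t - u (t - \<epsilon>)) - D = - ((1 / \<epsilon>) *\<^sub>R (u (t - \<epsilon>) - u t - (t - \<epsilon> - t) *\<^sub>R D))"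
      using elim by (simp add: algebra_simps)
    then have "dist ((1 / \<epsilon>) *\<^sub>R (u t - u (t - \<epsilon>))) D = (1 / \<epsilon>) * norm (u (t - \<epsilon>) - u t - (t - \<epsilon> - t) *\<^sub>R D)"
      using elim by (simp add: dist_norm)
    also have "\<dots> \<le> (1 / \<epsilon>) * (e / 2 * \<bar>t - \<epsilon> - t\<bar>)" using elim by (intro mult_left_mono d(2)) auto
    also have "\<dots> < e" using elim \<open>e > 0\<close> by simp
    finally show ?case .
  qed
qed

text \<open>The quotient is the average of the field along the trajectory over the last \<epsilon>
  units of time. It inherits the Lipschitz constant of the composed field, which does not depend on
  \<epsilon>; this is the equicontinuity used next.\<close>

lemma M_flow_left_quotient_lipschitz:
  assumes G: "M_field G" and \<phi>: "M_flow G \<phi>" and r: "r < 1" "norm z \<le> r" "norm w \<le> r" and \<epsilon>: "0 < \<epsilon>" "\<epsilon> \<le> t"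
  defines "K \<equiv> lip_M r * exp (lip_M r * t)"
  shows "norm ((1 / \<epsilon>) *\<^sub>R (\<phi> t z - \<phi> (t - \<epsilon>) z) - (1 / \<epsilon>) *\<^sub>R (\<phi> t w - \<phi> (t - \<epsilon>) w)) \<le> K * norm (z - w)" (is "norm ?Q \<le> _")
    and "norm (G (\<phi> t z) t - G (\<phi> t w) t) \<le> K * norm (z - w)"
proof -
  let ?X = "(\<phi> t z - \<phi> (t - \<epsilon>) z) - (\<phi> t w - \<phi> (t - \<epsilon>) w)"
  have zb: "z \<in> unit_ball" "w \<in> unit_ball" using r by auto
  have L: "lip_M r > 0" by (rule class_M_const_pos(1)[OF r(1)])
  have nz: "norm (\<phi> s z) \<le> r" "norm (\<phi> s w) \<le> r" if "s \<ge> 0" for s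
    using M_flow_norm_le[OF G \<phi> _ that] zb r by fastforce+
  have lip: "norm (G (\<phi> s z) s - G (\<phi> s w) s) \<le> K * norm (z - w)" if s: "0 \<le> s" "s \<le> t" for s
  proof -
    have "norm (G (\<phi> s z) s - G (\<phi> s w) s) \<le> lip_M r * norm (\<phi> s z - \<phi> s w)"
      by (rule class_M_lipschitz[OF M_field_D[OF G] nz[OF s(1)] r(1)])
    also have "\<dots> \<le> lip_M r * (norm (z - w) * exp (lip_M r * s))"
      using L by (intro mult_left_mono M_flow_lipschitz[OF G \<phi> r s(1)]) auto
    also have "\<dots> \<le> lip_M r * (norm (z - w) * exp (lip_M r * t))"
      using L s by (intro mult_left_mono) auto
    finally show ?thesis by (simp add: K_def mult_ac)
  qed
  show "norm (G (\<phi> t z) t - G (\<phi> t w) t) \<le> K * norm (z - w)" using lip \<epsilon> by simp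
  have "((\<lambda>s. G (\<phi> s z') s) has_integral (\<phi> t z' - \<phi> (t - \<epsilon>) z')) {t - \<epsilon>..t}" if "z' \<in> unit_ball" for z'
    by (rule has_integral_increment[OF M_flow_D(3)[OF \<phi> that]]) (use \<epsilon> in auto)
  from has_integral_diff[OF this[OF zb(1)] this[OF zb(2)]]
  have "norm (?X) \<le> K * norm (z - w) * (t - (t - \<epsilon>))"
    using has_integral_bound_real[of "K * norm (z - w)" "{}" "\<lambda>s. G (\<phi> s z) s - G (\<phi> s w) s" _ "t - \<epsilon>" t] lip \<epsilon> L
    by (simp add: K_def)
  then have "(1 / \<epsilon>) * norm (?X) \<le> K * norm (z - w)"
    using \<epsilon> by (simp add: field_simps)
  moreover have "norm (?Q)
      = (1 / \<epsilon>) * norm (?X)"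
    using \<epsilon> unfolding scaleR_diff_right[symmetric] by simp
  ultimately show "norm (?Q) \<le> K * norm (z - w)"
    by simp
qed

text \<open>Differentiability in time at a dense set of initial points is enough, since the difference
  quotients are equicontinuous in the initial point.\<close>

lemma M_flow_left_quotient_uniform:
  fixes G :: "complex ^ 'n::finite \<Rightarrow> real \<Rightarrow> complex ^ 'n"
  assumes G: "M_field G" and \<phi>: "M_flow G \<phi>" and t: "t > 0"
    and dense: "\<And>X. open X \<Longrightarrow> X \<noteq> {} \<Longrightarrow> \<exists>d\<in>D. d \<in> X"
    and der: "\<And>z. z \<in> D \<Longrightarrow> z \<in> unit_ball \<Longrightarrow> ((\<lambda>s. \<phi> s z) has_vector_derivative G (\<phi> t z) t) (at t)"
    and r: "r < 1"
  shows "uniform_limit (cball 0 r) (\<lambda>\<epsilon> z. (1 / \<epsilon>) *\<^sub>R (\<phi> t z - \<phi> (t - \<epsilon>) z)) (\<lambda>z. G (\<phi> t z) t) (at_right 0)"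
proof (rule uniform_limitI)
  fix e :: real assume "e > 0"
  \<comment> \<open>Points of \<open>D\<close> that approximate points of \<open>cball 0 r\<close>
    may lie outside that ball, but not outside radius \<open>r1\<close>.\<close>
  define r1 where "r1 = (1 + r) / 2"
  have r1: "r1 < 1" "r < r1" using r by (auto simp: r1_def)
  define K where "K = lip_M r1 * exp (lip_M r1 * t)"
  have K: "K > 0" using class_M_const_pos(1)[OF r1(1)] by (simp add: K_def)
  \<comment> \<open>Moving from \<open>z\<close> to a point \<open>d\<close> of the finite net costs
    at most \<open>K * \<eta> \<le> e / 4\<close> in the quotient and again in the limit; the third
    quarter is the convergence at \<open>d\<close>.\<close>
  define \<eta> where "\<eta> = min (e / (4 * K)) (r1 - r)"
  have \<eta>: "\<eta> > 0" "K * \<eta> \<le> e / 4" "\<eta> \<le> r1 - r"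
    using \<open>e > 0\<close> K r1 by (auto simp: \<eta>_def min_def field_simps)
  let ?Q = "\<lambda>\<epsilon> z. (1 / \<epsilon>) *\<^sub>R (\<phi> t z - \<phi> (t - \<epsilon>) z)" and ?L = "\<lambda>z. G (\<phi> t z) t"
  define D1 where "D1 = D \<inter> ball 0 r1"
  have "cball 0 r \<subseteq> (\<Union>d\<in>D1. ball d \<eta>)"
  proof
    fix z :: "complex ^ 'n" assume z: "z \<in> cball 0 r"
    obtain d where d: "d \<in> D" "d \<in> ball z \<eta>" using dense[of "ball z \<eta>"] \<eta>(1) by auto
    have "norm d < r1" using d(2) z \<eta>(3) norm_triangle_sub[of d z] by (simp add: dist_norm norm_minus_commute)
    then show "z \<in> (\<Union>d\<in>D1. ball d \<eta>)" using d by (auto simp: D1_def dist_commute)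
  qed
  then obtain D2 where D2: "D2 \<subseteq> D1" "finite D2" "cball 0 r \<subseteq> (\<Union>d\<in>D2. ball d \<eta>)"
    using compactE_image[OF compact_cball, of D1 "\<lambda>d. ball d \<eta>" 0 r] by auto
  have "\<forall>\<^sub>F \<epsilon> in at_right 0. \<forall>d\<in>D2. dist (?Q \<epsilon> d) (?L d) < e / 4"
  proof (rule eventually_ball_finite[OF D2(2)], rule ballI)
    fix d assume "d \<in> D2"
    then have "d \<in> D" "d \<in> unit_ball" using D2(1) r1 by (auto simp: D1_def)
    from tendstoD[OF has_vector_derivative_left_quotient[OF der[OF this]], of "e / 4"] \<open>e > 0\<close>
    show "\<forall>\<^sub>F \<epsilon> in at_right 0. dist (?Q \<epsilon> d) (?L d) < e / 4" by simp
  qed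
  moreover have "\<forall>\<^sub>F \<epsilon> in at_right 0. \<epsilon> \<in> {0<..<t}" using t by (rule eventually_at_right_real)
  ultimately show "\<forall>\<^sub>F \<epsilon> in at_right 0. \<forall>z\<in>cball 0 r. dist (?Q \<epsilon> z) (?L z) < e"
  proof eventually_elim
    case (elim \<epsilon>)
    show ?case
    proof
      fix z :: "complex ^ 'n" assume z: "z \<in> cball 0 r"
      then obtain d where d: "d \<in> D2" "dist d z < \<eta>" using D2(3) by auto
      have nd: "norm d \<le> r1" "norm z \<le> r1" using d D2(1) z r1 by (auto simp: D1_def)
      have \<epsilon>: "0 < \<epsilon>" "\<epsilon> \<le> t" using elim by auto
      have "K * norm (z - d) \<le> K * \<eta>" using d(2) K by (intro mult_left_mono) (auto simp: dist_norm norm_minus_commute)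
      then have "dist (?Q \<epsilon> z) (?Q \<epsilon> d) \<le> e / 4" "dist (?L d) (?L z) \<le> e / 4"
        using M_flow_left_quotient_lipschitz[OF G \<phi> r1(1) nd(2,1) \<epsilon>] \<eta>(2) unfolding K_def[symmetric]
        by (auto simp: dist_norm norm_minus_commute)
      moreover have "dist (?Q \<epsilon> d) (?L d) < e / 4" using elim d by blast
      moreover have "dist (?Q \<epsilon> z) (?L z) \<le> dist (?Q \<epsilon> z) (?Q \<epsilon> d) + dist (?Q \<epsilon> d) (?L d) + dist (?L d) (?L z)"
        by (meson add_mono_thms_linordered_semiring(3) dist_triangle order_trans)
      ultimately show "dist (?Q \<epsilon> z) (?L z) < e" using \<open>e > 0\<close> by linarith
    qed
  qed
qed

text \<open>The window is open at \<open>t\<close>, so that the time shifts by \<open>t\<close> of the two fields coincide.\<close>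

definition needle ::
  "(complex ^ 'n::finite \<Rightarrow> real \<Rightarrow> complex ^ 'n) \<Rightarrow> (complex ^ 'n \<Rightarrow> complex ^ 'n) \<Rightarrow> real \<Rightarrow> real \<Rightarrow> complex ^ 'n \<Rightarrow> real \<Rightarrow> complex ^ 'n"
  where "needle G h t \<epsilon> z s = (if s \<in> {t - \<epsilon><..<t} then h z else G z s)"

section \<open>First-order expansion of the perturbed flow\<close>

lemma M_field_needle:
  fixes G :: "complex ^ 'n::finite \<Rightarrow> real \<Rightarrow> complex ^ 'n"
  assumes G: "M_field G" and h: "h \<in> class_M"
  shows "M_field (needle G h t \<epsilon>)"
  unfolding M_field_def
proof (intro conjI allI ballI)
  show "(\<lambda>z. needle G h t \<epsilon> z s) \<in> class_M" for s
    using G h by (cases "s \<in> {t - \<epsilon><..<t}") (auto simp: needle_def M_field_def)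
  fix z :: "complex ^ 'n" assume "z \<in> unit_ball"
  then have "G z \<in> borel_measurable lebesgue" using G by (simp add: M_field_def)
  then have "(\<lambda>s. if s \<in> {t - \<epsilon><..<t} then h z else G z s) \<in> borel_measurable lebesgue"
    by (intro measurable_If_set) auto
  then show "needle G h t \<epsilon> z \<in> borel_measurable lebesgue" by (simp add: needle_def[abs_def])
qed

text \<open>Up to the window the two flows agree. Inside it, \<open>\<psi> s z\<close> and
  \<open>\<phi> t z\<close> both lie within \<open>bnd_M r * \<epsilon>\<close> of the common point
  \<open>\<phi> (t - \<epsilon>) z\<close>, so the integrand \<open>h (\<psi> s z)\<close> differs
  from the constant \<open>h (\<phi> t z)\<close> by a term of order \<epsilon>, over a window of
  length \<epsilon>.\<close>

lemma needle_flow_estimate: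
  assumes G: "M_field G" and \<phi>: "M_flow G \<phi>" and h: "h \<in> class_M"
    and \<psi>: "M_flow (needle G h t \<epsilon>) \<psi>" and \<epsilon>: "0 < \<epsilon>" "\<epsilon> < t" and z: "norm z \<le> r" "r < 1"
  shows "norm (\<psi> t z - \<phi> (t - \<epsilon>) z - \<epsilon> *\<^sub>R h (\<phi> t z)) \<le> lip_M r * (2 * bnd_M r) * \<epsilon>\<^sup>2"
proof -
  let ?H = "needle G h t \<epsilon>"
  note H = M_field_needle[OF G h, of t \<epsilon>]
  have zb: "z \<in> unit_ball" using z by simp
  have L: "lip_M r > 0" "bnd_M r > 0" using class_M_const_pos[OF z(2)] by auto
  have t: "t - \<epsilon> \<ge> 0" "t \<ge> 0" using \<epsilon> by auto
  have "M_trajectory G (t - \<epsilon>) z (\<lambda>s. \<psi> s z)"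
    unfolding M_trajectory_def
  proof (intro conjI ballI)
    show "continuous_on {0..t - \<epsilon>} (\<lambda>s. \<psi> s z)" by (rule M_flow_D(5)[OF \<psi> zb])
    fix s assume s: "s \<in> {0..t - \<epsilon>}"
    show "\<psi> s z \<in> unit_ball" by (rule M_flow_D(2)[OF \<psi> zb]) (use s in simp)
    show "((\<lambda>s. G (\<psi> s z) s) has_integral (\<psi> s z - z)) {0..s}"
      by (rule has_integral_eq[OF _ M_flow_D(3)[OF \<psi> zb]]) (use s in \<open>auto simp: needle_def\<close>)
  qed
  then have start: "\<psi> (t - \<epsilon>) z = \<phi> (t - \<epsilon>) z"
    by (rule M_trajectory_unique[OF M_field_D[OF G] _ M_flow_D(1)[OF \<phi> zb t(1)]]) (use t in simp)
  have n\<phi>: "norm (\<phi> s z) \<le> r" "norm (\<psi> s z) \<le> r" if "s \<ge> 0" for s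
    using M_flow_norm_le[OF G \<phi> zb that] M_flow_norm_le[OF H \<psi> zb that] z by auto
  have inc: "norm (\<phi> t z - \<phi> (t - \<epsilon>) z) \<le> bnd_M r * \<epsilon>"
    using has_integral_lipschitz[OF M_flow_D(3)[OF \<phi> zb], of t "bnd_M r" "t - \<epsilon>"]
      class_M_bounded[OF M_field_D[OF G] n\<phi>(1) z(2)] L t \<epsilon> by simp
  have inc': "norm (\<psi> s z - \<psi> (t - \<epsilon>) z) \<le> bnd_M r * \<epsilon>" if s: "s \<in> {t - \<epsilon>..t}" for s
  proof -
    have "norm (\<psi> s z - \<psi> (t - \<epsilon>) z) \<le> bnd_M r * (s - (t - \<epsilon>))"
      using has_integral_lipschitz[OF M_flow_D(3)[OF \<psi> zb], of s "bnd_M r" "t - \<epsilon>"]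
        class_M_bounded[OF M_field_D[OF H] n\<phi>(2) z(2)] L t s by simp
    also have "\<dots> \<le> bnd_M r * \<epsilon>" using s L by (intro mult_left_mono) auto
    finally show ?thesis .
  qed
  have "((\<lambda>s. ?H (\<psi> s z) s) has_integral (\<psi> t z - \<psi> (t - \<epsilon>) z)) {t - \<epsilon>..t}"
    by (rule has_integral_increment[OF M_flow_D(3)[OF \<psi> zb] t(1)]) (use \<epsilon> in simp_all)
  \<comment> \<open>On the closed window the perturbed field differs from \<open>h\<close> at most
    at the two end points.\<close>
  then have "((\<lambda>s. h (\<psi> s z)) has_integral (\<psi> t z - \<psi> (t - \<epsilon>) z)) {t - \<epsilon>..t}"
    by (rule has_integral_spike_finite[of "{t - \<epsilon>, t}", rotated -1]) (auto simp: needle_def)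
  from has_integral_diff[OF this has_integral_const_real[of "h (\<phi> t z)" "t - \<epsilon>" t]]
  have "((\<lambda>s. h (\<psi> s z) - h (\<phi> t z)) has_integral (\<psi> t z - \<phi> (t - \<epsilon>) z - \<epsilon> *\<^sub>R h (\<phi> t z))) {t - \<epsilon>..t}"
    using \<epsilon> by (simp add: start)
  then have "norm (\<psi> t z - \<phi> (t - \<epsilon>) z - \<epsilon> *\<^sub>R h (\<phi> t z)) \<le> (lip_M r * (2 * (bnd_M r * \<epsilon>))) * measure lborel {t - \<epsilon>..t}"
  proof (rule has_integral_bound_real[rotated 2])
    show "0 \<le> lip_M r * (2 * (bnd_M r * \<epsilon>))" using L \<epsilon> by simp
    show "norm (h (\<psi> s z) - h (\<phi> t z)) \<le> lip_M r * (2 * (bnd_M r * \<epsilon>))" if s: "s \<in> {t - \<epsilon>..t} - {}" for s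
    proof -
      have "norm (h (\<psi> s z) - h (\<phi> t z)) \<le> lip_M r * norm (\<psi> s z - \<phi> t z)"
        by (rule class_M_lipschitz[OF h n\<phi>(2) n\<phi>(1) z(2)]) (use s t in auto)
      also have "norm (\<psi> s z - \<phi> t z) \<le> norm (\<psi> s z - \<psi> (t - \<epsilon>) z) + norm (\<phi> t z - \<phi> (t - \<epsilon>) z)"
        unfolding start using norm_triangle_ineq4[of "\<psi> s z - \<phi> (t - \<epsilon>) z" "\<phi> t z - \<phi> (t - \<epsilon>) z"] by simp
      also have "\<dots> \<le> 2 * (bnd_M r * \<epsilon>)" using inc inc'[of s] s by simp
      finally show ?thesis using L by (simp add: mult_left_mono)
    qed
  qed simp
  then show ?thesis using \<epsilon> by (simp add: power2_eq_square mult_ac)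
qed

text \<open>Both flows leave the same point at time \<open>t - \<epsilon>\<close>; over the window
  one moves by about \<open>\<epsilon> *\<^sub>R h\<close>, the other by about
  \<open>\<epsilon> *\<^sub>R G\<close>. Only the second displacement depends on the choice of
  \<open>t\<close>, through the hypothesis \<open>quot\<close>.\<close>

lemma needle_flow_quotient:
  fixes G :: "complex ^ 'n::finite \<Rightarrow> real \<Rightarrow> complex ^ 'n"
  assumes G: "M_field G" and \<phi>: "M_flow G \<phi>" and h: "h \<in> class_M" and t: "t > 0"
    and \<psi>: "\<And>\<epsilon>. 0 < \<epsilon> \<Longrightarrow> \<epsilon> < t \<Longrightarrow> M_flow (needle G h t \<epsilon>) (\<psi> \<epsilon>)" and r: "r < 1"
    and quot: "uniform_limit (cball 0 r) (\<lambda>\<epsilon> z. (1 / \<epsilon>) *\<^sub>R (\<phi> t z - \<phi> (t - \<epsilon>) z)) (\<lambda>z. G (\<phi> t z) t) (at_right 0)"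
  shows "uniform_limit (cball 0 r) (\<lambda>\<epsilon> z. (1 / \<epsilon>) *\<^sub>R (\<psi> \<epsilon> t z - \<phi> t z)) (\<lambda>z. h (\<phi> t z) - G (\<phi> t z) t) (at_right 0)"
proof (rule uniform_limitI)
  fix e :: real assume "e > 0"
  define C where "C = lip_M r * (2 * bnd_M r)"
  have "((\<lambda>\<epsilon>. C * \<epsilon>) \<longlongrightarrow> C * 0) (at_right 0)" by (intro tendsto_intros)
  then have "\<forall>\<^sub>F \<epsilon> in at_right 0. C * \<epsilon> < e / 2" using \<open>e > 0\<close> by (intro order_tendstoD) auto
  moreover have "\<forall>\<^sub>F \<epsilon> in at_right 0. \<epsilon> \<in> {0<..<t}" using t by (rule eventually_at_right_real)
  moreover have "\<forall>\<^sub>F \<epsilon> in at_right 0. \<forall>z\<in>cball 0 r. dist ((1 / \<epsilon>) *\<^sub>R (\<phi> t z - \<phi> (t - \<epsilon>) z)) (G (\<phi> t z) t) < e / 2"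
    using uniform_limitD[OF quot, of "e / 2"] \<open>e > 0\<close> by simp
  ultimately show "\<forall>\<^sub>F \<epsilon> in at_right 0. \<forall>z\<in>cball 0 r.
      dist ((1 / \<epsilon>) *\<^sub>R (\<psi> \<epsilon> t z - \<phi> t z)) (h (\<phi> t z) - G (\<phi> t z) t) < e"
  proof eventually_elim
    case (elim \<epsilon>)
    then have \<epsilon>: "0 < \<epsilon>" "\<epsilon> < t" by auto
    show ?case
    proof
      fix z :: "complex ^ 'n" assume z: "z \<in> cball 0 r"
      let ?X = "\<psi> \<epsilon> t z - \<phi> (t - \<epsilon>) z - \<epsilon> *\<^sub>R h (\<phi> t z)" and ?Y = "(1 / \<epsilon>) *\<^sub>R (\<phi> t z - \<phi> (t - \<epsilon>) z) - G (\<phi> t z) t"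
      have "norm ?X \<le> C * \<epsilon>\<^sup>2"
        unfolding C_def by (rule needle_flow_estimate[OF G \<phi> h \<psi>[OF \<epsilon>] \<epsilon> _ r]) (use z in simp)
      then have "(1 / \<epsilon>) * norm ?X \<le> C * \<epsilon>" using \<epsilon> by (simp add: field_simps power2_eq_square)
      moreover have "norm ((1 / \<epsilon>) *\<^sub>R ?X) = (1 / \<epsilon>) * norm ?X" using \<epsilon> by simp
      ultimately have X: "norm ((1 / \<epsilon>) *\<^sub>R ?X) < e / 2" using elim(1) by linarith
      have Y: "norm ?Y < e / 2" using elim z by (simp add: dist_norm)
      have eq: "(1 / \<epsilon>) *\<^sub>R (\<psi> \<epsilon> t z - \<phi> t z) - (h (\<phi> t z) - G (\<phi> t z) t) = (1 / \<epsilon>) *\<^sub>R ?X - ?Y"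
        using \<epsilon> by (simp add: scaleR_diff_right)
      show "dist ((1 / \<epsilon>) *\<^sub>R (\<psi> \<epsilon> t z - \<phi> t z)) (h (\<phi> t z) - G (\<phi> t z) t) < e"
        unfolding dist_norm eq using X Y norm_triangle_ineq4[of "(1 / \<epsilon>) *\<^sub>R ?X" ?Y] by linarith
    qed
  qed
qed

text \<open>A chain rule at \<epsilon> = 0 that is uniform in \<open>z\<close>. Since
  \<open>w\<close> takes values in a closed ball of radius \<open>r < 1\<close>, the Taylor
  remainder of \<open>g\<close> is of order \<open>\<epsilon>\<^sup>2\<close> and its Jacobians are
  bounded, both uniformly.\<close>

lemma holo_compose_quotient:
  fixes g :: "complex ^ 'n::finite \<Rightarrow> complex ^ 'n"
  assumes g: "g \<in> Hol_ball" and r: "r < 1" and w: "\<And>z. z \<in> S \<Longrightarrow> norm (w z) \<le> r"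
    and k: "\<And>z. z \<in> S \<Longrightarrow> norm (k z) \<le> B"
    and lim: "uniform_limit S (\<lambda>\<epsilon> z. (1 / \<epsilon>) *\<^sub>R (p \<epsilon> z - w z)) k (at_right 0)"
  shows "uniform_limit S (\<lambda>\<epsilon> z. (1 / \<epsilon>) *\<^sub>R (g (p \<epsilon> z) - g (w z))) (\<lambda>z. complex_jacobian g (w z) *v k z) (at_right 0)"
proof (rule uniform_limitI)
  fix e :: real assume "e > 0"
  define R where "R = (1 - r) / 2"
  have R: "R > 0" using r by (simp add: R_def)
  have gh: "holo_at g x" if "norm x < 1" for x using g that by (simp add: Hol_ball_iff)
  have sub: "norm x \<le> (1 + r) / 2" if "x \<in> ball y R" "norm y \<le> r" for x y :: "complex ^ 'n"
    using that norm_triangle_sub[of x y] by (simp add: R_def dist_norm norm_minus_commute field_simps)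
  have "continuous_on (cball 0 ((1 + r) / 2)) g"
    using holo_at_isCont[OF gh] r by (auto intro!: continuous_at_imp_continuous_on)
  then obtain M where M: "\<And>x. x \<in> cball 0 ((1 + r) / 2) \<Longrightarrow> norm (g x) \<le> M"
    by (rule continuous_on_compact_norm_le[OF compact_cball]) (rule that)
  define M' where "M' = \<bar>M\<bar>"
  have rem: "norm v \<le> R / 2 \<Longrightarrow> norm (g (y + v) - g y - complex_jacobian g y *v v) \<le> 32 * M' / R\<^sup>2 * (norm v)\<^sup>2"
    and cau: "norm (complex_jacobian g y *v v) \<le> 2 * M' / R * norm v" if y: "norm y \<le> r" for y v
  proof -
    have 1: "holo_at g x" if "x \<in> ball y R" for x by (rule gh) (use sub[OF that y] r in simp)
    have 2: "norm (g x) \<le> M'" if "x \<in> ball y R" for x using M[of x] sub[OF that y] by (simp add: M'_def)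
    have 3: "(g has_derivative (\<lambda>v. complex_jacobian g y *v v)) (at y)"
      by (rule holo_at_has_derivative[OF gh]) (use y r in simp)
    show "norm v \<le> R / 2 \<Longrightarrow> norm (g (y + v) - g y - complex_jacobian g y *v v) \<le> 32 * M' / R\<^sup>2 * (norm v)\<^sup>2"
      by (rule holo_at_remainder(1)[OF 1 2 R 3])
    show "norm (complex_jacobian g y *v v) \<le> 2 * M' / R * norm v"
      by (rule holo_at_remainder(2)[OF 1 2 R 3])
  qed
  \<comment> \<open>Bounds the difference quotient, which is within \<open>d \<le> 1\<close> of
    \<open>k z\<close>. Displacements are then at most \<open>\<epsilon> * B1\<close>, and for
    \<open>\<epsilon> < R / (2 * B1)\<close> they stay in the range \<open>R / 2\<close> of the
    remainder estimate.\<close>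
  define B1 where "B1 = \<bar>B\<bar> + 1"
  have B1: "B1 > 0" by (simp add: B1_def)
  define K where "K = 32 * M' / R\<^sup>2 * B1\<^sup>2"
  define L where "L = 2 * M' / R + 1"
  have K: "K \<ge> 0" and L: "L > 0" using R by (auto simp: K_def L_def M'_def add_nonneg_pos)
  define d where "d = min 1 (e / (2 * L))"
  have d: "d > 0" "d \<le> 1" "L * d \<le> e / 2" using \<open>e > 0\<close> L by (auto simp: d_def min_def field_simps)
  have "((\<lambda>\<epsilon>. K * \<epsilon>) \<longlongrightarrow> K * 0) (at_right 0)" by (intro tendsto_intros)
  then have "\<forall>\<^sub>F \<epsilon> in at_right 0. K * \<epsilon> < e / 2" using \<open>e > 0\<close> by (intro order_tendstoD) auto
  moreover have "\<forall>\<^sub>F \<epsilon> in at_right 0. \<epsilon> \<in> {0<..<R / (2 * B1)}" using R B1 by (intro eventually_at_right_real) simp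
  moreover have "\<forall>\<^sub>F \<epsilon> in at_right 0. \<forall>z\<in>S. dist ((1 / \<epsilon>) *\<^sub>R (p \<epsilon> z - w z)) (k z) < d"
    using uniform_limitD[OF lim d(1)] .
  ultimately show "\<forall>\<^sub>F \<epsilon> in at_right 0. \<forall>z\<in>S.
      dist ((1 / \<epsilon>) *\<^sub>R (g (p \<epsilon> z) - g (w z))) (complex_jacobian g (w z) *v k z) < e"
  proof eventually_elim
    case (elim \<epsilon>)
    then have \<epsilon>: "0 < \<epsilon>" "\<epsilon> < R / (2 * B1)" by auto
    show ?case
    proof
      fix z assume z: "z \<in> S"
      define v where "v = p \<epsilon> z - w z"
      define q where "q = (1 / \<epsilon>) *\<^sub>R v"
      have vq: "v = \<epsilon> *\<^sub>R q" using \<epsilon> by (simp add: q_def)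
      have qk: "norm (q - k z) < d" using elim z by (simp add: q_def v_def dist_norm)
      then have "norm q \<le> B1" using k[OF z] d(2) norm_triangle_sub[of q "k z"] by (simp add: B1_def)
      then have nv: "norm v \<le> \<epsilon> * B1" using \<epsilon> by (simp add: vq)
      have "\<epsilon> * B1 \<le> R / 2" using \<epsilon> B1 by (simp add: field_simps)
      with nv have "norm v \<le> R / 2" by simp
      let ?J = "complex_jacobian g (w z)"
      let ?X = "g (w z + v) - g (w z) - ?J *v v"
      have "norm ?X \<le> 32 * M' / R\<^sup>2 * (norm v)\<^sup>2" by (rule rem[OF w[OF z] \<open>norm v \<le> R / 2\<close>])
      also have "\<dots> \<le> 32 * M' / R\<^sup>2 * (\<epsilon> * B1)\<^sup>2"
        using nv by (intro mult_left_mono power_mono) (auto simp: M'_def)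
      also have "\<dots> = (K * \<epsilon>) * \<epsilon>" by (simp add: K_def power2_eq_square)
      finally have "(1 / \<epsilon>) * norm ?X \<le> K * \<epsilon>" using \<epsilon> by (simp add: field_simps)
      moreover have "norm ((1 / \<epsilon>) *\<^sub>R ?X) = (1 / \<epsilon>) * norm ?X" using \<epsilon> by simp
      ultimately have X: "norm ((1 / \<epsilon>) *\<^sub>R ?X) < e / 2" using elim(1) by linarith
      have "norm (?J *v (q - k z)) \<le> 2 * M' / R * norm (q - k z)" by (rule cau[OF w[OF z]])
      also have "\<dots> \<le> L * d" unfolding L_def using qk R by (intro mult_mono) (auto simp: M'_def)
      finally have Y: "norm (?J *v (q - k z)) \<le> e / 2" using d(3) by simp
      have Jv: "?J *v v = \<epsilon> *\<^sub>R (?J *v q)"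
        by (simp add: vq scaleR_eq_vector_scalar_mult matrix_vector_mult_scale)
      have eq: "(1 / \<epsilon>) *\<^sub>R (g (p \<epsilon> z) - g (w z)) - ?J *v k z = (1 / \<epsilon>) *\<^sub>R ?X + ?J *v (q - k z)"
        unfolding Jv matrix_vector_mult_diff_distrib using \<epsilon> by (simp add: v_def scaleR_diff_right)
      show "dist ((1 / \<epsilon>) *\<^sub>R (g (p \<epsilon> z) - g (w z))) (?J *v k z) < e"
        unfolding dist_norm eq using X Y norm_triangle_ineq[of "(1 / \<epsilon>) *\<^sub>R ?X" "?J *v (q - k z)"] by linarith
    qed
  qed
qed

section \<open>The variation formula\<close>

lemma needle_variation:
  fixes G :: "complex ^ 'n::finite \<Rightarrow> real \<Rightarrow> complex ^ 'n"
  assumes G: "M_field G" and \<phi>: "M_flow G \<phi>" and f: "Loewner_limit \<phi> f" and h: "h \<in> class_M" and t: "t > 0"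
    and quot: "\<And>r. r < 1 \<Longrightarrow>
      uniform_limit (cball 0 r) (\<lambda>\<epsilon> z. (1 / \<epsilon>) *\<^sub>R (\<phi> t z - \<phi> (t - \<epsilon>) z)) (\<lambda>z. G (\<phi> t z) t) (at_right 0)"
  defines "V \<equiv> \<lambda>z. complex_jacobian f z *v (matrix_inv (complex_jacobian (\<phi> t) z) *v (h (\<phi> t z) - G (\<phi> t z) t))"
  obtains fe where "\<And>\<epsilon>. 0 < \<epsilon> \<Longrightarrow> \<epsilon> < t \<Longrightarrow> fe \<epsilon> \<in> class_S0 \<and> fe \<epsilon> \<in> Hol_ball"
    and "\<And>r. r < 1 \<Longrightarrow> uniform_limit (cball 0 r) (\<lambda>\<epsilon> z. (1 / \<epsilon>) *\<^sub>R (fe \<epsilon> z - f z)) V (at_right 0)"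
proof -
  let ?k = "\<lambda>z. h (\<phi> t z) - G (\<phi> t z) t"
  note H = M_field_needle[OF G h, of t]
  have "\<exists>\<psi> fe. M_flow (needle G h t \<epsilon>) \<psi> \<and> Loewner_limit \<psi> fe" for \<epsilon>
    by (rule M_flow_exists[OF H], rule M_flow_limit_exists[OF H], assumption) blast
  then obtain \<psi> fe where \<psi>: "\<And>\<epsilon>. M_flow (needle G h t \<epsilon>) (\<psi> \<epsilon>)" and fe: "\<And>\<epsilon>. Loewner_limit (\<psi> \<epsilon>) (fe \<epsilon>)"
    by metis
  note S = M_field_shift[OF G, of t]
  obtain \<Phi> where \<Phi>: "M_flow (\<lambda>z s. G z (t + s)) \<Phi>" by (rule M_flow_exists[OF S])
  obtain g where g: "Loewner_limit \<Phi> g" "g \<in> Hol_ball" by (rule M_flow_limit_exists[OF S \<Phi>])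
  have fz: "f z = exp t *\<^sub>R g (\<phi> t z)" if "z \<in> unit_ball" for z
    by (rule M_flow_limit_shift[OF G \<phi> \<Phi> f g(1) that]) (use t in simp)
  \<comment> \<open>The same \<Phi> and \<open>g\<close> serve for every \<epsilon>, because from
    time \<open>t\<close> on the perturbed field is \<open>G\<close>. Hence the limit maps differ
    only in the point at which \<open>g\<close> is evaluated.\<close>
  have fez: "fe \<epsilon> z = exp t *\<^sub>R g (\<psi> \<epsilon> t z)" if "z \<in> unit_ball" for z \<epsilon>
  proof (rule M_flow_limit_shift[OF H \<psi> _ fe _ that])
    have eq: "needle G h t \<epsilon> z (t + s) = G z (t + s)" if "s \<ge> 0" for z s using that by (simp add: needle_def)
    show "M_flow (\<lambda>z s. needle G h t \<epsilon> z (t + s)) \<Phi>"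
      unfolding M_flow_def M_trajectory_def
    proof (intro ballI allI impI conjI)
      fix z :: "complex ^ 'n" and T assume z: "z \<in> unit_ball"
      show "continuous_on {0..T} (\<lambda>t. \<Phi> t z)" by (rule M_flow_D(5)[OF \<Phi> z])
      fix s assume s: "s \<in> {0..T}"
      show "\<Phi> s z \<in> unit_ball" by (rule M_flow_D(2)[OF \<Phi> z]) (use s in simp)
      show "((\<lambda>s. needle G h t \<epsilon> (\<Phi> s z) (t + s)) has_integral \<Phi> s z - z) {0..s}"
        by (rule has_integral_eq[OF _ M_flow_D(3)[OF \<Phi> z]]) (use s eq in auto)
    qed
  qed (use t g in auto)
  have \<phi>n: "norm (\<phi> t z) \<le> norm z" if "z \<in> unit_ball" for z
    by (rule M_flow_norm_le[OF G \<phi> that]) (use t in simp)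
  \<comment> \<open>The inverse of \<open>?A\<close> meets \<open>?A\<close> as the right factor of
    the Jacobian of \<open>f\<close> and cancels, so only the Jacobian of \<open>g\<close>
    remains.\<close>
  have V: "V z = exp t *\<^sub>R (complex_jacobian g (\<phi> t z) *v ?k z)" if z: "z \<in> unit_ball" for z
  proof -
    let ?A = "complex_jacobian (\<phi> t) z" and ?B = "complex_jacobian g (\<phi> t z)"
    have dA: "(\<phi> t has_derivative (\<lambda>v. ?A *v v)) (at z)"
      by (rule holo_at_has_derivative[OF M_flow_holo_at[OF G \<phi> z]]) (use t in simp)
    have "\<phi> t z \<in> unit_ball" using M_flow_D(2)[OF \<phi> z, of t] t by simp
    then have dB: "(g has_derivative (\<lambda>v. ?B *v v)) (at (\<phi> t z))"
      using g(2) by (intro holo_at_has_derivative) (simp add: Hol_ball_iff)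
    have "((\<lambda>z. exp t *\<^sub>R g (\<phi> t z)) has_derivative (\<lambda>v. exp t *\<^sub>R (?B *v (?A *v v)))) (at z)"
      using has_derivative_scaleR_right[OF diff_chain_at[OF dA dB], of "exp t"] by (simp add: o_def)
    then have "(f has_derivative (\<lambda>v. exp t *\<^sub>R (?B *v (?A *v v)))) (at z)"
      by (rule has_derivative_unit_ball_cong[OF _ z]) (rule fz)
    then have "(f has_derivative (\<lambda>v. (exp t *\<^sub>R (?B ** ?A)) *v v)) (at z)"
      by (simp add: scaleR_matrix_vector_mult[symmetric] matrix_vector_mul_assoc)
    then have "complex_jacobian f z = exp t *\<^sub>R (?B ** ?A)" by (rule complex_jacobian_eqI)
    then have "V z = exp t *\<^sub>R (?B *v ((?A ** matrix_inv ?A) *v ?k z))"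
      by (simp add: V_def scaleR_matrix_vector_mult[symmetric] matrix_vector_mul_assoc[symmetric])
    then show ?thesis using M_flow_matrix_inv_jacobian[OF G \<phi> z, of t] t by simp
  qed
  show thesis
  proof
    fix \<epsilon> :: real assume "0 < \<epsilon>" "\<epsilon> < t"
    show "fe \<epsilon> \<in> class_S0 \<and> fe \<epsilon> \<in> Hol_ball"
      using M_field_class_S0[OF H \<psi> fe] Loewner_limit_Hol_ball[OF H \<psi> fe] by blast
  next
    fix r :: real assume r: "r < 1"
    have "uniform_limit (cball 0 r) (\<lambda>\<epsilon> z. (1 / \<epsilon>) *\<^sub>R (g (\<psi> \<epsilon> t z) - g (\<phi> t z)))
        (\<lambda>z. complex_jacobian g (\<phi> t z) *v ?k z) (at_right 0)"
    proof (rule holo_compose_quotient[OF g(2) r])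
      show "uniform_limit (cball 0 r) (\<lambda>\<epsilon> z. (1 / \<epsilon>) *\<^sub>R (\<psi> \<epsilon> t z - \<phi> t z)) ?k (at_right 0)"
        by (rule needle_flow_quotient[OF G \<phi> h t \<psi> r quot[OF r]])
      fix z :: "complex ^ 'n" assume "z \<in> cball 0 r"
      then show n: "norm (\<phi> t z) \<le> r" using \<phi>n[of z] r by simp
      show "norm (?k z) \<le> bnd_M r + bnd_M r"
        by (intro norm_triangle_le_diff add_mono class_M_bounded[OF h n r] class_M_bounded[OF M_field_D[OF G] n r])
    qed
    then have "uniform_limit (cball 0 r) (\<lambda>\<epsilon> z. exp t *\<^sub>R ((1 / \<epsilon>) *\<^sub>R (g (\<psi> \<epsilon> t z) - g (\<phi> t z))))
        (\<lambda>z. exp t *\<^sub>R (complex_jacobian g (\<phi> t z) *v ?k z)) (at_right 0)"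
      by (rule bounded_linear_uniform_limit_intros)
    moreover have 1: "exp t *\<^sub>R ((1 / \<epsilon>) *\<^sub>R (g (\<psi> \<epsilon> t z) - g (\<phi> t z))) = (1 / \<epsilon>) *\<^sub>R (fe \<epsilon> z - f z)" if "z \<in> cball 0 r" for z \<epsilon>
      using fz[of z] fez[of z \<epsilon>] that r by (simp add: scaleR_diff_right)
    ultimately show "uniform_limit (cball 0 r) (\<lambda>\<epsilon> z. (1 / \<epsilon>) *\<^sub>R (fe \<epsilon> z - f z)) V (at_right 0)"
      using V r by (subst (asm) uniform_limit_cong'[OF 1 V[symmetric]]) auto
  qed
qed

lemma needle_expansion:
  fixes G :: "complex ^ 'n::finite \<Rightarrow> real \<Rightarrow> complex ^ 'n"
  assumes G: "M_field G" and \<phi>: "M_flow G \<phi>" and f: "Loewner_limit \<phi> f" and h: "h \<in> class_M" and t: "t > 0"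
    and quot: "\<And>r. r < 1 \<Longrightarrow>
      uniform_limit (cball 0 r) (\<lambda>\<epsilon> z. (1 / \<epsilon>) *\<^sub>R (\<phi> t z - \<phi> (t - \<epsilon>) z)) (\<lambda>z. G (\<phi> t z) t) (at_right 0)"
  shows "\<exists>(f\<epsilon> :: real \<Rightarrow> complex ^ 'n \<Rightarrow> complex ^ 'n) (r :: real \<Rightarrow> complex ^ 'n \<Rightarrow> complex ^ 'n).
      (\<exists>\<epsilon>0>0. \<forall>\<epsilon>. 0 < \<epsilon> \<and> \<epsilon> < \<epsilon>0 \<longrightarrow>
         f\<epsilon> \<epsilon> \<in> class_S0 \<and> r \<epsilon> \<in> Hol_ball \<and>
         (\<forall>z\<in>unit_ball.
            f\<epsilon> \<epsilon> z = f z + \<epsilon> *\<^sub>R (complex_jacobian f z *v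
              (matrix_inv (complex_jacobian (\<phi> t) z) *v (h (\<phi> t z) - G (\<phi> t z) t))) + r \<epsilon> z)) \<and>
      locally_uniform_limit_ball (\<lambda>\<epsilon> z. (1 / \<epsilon>) *\<^sub>R r \<epsilon> z) (\<lambda>_. 0) (at_right 0)"
proof -
  define V where "V = (\<lambda>z. complex_jacobian f z *v (matrix_inv (complex_jacobian (\<phi> t) z) *v (h (\<phi> t z) - G (\<phi> t z) t)))"
  obtain fe where fe: "\<And>\<epsilon>. 0 < \<epsilon> \<Longrightarrow> \<epsilon> < t \<Longrightarrow> fe \<epsilon> \<in> class_S0 \<and> fe \<epsilon> \<in> Hol_ball"
    and lim: "\<And>r. r < 1 \<Longrightarrow> uniform_limit (cball 0 r) (\<lambda>\<epsilon> z. (1 / \<epsilon>) *\<^sub>R (fe \<epsilon> z - f z)) V (at_right 0)"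
    by (rule needle_variation[OF G \<phi> f h t quot, folded V_def]) (assumption, rule that)
  have f_hol: "f \<in> Hol_ball" by (rule Loewner_limit_Hol_ball[OF G \<phi> f])
  \<comment> \<open>The quotients \<open>(1 / \<epsilon>) *\<^sub>R (fe \<epsilon> z - f z)\<close>
    are holomorphic and converge to \<open>V\<close>, which avoids differentiating the inverse
    Jacobian.\<close>
  have "V \<in> Hol_ball"
  proof (rule Hol_ball_uniform_limit)
    \<comment> \<open>The offset 2 keeps every term strictly below \<open>t\<close>, where
      \<open>fe\<close> is known to be holomorphic, already at \<open>k = 0\<close>.\<close>
    have \<epsilon>lim: "filterlim (\<lambda>k. t / (real k + 2)) (at_right 0) sequentially" using t by real_asymp
    show "uniform_limit (cball 0 r) (\<lambda>k z. (1 / (t / (real k + 2))) *\<^sub>R (fe (t / (real k + 2)) z - f z)) V sequentially"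
      if "r < 1" for r
      unfolding uniform_limit_iff
      using eventually_compose_filterlim[OF _ \<epsilon>lim] lim[OF that, unfolded uniform_limit_iff] by blast
    fix k and x :: "complex ^ 'n" assume x: "x \<in> unit_ball"
    have "0 < t / (real k + 2)" "t / (real k + 2) < t" using t by (auto simp: field_simps add_pos_nonneg)
    then have "fe (t / (real k + 2)) \<in> Hol_ball" using fe by blast
    then show "holo_at (\<lambda>z. (1 / (t / (real k + 2))) *\<^sub>R (fe (t / (real k + 2)) z - f z)) x"
      using f_hol x by (intro holo_at_scaleR holo_at_diff) (simp_all add: Hol_ball_iff)
  qed
  then have V_hol: "holo_at V z" if "z \<in> unit_ball" for z using that by (simp add: Hol_ball_iff)
  define r where "r = (\<lambda>\<epsilon> z. fe \<epsilon> z - f z - \<epsilon> *\<^sub>R V z)"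
  have "locally_uniform_limit_ball (\<lambda>\<epsilon> z. (1 / \<epsilon>) *\<^sub>R r \<epsilon> z) (\<lambda>_. 0) (at_right 0)"
  proof (rule locally_uniform_limit_ballI, rule uniform_limitI)
    fix \<rho> e :: real assume "\<rho> < 1" "e > 0"
    have "\<forall>\<^sub>F \<epsilon> in at_right 0. \<forall>z\<in>cball 0 \<rho>. dist ((1 / \<epsilon>) *\<^sub>R (fe \<epsilon> z - f z)) (V z) < e"
      by (rule uniform_limitD[OF lim[OF \<open>\<rho> < 1\<close>] \<open>e > 0\<close>])
    moreover have "\<forall>\<^sub>F \<epsilon> in at_right 0. \<epsilon> \<in> {0<..<t}" using t by (rule eventually_at_right_real)
    ultimately show "\<forall>\<^sub>F \<epsilon> in at_right 0. \<forall>z\<in>cball 0 \<rho>. dist ((1 / \<epsilon>) *\<^sub>R r \<epsilon> z) 0 < e"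
    proof eventually_elim
      case (elim \<epsilon>)
      have "(1 / \<epsilon>) *\<^sub>R r \<epsilon> z = (1 / \<epsilon>) *\<^sub>R (fe \<epsilon> z - f z) - V z" for z
        using elim(2) by (simp add: r_def scaleR_diff_right)
      then show ?case using elim(1) by (simp add: dist_norm)
    qed
  qed
  moreover have "\<exists>\<epsilon>0>0. \<forall>\<epsilon>. 0 < \<epsilon> \<and> \<epsilon> < \<epsilon>0 \<longrightarrow> fe \<epsilon> \<in> class_S0 \<and> r \<epsilon> \<in> Hol_ball \<and>
      (\<forall>z\<in>unit_ball. fe \<epsilon> z = f z + \<epsilon> *\<^sub>R V z + r \<epsilon> z)"
  proof (intro exI[of _ t] conjI allI impI t; elim conjE)
    fix \<epsilon> assume \<epsilon>: "0 < \<epsilon>" "\<epsilon> < t"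
    show "fe \<epsilon> \<in> class_S0" using fe[OF \<epsilon>] by blast
    show "r \<epsilon> \<in> Hol_ball"
      unfolding Hol_ball_iff r_def
      using fe[OF \<epsilon>] f_hol V_hol by (auto intro!: holo_at_diff holo_at_scaleR simp: Hol_ball_iff)
    show "\<forall>z\<in>unit_ball. fe \<epsilon> z = f z + \<epsilon> *\<^sub>R V z + r \<epsilon> z" by (simp add: r_def)
  qed
  ultimately show ?thesis unfolding V_def by blast
qed

theorem theorem1p3:
  fixes f :: "complex ^ 'n::finite \<Rightarrow> complex ^ 'n"
    and G :: "complex ^ 'n \<Rightarrow> real \<Rightarrow> complex ^ 'n"
    and \<phi> :: "real \<Rightarrow> complex ^ 'n \<Rightarrow> complex ^ 'n"
  assumes "f \<in> class_S0"
    and "Herglotz_vector_field G"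
    and "Loewner_flow G \<phi>"
    and "Loewner_limit \<phi> f"
  shows "AE t in lebesgue_on {0..}. \<forall>h\<in>class_M.
    \<exists>(f\<epsilon> :: real \<Rightarrow> complex ^ 'n \<Rightarrow> complex ^ 'n) (r :: real \<Rightarrow> complex ^ 'n \<Rightarrow> complex ^ 'n).
      (\<exists>\<epsilon>0>0. \<forall>\<epsilon>. 0 < \<epsilon> \<and> \<epsilon> < \<epsilon>0 \<longrightarrow>
         f\<epsilon> \<epsilon> \<in> class_S0 \<and> r \<epsilon> \<in> Hol_ball \<and>
         (\<forall>z\<in>unit_ball.
            f\<epsilon> \<epsilon> z = f z + \<epsilon> *\<^sub>R (complex_jacobian f z *v
              (matrix_inv (complex_jacobian (\<phi> t) z) *v (h (\<phi> t z) - G (\<phi> t z) t))) + r \<epsilon> z)) \<and>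
      locally_uniform_limit_ball (\<lambda>\<epsilon> z. (1 / \<epsilon>) *\<^sub>R r \<epsilon> z) (\<lambda>_. 0) (at_right 0)"
    (is "AE t in _. ?P t")
proof -
  obtain G' N where G': "M_field G'" and N: "negligible N" and eq: "\<And>s z. s > 0 \<Longrightarrow> s \<notin> N \<Longrightarrow> G' z s = G z s"
    by (rule Herglotz_vector_field_M_field[OF assms(2)]) (rule that)
  have \<phi>: "M_flow G' \<phi>" by (rule Loewner_flow_M_flow[OF assms(3) N eq])
  obtain D :: "(complex ^ 'n) set" where D: "countable D" "\<And>X. open X \<Longrightarrow> X \<noteq> {} \<Longrightarrow> \<exists>d\<in>D. d \<in> X"
    using countable_dense_exists by blast
  define E where "E = (\<lambda>z. {t. t > 0 \<and> \<not> ((\<lambda>s. \<phi> s z) has_vector_derivative G' (\<phi> t z) t) (at t)})"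
  \<comment> \<open>At 0 there is no room for a window on the left, on \<open>N\<close> the field
    may have been redefined, and the sets \<open>E z\<close> collect the times without the required
    derivative. No \<open>h\<close> enters, so one null set serves all of
    \<open>class_M\<close>.\<close>
  define N' where "N' = {0} \<union> N \<union> (\<Union>z\<in>D \<inter> unit_ball. E z)"
  have "negligible (\<Union>z\<in>D \<inter> unit_ball. E z)"
  proof (rule negligible_countable_Union)
    show "countable (E ` (D \<inter> unit_ball))" using D(1) by (intro countable_image countable_Int1)
    show "negligible S" if "S \<in> E ` (D \<inter> unit_ball)" for S
      using that has_integral_derivative_negligible[OF M_flow_D(3)[OF \<phi>]] unfolding E_def by blast
  qed
  then have N': "negligible N'" unfolding N'_def using N by (intro negligible_Un) auto
  have meas: "{0::real..} \<in> sets lebesgue" by simp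
  show ?thesis
    unfolding AE_lebesgue_on_iff_negligible[OF meas]
  proof (intro negligible_subset[OF N'] subsetI, rule ccontr)
    fix t assume t: "t \<in> {t\<in>{0..}. \<not> ?P t}" and "t \<notin> N'"
    then have t0: "t > 0" "t \<notin> N" and der: "\<And>z. z \<in> D \<Longrightarrow> z \<in> unit_ball \<Longrightarrow>
        ((\<lambda>s. \<phi> s z) has_vector_derivative G' (\<phi> t z) t) (at t)"
      by (auto simp: N'_def E_def)
    note quot = M_flow_left_quotient_uniform[OF G' \<phi> t0(1) D(2) der]
    \<comment> \<open>The expansion involves the field at the single time \<open>t\<close> only, and
      \<open>t\<close> lies outside \<open>N\<close>, so there \<open>G'\<close> can be replaced by
      \<open>G\<close>.\<close>
    have "?P t" using needle_expansion[OF G' \<phi> assms(4) _ t0(1) quot] unfolding eq[OF t0] by blast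
    then show False using t by blast
  qed
qed

end
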